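(* Let $\Omega\subset\mathbb{R}^d$ be a bounded open set and let $1<p<\infty$. There exists a constant $C=C(\Omega,d,p)>0$, depending only on $\Omega$, $d$ and $p$, such that for all $0<t<s\leq 1$ one has $\Lambda^{s,p}_0(\Omega)\subset\Lambda^{t,p}_0(\Omega)$ and $$\|D^t u\|_{L^p(\mathbb{R}^d;\mathbb{R}^d)}\leq \frac{C}{t^{1+\frac1p}}\,\|D^s u\|_{L^p(\mathbb{R}^d;\mathbb{R}^d)}\qquad\text{for all } u\in\Lambda^{s,p}_0(\Omega).$$
   Context: Fractional gradient. For $r\in(0,1)$ and $\varphi\in C_c^\infty(\mathbb{R}^d)$ let $I_r\varphi(x)=\frac{\mu_{d,1-r}}{d-r}\int_{\mathbb{R}^d}\frac{\varphi(y)}{|x-y|^{d-r}}\,dy$ be the Riesz potential, where $\mu_{d,s}=\frac{2^s\Gamma((d+s+1)/2)}{\pi^{d/2}\Gamma((1-s)/2)}$. For $s\in(0,1)$, $D^s\varphi=D(I_{1-s}\varphi)$, where $D$ is the classical gradient, and for $\Phi\in C^\infty_c(\mathbb{R}^d;\mathbb{R}^d)$, $D^s\cdot\Phi=\sum_{j=1}^d (D^s\Phi_j)_j$. Also $D^1=D$. For $0<s<1$ and $u\in L^p(\mathbb{R}^d)$, the weak $s$-fractional gradient $D^su$ is the function $\Gamma\in L^1_{\mathrm{loc}}(\mathbb{R}^d;\mathbb{R}^d)$ (if it exists) such that $\int_{\mathbb{R}^d}u\,D^s\cdot\Phi\,dx=-\int_{\mathbb{R}^d}\Gamma\cdot\Phi\,dx$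 for all $\Phi\in C_c^\infty(\mathbb{R}^d;\mathbb{R}^d)$. Spaces. For $1<p<\infty$, $\Lambda^{s,p}(\mathbb{R}^d)=\{u\in L^p(\mathbb{R}^d): D^su\in L^p(\mathbb{R}^d;\mathbb{R}^d)\}$ with norm $\|u\|_{\Lambda^{s,p}(\mathbb{R}^d)}=(\|u\|^p_{L^p(\mathbb{R}^d)}+\|D^su\|^p_{L^p(\mathbb{R}^d;\mathbb{R}^d)})^{1/p}$, with $\Lambda^{1,p}(\mathbb{R}^d)=W^{1,p}(\mathbb{R}^d)$. For $\Omega\subset\mathbb{R}^d$ open, $\Lambda^{s,p}_0(\Omega)$ is the closure of $C^\infty_c(\Omega)$ in $\Lambda^{s,p}(\mathbb{R}^d)$, with the same norm; its elements are functions on $\mathbb{R}^d$ vanishing a.e. outside $\Omega$. *)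

theory Defs
  imports "HOL-Analysis.Analysis"
begin

text \<open>
  The space \<open>\<real>\<^sup>d\<close> is an arbitrary Euclidean space \<open>'a\<close> with \<open>d = DIM('a)\<close>.  Elements of \<open>L\<^sup>p\<close>
  are represented by functions, not by equivalence classes; every set of functions defined from
  \<open>Lp\<close> below is closed under modification on null sets.
\<close>

subsection \<open>Test functions\<close>

primrec Ck :: "nat \<Rightarrow> ('a::euclidean_space \<Rightarrow> 'b::real_normed_vector) \<Rightarrow> bool" where
  "Ck 0 f \<longleftrightarrow> continuous_on UNIV f"
| "Ck (Suc k) f \<longleftrightarrow> (\<forall>x. f differentiable (at x)) \<and>
     (\<forall>i\<in>Basis. Ck k (\<lambda>x. frechet_derivative f (at x) i))"

definition Cc_infinity :: "'a::euclidean_space set \<Rightarrow> ('a \<Rightarrow> 'b::real_normed_vector) set" where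
  "Cc_infinity \<Omega> = {f. (\<forall>k. Ck k f) \<and> compact (closure {x. f x \<noteq> 0}) \<and> closure {x. f x \<noteq> 0} \<subseteq> \<Omega>}"

subsection \<open>Lebesgue spaces\<close>

definition Lp :: "real \<Rightarrow> ('a::euclidean_space \<Rightarrow> 'b::euclidean_space) set" where
  "Lp p = {f. f \<in> borel_measurable lebesgue \<and> integrable lebesgue (\<lambda>x. norm (f x) powr p)}"

definition Lp_norm :: "real \<Rightarrow> ('a::euclidean_space \<Rightarrow> 'b::euclidean_space) \<Rightarrow> real" where
  "Lp_norm p f = (LINT x|lebesgue. norm (f x) powr p) powr (1 / p)"

definition L1_loc :: "('a::euclidean_space \<Rightarrow> 'b::euclidean_space) set" where
  "L1_loc = {f. \<forall>K. compact K \<longrightarrow> set_integrable lebesgue K f}"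

subsection \<open>Fractional gradient of test functions\<close>

definition mu :: "nat \<Rightarrow> real \<Rightarrow> real" where
  "mu d s = 2 powr s * Gamma ((real d + s + 1) / 2) / (pi powr (real d / 2) * Gamma ((1 - s) / 2))"

text \<open>
  The integrand takes the value \<open>0\<close> on the diagonal \<open>y = x\<close>, where the kernel is singular.
\<close>

definition riesz_potential :: "real \<Rightarrow> ('a::euclidean_space \<Rightarrow> real) \<Rightarrow> 'a \<Rightarrow> real" where
  "riesz_potential r \<phi> x = mu DIM('a) (1 - r) / (real DIM('a) - r) *
     (LINT y|lebesgue. \<phi> y / norm (x - y) powr (real DIM('a) - r))"

definition grad :: "('a::euclidean_space \<Rightarrow> real) \<Rightarrow> 'a \<Rightarrow> 'a" where
  "grad f x = (\<Sum>i\<in>Basis. frechet_derivative f (at x) i *\<^sub>R i)"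

definition test_frac_grad :: "real \<Rightarrow> ('a::euclidean_space \<Rightarrow> real) \<Rightarrow> 'a \<Rightarrow> 'a" where
  "test_frac_grad s \<phi> = (if s = 1 then grad \<phi> else grad (riesz_potential (1 - s) \<phi>))"

definition test_frac_div :: "real \<Rightarrow> ('a::euclidean_space \<Rightarrow> 'a) \<Rightarrow> 'a \<Rightarrow> real" where
  "test_frac_div s \<Phi> x = (\<Sum>j\<in>Basis. test_frac_grad s (\<lambda>y. \<Phi> y \<bullet> j) x \<bullet> j)"

subsection \<open>Weak fractional gradient\<close>

text \<open>
  For \<open>s = 1\<close> this is the usual weak gradient.  The relation is only meant for \<open>u\<close> in some
  \<open>L\<^sup>p\<close> with \<open>1 < p < \<infinity>\<close>; then both integrals converge.
\<close>

definition has_weak_frac_grad ::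
    "real \<Rightarrow> ('a::euclidean_space \<Rightarrow> real) \<Rightarrow> ('a \<Rightarrow> 'a) \<Rightarrow> bool" where
  "has_weak_frac_grad s u G \<longleftrightarrow> G \<in> L1_loc \<and>
     (\<forall>\<Phi>\<in>Cc_infinity UNIV.
        (LINT x|lebesgue. u x * test_frac_div s \<Phi> x) = - (LINT x|lebesgue. G x \<bullet> \<Phi> x))"

text \<open>
  The weak gradient is unique only up to null sets, so a representative is chosen.  If none exists
  the value is arbitrary; hence existence is a separate requirement in the definition of \<open>\<Lambda>\<^sup>s\<^sup>,\<^sup>p\<close>.
\<close>

definition frac_grad :: "real \<Rightarrow> ('a::euclidean_space \<Rightarrow> real) \<Rightarrow> 'a \<Rightarrow> 'a" where
  "frac_grad s u = (SOME G. has_weak_frac_grad s u G)"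

subsection \<open>The function spaces\<close>

definition Lam :: "real \<Rightarrow> real \<Rightarrow> ('a::euclidean_space \<Rightarrow> real) set" where
  "Lam s p = {u \<in> Lp p. (\<exists>G. has_weak_frac_grad s u G) \<and> frac_grad s u \<in> Lp p}"

definition Lam_norm :: "real \<Rightarrow> real \<Rightarrow> ('a::euclidean_space \<Rightarrow> real) \<Rightarrow> real" where
  "Lam_norm s p u = (Lp_norm p u powr p + Lp_norm p (frac_grad s u) powr p) powr (1 / p)"

definition Lam0 :: "real \<Rightarrow> real \<Rightarrow> 'a::euclidean_space set \<Rightarrow> ('a \<Rightarrow> real) set" where
  "Lam0 s p \<Omega> = {u \<in> Lam s p.
     \<forall>\<epsilon>>0. \<exists>\<phi>\<in>Cc_infinity \<Omega>. Lam_norm s p (\<lambda>x. u x - \<phi> x) < \<epsilon>}"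

end

theory Submission
  imports Defs "HOL-Probability.Distributions" "HOL-Computational_Algebra.Polynomial"
begin

text \<open>
  Let \<open>I\<^sub>a\<close> be the Riesz potential of order \<open>a\<close> and \<open>\<phi>\<close> a test function whose support lies in a fixed ball.
  Since \<open>D\<^sup>s\<phi> = I\<^sub>1\<^sub>-\<^sub>s D\<phi>\<close> and \<open>I\<^sub>a I\<^sub>b = I\<^sub>a\<^sub>+\<^sub>b\<close>, a lower order is reached by one more convolution,
  \<open>D\<^sup>t\<phi> = I\<^sub>s\<^sub>-\<^sub>t D\<^sup>s\<phi>\<close> (\<open>test_frac_grad_le_riesz\<close>).  The kernel of \<open>I\<^sub>a\<close> is \<open>c\<^sub>a |z|\<^bsup>a-d\<^esup>\<close> with
  \<open>c\<^sub>a \<le> \<kappa> a / (1 - a)\<close>, so its mass on a bounded set is at most a constant times \<open>1 / (1 - a)\<close>, hence times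
  \<open>1 / t\<close> for \<open>a = s - t\<close>.  On a bounded set this controls the part of the convolution that comes from a
  bounded set.  The kernel is not integrable at infinity, so everything else must come from decay:
  away from the support \<open>|D\<^sup>s\<phi>(x)| \<le> B \<parallel>\<phi>\<parallel>\<^sub>1 |x|\<^bsup>-d-s\<^esup>\<close> with \<open>B\<close> independent of \<open>s\<close>
  (\<open>test_frac_grad_decay\<close>).

  What remains is the Poincare inequality \<open>\<parallel>\<phi>\<parallel>\<^sub>1 \<le> C / s \<integral>\<^sub>|\<^sub>y\<^sub>|\<^sub>\<le>\<^sub>M |D\<^sup>s\<phi>|\<close> (\<open>poincare_L1\<close>).  It follows from the
  fractional fundamental theorem of calculus, used as the bound
  \<open>|\<phi>(x)| \<le> N \<integral> |x - y|\<^bsup>s-d\<^esup> |D\<^sup>s\<phi>(y)| dy\<close> (\<open>abs_test_function_le\<close>): integrated over the ball that contains the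
  support, its near part has mass of order \<open>1 / s\<close>, and its far part is, by the decay estimate, a small
  multiple of \<open>\<parallel>\<phi>\<parallel>\<^sub>1\<close> that is absorbed.  Together this gives \<open>\<parallel>D\<^sup>t\<phi>\<parallel>\<^sub>p \<le> C / t \<parallel>D\<^sup>s\<phi>\<parallel>\<^sub>p\<close> for test functions
  (\<open>test_frac_grad_comparison\<close>), and \<open>1 / t \<le> t\<^bsup>-1-1/p\<^esup>\<close>.

  Both kernel identities, the semigroup law and the fundamental theorem, come from the heat kernel
  \<open>G\<^sub>\<tau>\<close>.  Riesz kernels are integrals \<open>\<integral> \<tau>\<^bsup>a/2-1\<^esup> G\<^sub>\<tau> d\<tau>\<close>, so with \<open>G\<^sub>\<tau> * G\<^sub>\<sigma> = G\<^sub>\<tau>\<^sub>+\<^sub>\<sigma>\<close> a composition becomes a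
  Beta integral.  For the fundamental theorem, \<open>\<integral>\<^sub>0\<^sup>\<infinity> (\<nabla>G\<^sub>\<rho> * D\<phi>)(x) d\<rho> = - \<phi>(x)\<close>, which is the fundamental theorem
  along the curves \<open>\<rho> \<mapsto> x - \<surd>\<rho> w\<close> averaged over \<open>w\<close>.

  To pass to the closure, test functions that approximate \<open>u\<close> in the norm of order \<open>s\<close> have Cauchy
  gradients of order \<open>t\<close>.  Their limit is a weak gradient of \<open>u\<close>, and weak gradients are unique almost
  everywhere (\<open>Lam0_transfer\<close>).
\<close>

section \<open>Radial and one-dimensional integrals\<close>

lemma nn_integral_powr_Ioc:
  fixes a r :: real
  assumes "0 < a" "0 \<le> r"
  shows "(\<integral>\<^sup>+x. ennreal (x powr (a - 1)) * indicator {0<..r} x \<partial>lborel) = ennreal (r powr a / a)"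
proof -
  have "((\<lambda>x. x powr (a - 1)) has_integral (r powr (a - 1 + 1) / (a - 1 + 1))) {0..r}"
    using assms by (intro has_integral_powr_from_0) auto
  hence "(\<integral>\<^sup>+x. ennreal (x powr (a - 1)) * indicator {0..r} x \<partial>lborel) = ennreal (r powr a / a)"
    by (subst nn_integral_has_integral_lebesgue') auto
  moreover have "(\<integral>\<^sup>+x. ennreal (x powr (a - 1)) * indicator {0<..r} x \<partial>lborel) =
      (\<integral>\<^sup>+x. ennreal (x powr (a - 1)) * indicator {0..r} x \<partial>lborel)"
    by (intro nn_integral_cong_AE eventually_mono[OF AE_lborel_singleton[of 0]]) (auto simp: indicator_def)
  ultimately show ?thesis by simp
qed

lemma nn_integral_powr_Ici:
  fixes a r :: real
  assumes "0 < a" "0 < r"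
  shows "(\<integral>\<^sup>+x. ennreal (x powr (- a - 1)) * indicator {r..} x \<partial>lborel) = ennreal (r powr (- a) / a)"
proof -
  have "((\<lambda>x. x powr (- a - 1)) has_integral -(r powr (- a - 1 + 1)) / (- a - 1 + 1)) {r..}"
    using assms by (intro has_integral_powr_to_inf) auto
  thus ?thesis by (subst nn_integral_has_integral_lebesgue') auto
qed

text \<open>
  Both sides integrate \<open>f\<close> against the same measure on the line, since both give \<open>{..r}\<close> the volume of
  the ball of radius \<open>r\<close>.
\<close>
lemma nn_integral_radial:
  fixes f :: "real \<Rightarrow> ennreal"
  assumes [measurable]: "f \<in> borel_measurable borel"
  shows "(\<integral>\<^sup>+z. f (norm z) \<partial>(lborel :: 'a::euclidean_space measure)) =
    (\<integral>\<^sup>+r. ennreal (real DIM('a) * unit_ball_vol (real DIM('a)) * r powr (real DIM('a) - 1)) *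
        indicator {0<..} r * f r \<partial>lborel)"
proof -
  let ?d = "real DIM('a)"
  let ?w = "\<lambda>r. ennreal (?d * unit_ball_vol ?d * r powr (?d - 1)) * indicator {0<..} r"
  define M where "M = distr (lborel :: 'a measure) borel norm"
  define N where "N = density lborel ?w"
  have M_atMost: "emeasure M {..r} = ennreal (unit_ball_vol ?d * max 0 r ^ DIM('a))" for r
  proof (cases "r \<ge> 0")
    case True
    have "emeasure M {..r} = emeasure lborel (cball 0 r :: 'a set)"
      unfolding M_def by (subst emeasure_distr) (auto intro!: arg_cong[where f="emeasure lborel"])
    thus ?thesis using True emeasure_cball[OF True, of "0::'a"] by (simp add: max_def)
  next
    case False
    have "\<not> norm (x::'a) \<le> r" for x
      using False norm_ge_zero[of x] by linarith
    hence "norm -` {..r} = ({} :: 'a set)" by auto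
    thus ?thesis using False unfolding M_def by (subst emeasure_distr) auto
  qed
  have N_atMost: "emeasure N {..r} = ennreal (unit_ball_vol ?d * max 0 r ^ DIM('a))" for r
  proof -
    have "emeasure N {..r} = (\<integral>\<^sup>+x. ennreal (?d * unit_ball_vol ?d) *
       (ennreal (x powr (?d - 1)) * indicator {0<..max 0 r} x) \<partial>lborel)"
      unfolding N_def by (subst emeasure_density)
        (auto intro!: nn_integral_cong simp: indicator_def ennreal_mult' [symmetric] mult_ac)
    also have "\<dots> = ennreal (?d * unit_ball_vol ?d) * ennreal (max 0 r powr ?d / ?d)"
      by (subst nn_integral_cmult) (auto simp: nn_integral_powr_Ioc DIM_positive)
    also have "\<dots> = ennreal (unit_ball_vol ?d * max 0 r ^ DIM('a))"
      by (subst ennreal_mult' [symmetric])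
        (auto simp: powr_realpow' max_def)
    finally show ?thesis .
  qed
  have "M = N"
  proof (rule measure_eqI_generator_eq[where E="range atMost" and \<Omega>=UNIV and A="\<lambda>n. {..real n}"])
    show "Int_stable (range (atMost :: real \<Rightarrow> real set))"
      by (auto simp: Int_stable_def)
    show "sets M = sigma_sets UNIV (range atMost)" "sets N = sigma_sets UNIV (range atMost)"
      unfolding M_def N_def by (simp_all add: borel_eq_atMost[where 'a=real] image_def)
    show "(\<Union>i. {..real i}) = UNIV"
      by (auto simp: real_arch_simple)
  qed (auto simp: M_atMost N_atMost)
  have "(\<integral>\<^sup>+z. f (norm z) \<partial>(lborel :: 'a measure)) = (\<integral>\<^sup>+r. f r \<partial>M)"
    unfolding M_def by (subst nn_integral_distr) auto
  also have "\<dots> = (\<integral>\<^sup>+r. ?w r * f r \<partial>lborel)"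
    unfolding \<open>M = N\<close> N_def by (subst nn_integral_density) auto
  finally show ?thesis .
qed

lemma nn_integral_norm_powr_ball:
  assumes "0 < a" "0 \<le> r"
  shows "(\<integral>\<^sup>+z. ennreal (norm z powr (a - real DIM('a))) * indicator {..r} (norm z) \<partial>(lborel :: 'a::euclidean_space measure))
     = ennreal (real DIM('a) * unit_ball_vol (real DIM('a)) * r powr a / a)"
proof -
  let ?d = "real DIM('a)"
  have "(\<integral>\<^sup>+z. ennreal (norm z powr (a - ?d)) * indicator {..r} (norm z) \<partial>(lborel :: 'a measure)) =
    (\<integral>\<^sup>+\<rho>. ennreal (?d * unit_ball_vol ?d) * (ennreal (\<rho> powr (a - 1)) * indicator {0<..r} \<rho>) \<partial>lborel)"
    by (subst nn_integral_radial)
      (auto intro!: nn_integral_cong simp: indicator_def ennreal_mult' [symmetric] mult_ac powr_add[symmetric])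
  also have "\<dots> = ennreal (?d * unit_ball_vol ?d) * ennreal (r powr a / a)"
    using assms by (subst nn_integral_cmult) (auto simp: nn_integral_powr_Ioc)
  finally show ?thesis using assms by (simp add: ennreal_mult' [symmetric])
qed

lemma nn_integral_norm_powr_outside_ball:
  assumes "0 < e" "0 < r"
  shows "(\<integral>\<^sup>+z. ennreal (norm z powr (- real DIM('a) - e)) * indicator {r..} (norm z) \<partial>(lborel :: 'a::euclidean_space measure))
     = ennreal (real DIM('a) * unit_ball_vol (real DIM('a)) * r powr (- e) / e)"
proof -
  let ?d = "real DIM('a)"
  have "(\<integral>\<^sup>+z. ennreal (norm z powr (- ?d - e)) * indicator {r..} (norm z) \<partial>(lborel :: 'a measure)) =
    (\<integral>\<^sup>+\<rho>. ennreal (?d * unit_ball_vol ?d) * (ennreal (\<rho> powr (- e - 1)) * indicator {r..} \<rho>) \<partial>lborel)"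
    using assms by (subst nn_integral_radial)
      (auto intro!: nn_integral_cong simp: indicator_def ennreal_mult' [symmetric] mult_ac powr_add[symmetric] minus_diff_commute)
  also have "\<dots> = ennreal (?d * unit_ball_vol ?d) * ennreal (r powr (- e) / e)"
    using assms by (subst nn_integral_cmult) (auto simp: nn_integral_powr_Ici)
  finally show ?thesis using assms by (simp add: ennreal_mult' [symmetric])
qed

subsection \<open>Translations and dilations\<close>

lemma nn_integral_lborel_affine:
  fixes f :: "'a::euclidean_space \<Rightarrow> ennreal"
  assumes [measurable]: "f \<in> borel_measurable borel" and "c \<noteq> 0"
  shows "(\<integral>\<^sup>+x. f x \<partial>lborel) = ennreal (\<bar>c\<bar> ^ DIM('a)) * (\<integral>\<^sup>+x. f (t + c *\<^sub>R x) \<partial>lborel)"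
  by (subst lborel_affine[OF assms(2), of t])
     (simp add: nn_integral_density nn_integral_distr nn_integral_cmult ennreal_power)

lemma nn_integral_lborel_reflect:
  fixes f :: "'a::euclidean_space \<Rightarrow> ennreal"
  assumes [measurable]: "f \<in> borel_measurable borel"
  shows "(\<integral>\<^sup>+x. f (t - x) \<partial>lborel) = (\<integral>\<^sup>+x. f x \<partial>lborel)"
  using nn_integral_lborel_affine[OF assms, of "-1" t] by simp

lemma nn_integral_lborel_shift:
  fixes f :: "'a::euclidean_space \<Rightarrow> ennreal"
  assumes [measurable]: "f \<in> borel_measurable borel"
  shows "(\<integral>\<^sup>+x. f (x - t) \<partial>lborel) = (\<integral>\<^sup>+x. f x \<partial>lborel)"
  using nn_integral_lborel_affine[OF assms, of 1 "-t"] by simp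

lemma
  fixes f :: "'a::euclidean_space \<Rightarrow> 'b::{banach, second_countable_topology}"
  assumes "c \<noteq> 0"
  shows integrable_lborel_affine: "integrable lborel f \<Longrightarrow> integrable lborel (\<lambda>x. f (t + c *\<^sub>R x))"
    and integral_lborel_affine: "integrable lborel f \<Longrightarrow>
      (\<integral>x. f x \<partial>lborel) = \<bar>c\<bar> ^ DIM('a) *\<^sub>R (\<integral>x. f (t + c *\<^sub>R x) \<partial>lborel)"
proof -
  assume f: "integrable lborel f"
  hence [measurable]: "f \<in> borel_measurable borel" by auto
  have "ennreal (\<bar>c\<bar> ^ DIM('a)) * (\<integral>\<^sup>+x. norm (f (t + c *\<^sub>R x)) \<partial>lborel) < \<infinity>"
    using f nn_integral_lborel_affine[of "\<lambda>x. ennreal (norm (f x))" c t] assms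
    by (auto simp: integrable_iff_bounded)
  moreover have "ennreal (\<bar>c\<bar> ^ DIM('a)) > 0" using assms by simp
  ultimately have "(\<integral>\<^sup>+x. norm (f (t + c *\<^sub>R x)) \<partial>lborel) < \<infinity>"
    by (auto simp: ennreal_mult_less_top)
  thus i: "integrable lborel (\<lambda>x. f (t + c *\<^sub>R x))"
    by (intro integrableI_bounded) auto
  show "(\<integral>x. f x \<partial>lborel) = \<bar>c\<bar> ^ DIM('a) *\<^sub>R (\<integral>x. f (t + c *\<^sub>R x) \<partial>lborel)"
    by (subst lborel_affine[OF assms, of t]) (simp add: integral_density integral_distr)
qed

lemma integral_lborel_reflect:
  fixes f :: "'a::euclidean_space \<Rightarrow> 'b::{banach, second_countable_topology}"
  shows "(\<integral>x. f (t - x) \<partial>lborel) = (\<integral>x. f x \<partial>lborel)"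
proof (cases "integrable lborel f")
  case True
  thus ?thesis using integral_lborel_affine[of "-1" f t] by simp
next
  case False
  hence "\<not> integrable lborel (\<lambda>x. f (t - x))"
    using integrable_lborel_affine[of "-1" "\<lambda>x. f (t - x)" t] by auto
  thus ?thesis using False by (simp add: not_integrable_integral_eq)
qed

lemma integrable_lborel_reflect:
  fixes f :: "'a::euclidean_space \<Rightarrow> 'b::{banach, second_countable_topology}"
  shows "integrable lborel f \<Longrightarrow> integrable lborel (\<lambda>x. f (t - x))"
  using integrable_lborel_affine[of "-1" f t] by simp

section \<open>The heat kernel\<close>

definition heat_kernel :: "real \<Rightarrow> 'a::euclidean_space \<Rightarrow> real" where
  "heat_kernel \<tau> z = (4 * pi * \<tau>) powr (- real DIM('a) / 2) * exp (- (norm z)\<^sup>2 / (4 * \<tau>))"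

lemma heat_kernel_nonneg [simp]: "0 \<le> heat_kernel \<tau> z"
  by (simp add: heat_kernel_def)

lemma measurable_heat_kernel [measurable]:
  fixes z :: "'b \<Rightarrow> 'a::euclidean_space"
  assumes [measurable]: "\<tau> \<in> borel_measurable M" "z \<in> borel_measurable M"
  shows "(\<lambda>x. heat_kernel (\<tau> x) (z x)) \<in> borel_measurable M"
  unfolding heat_kernel_def by measurable

lemma heat_kernel_minus [simp]: "heat_kernel \<tau> (- z) = heat_kernel \<tau> z"
  by (simp add: heat_kernel_def)

text \<open>
  Over the coordinates the kernel factorises into normal densities, which gives its mass.
\<close>
lemma heat_kernel_eq_prod:
  fixes z :: "'a::euclidean_space"
  assumes "0 < \<tau>"
  shows "heat_kernel \<tau> z = (\<Prod>b\<in>Basis. normal_density 0 (sqrt (2 * \<tau>)) (z \<bullet> b))"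
proof -
  have "(\<Prod>b\<in>(Basis::'a set). normal_density 0 (sqrt (2 * \<tau>)) (z \<bullet> b)) =
     (1 / sqrt (4 * pi * \<tau>)) ^ DIM('a) * exp (\<Sum>b\<in>Basis. - (z \<bullet> b)\<^sup>2 / (4 * \<tau>))"
    using assms by (simp add: normal_density_def prod.distrib exp_sum prod_dividef mult_ac power_divide)
  also have "(\<Sum>b\<in>Basis. - (z \<bullet> b)\<^sup>2 / (4 * \<tau>)) = - (norm z)\<^sup>2 / (4 * \<tau>)"
    unfolding power2_norm_eq_inner euclidean_inner[of z z] by (simp add: sum_negf sum_divide_distrib power2_eq_square)
  also have "(1 / sqrt (4 * pi * \<tau>)) ^ DIM('a) = (4 * pi * \<tau>) powr (- real DIM('a) / 2)"
  proof -
    have "1 / sqrt (4 * pi * \<tau>) = (4 * pi * \<tau>) powr (- (1/2))"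
      using assms by (simp add: powr_minus_divide powr_half_sqrt)
    hence "(1 / sqrt (4 * pi * \<tau>)) ^ DIM('a) = ((4 * pi * \<tau>) powr (- (1/2))) powr real DIM('a)"
      using assms by (simp add: powr_realpow)
    thus ?thesis by (simp add: powr_powr)
  qed
  finally show ?thesis by (simp add: heat_kernel_def)
qed

lemma nn_integral_heat_kernel:
  assumes "0 < \<tau>"
  shows "(\<integral>\<^sup>+z. ennreal (heat_kernel \<tau> z) \<partial>(lborel :: 'a::euclidean_space measure)) = 1"
proof -
  have one: "(\<integral>\<^sup>+t. ennreal (normal_density 0 (sqrt (2 * \<tau>)) t) \<partial>lborel) = 1"
    using assms by (subst nn_integral_eq_integral) auto
  have "(\<integral>\<^sup>+z. ennreal (heat_kernel \<tau> z) \<partial>(lborel :: 'a measure)) =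
     (\<integral>\<^sup>+z. (\<Prod>b\<in>Basis. ennreal (normal_density 0 (sqrt (2 * \<tau>)) (z \<bullet> b))) \<partial>(lborel :: 'a measure))"
    using assms by (simp add: heat_kernel_eq_prod prod_ennreal)
  also have "\<dots> = 1"
    by (subst nn_integral_lborel_prod) (auto simp: one)
  finally show ?thesis .
qed

lemma exp_weights_mult:
  fixes p1 p2 p3 p4 e1 e2 e3 e4 :: real
  assumes "p1 * p2 = p3 * p4" "e1 + e2 = e3 + e4"
  shows "(p1 * exp e1) * (p2 * exp e2) = (p3 * exp e3) * (p4 * exp e4)"
proof -
  have "(p1 * exp e1) * (p2 * exp e2) = (p1 * p2) * exp (e1 + e2)" by (simp add: exp_add)
  also have "\<dots> = (p3 * exp e3) * (p4 * exp e4)" unfolding assms by (simp add: exp_add)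
  finally show ?thesis .
qed

text \<open>Completing the square in \<open>y\<close>.\<close>
lemma heat_kernel_mult:
  fixes x y :: "'a::euclidean_space"
  assumes "0 < \<tau>" "0 < \<sigma>"
  shows "heat_kernel \<tau> (x - y) * heat_kernel \<sigma> y =
    heat_kernel (\<tau> + \<sigma>) x * heat_kernel (\<tau> * \<sigma> / (\<tau> + \<sigma>)) (y - (\<sigma> / (\<tau> + \<sigma>)) *\<^sub>R x)"
proof -
  let ?k = "- real DIM('a) / 2"
  define X Y P where "X = x \<bullet> x" and "Y = y \<bullet> y" and "P = x \<bullet> y"
  have "(X - 2 * P + Y) / (4 * \<tau>) + Y / (4 * \<sigma>) = X / (4 * (\<tau> + \<sigma>)) +
      (Y - 2 * (\<sigma> / (\<tau> + \<sigma>)) * P + (\<sigma> / (\<tau> + \<sigma>))\<^sup>2 * X) / (4 * (\<tau> * \<sigma> / (\<tau> + \<sigma>)))"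
    using assms by (simp add: divide_simps power2_eq_square) (simp add: algebra_simps)
  moreover have "(norm (x - y))\<^sup>2 = X - 2 * P + Y"
    by (simp add: power2_norm_eq_inner X_def Y_def P_def algebra_simps inner_commute)
  moreover have "(norm (y - c *\<^sub>R x))\<^sup>2 = Y - 2 * c * P + c\<^sup>2 * X" for c
    unfolding power2_norm_eq_inner by (simp add: X_def Y_def P_def algebra_simps inner_commute power2_eq_square)
  moreover have "(norm x)\<^sup>2 = X" "(norm y)\<^sup>2 = Y"
    by (simp_all add: power2_norm_eq_inner X_def Y_def)
  ultimately have "- (norm (x - y))\<^sup>2 / (4 * \<tau>) + - (norm y)\<^sup>2 / (4 * \<sigma>) = - (norm x)\<^sup>2 / (4 * (\<tau> + \<sigma>)) +
      - (norm (y - (\<sigma> / (\<tau> + \<sigma>)) *\<^sub>R x))\<^sup>2 / (4 * (\<tau> * \<sigma> / (\<tau> + \<sigma>)))"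
    by (simp only: minus_divide_left [symmetric])
  moreover have "(4 * pi * \<tau>) powr ?k * (4 * pi * \<sigma>) powr ?k =
     (4 * pi * (\<tau> + \<sigma>)) powr ?k * (4 * pi * (\<tau> * \<sigma> / (\<tau> + \<sigma>))) powr ?k"
  proof -
    have "(4 * pi * \<tau>) * (4 * pi * \<sigma>) = (4 * pi * (\<tau> + \<sigma>)) * (4 * pi * (\<tau> * \<sigma> / (\<tau> + \<sigma>)))"
      using assms by simp
    thus ?thesis using assms by (simp only: powr_mult [symmetric])
  qed
  ultimately show ?thesis
    unfolding heat_kernel_def by (intro exp_weights_mult)
qed

lemma nn_integral_heat_kernel_shift:
  assumes "0 < \<tau>"
  shows "(\<integral>\<^sup>+y. ennreal (heat_kernel \<tau> (y - c)) \<partial>(lborel :: 'a::euclidean_space measure)) = 1"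
  using nn_integral_lborel_shift[of "\<lambda>y. ennreal (heat_kernel \<tau> y)" c] nn_integral_heat_kernel[OF assms]
  by simp

lemma heat_kernel_convolution:
  fixes x :: "'a::euclidean_space"
  assumes "0 < \<tau>" "0 < \<sigma>"
  shows "(\<integral>\<^sup>+y. ennreal (heat_kernel \<tau> (x - y)) * ennreal (heat_kernel \<sigma> y) \<partial>lborel) =
    ennreal (heat_kernel (\<tau> + \<sigma>) x)"
  using assms
  by (simp add: ennreal_mult' [symmetric] heat_kernel_mult)
    (simp add: ennreal_mult nn_integral_cmult nn_integral_heat_kernel_shift)

section \<open>Gamma and Beta integrals\<close>

lemma nn_integral_Gamma_scaled:
  fixes a A :: real
  assumes "0 < a" "0 < A"
  shows "(\<integral>\<^sup>+u. ennreal (u powr (a - 1) * exp (- A * u)) * indicator {0<..} u \<partial>lborel) =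
    ennreal (Gamma a * A powr (- a))"
proof -
  have "ennreal (Gamma a) = (\<integral>\<^sup>+t. ennreal (t powr (a - 1) / exp t) * indicator {0<..} t \<partial>lborel)"
    unfolding Gamma_conv_nn_integral_real[OF assms(1)]
    by (intro nn_integral_cong_AE eventually_mono[OF AE_lborel_singleton[of 0]]) (auto simp: indicator_def)
  also have "\<dots> = ennreal A * (\<integral>\<^sup>+u. ennreal ((A * u) powr (a - 1) / exp (A * u)) * indicator {0<..} u \<partial>lborel)"
    using assms by (subst nn_integral_real_affine[where c=A and t=0])
      (simp_all add: indicator_def zero_less_mult_iff)
  also have "\<dots> = ennreal A * (\<integral>\<^sup>+u. ennreal (A powr (a - 1)) *
       (ennreal (u powr (a - 1) * exp (- A * u)) * indicator {0<..} u) \<partial>lborel)"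
    using assms by (intro arg_cong2[where f="(*)", OF refl nn_integral_cong])
      (auto simp: indicator_def powr_mult ennreal_mult' [symmetric] exp_minus field_simps)
  also have "\<dots> = ennreal (A powr a) *
      (\<integral>\<^sup>+u. ennreal (u powr (a - 1) * exp (- A * u)) * indicator {0<..} u \<partial>lborel)"
    using assms by (subst nn_integral_cmult)
      (auto simp: mult.assoc [symmetric] ennreal_mult' [symmetric] powr_diff)
  finally have "ennreal (A powr (- a)) * ennreal (Gamma a) = ennreal (A powr (- a)) * (ennreal (A powr a) *
      (\<integral>\<^sup>+u. ennreal (u powr (a - 1) * exp (- A * u)) * indicator {0<..} u \<partial>lborel))"
    by simp
  also have "\<dots> = (\<integral>\<^sup>+u. ennreal (u powr (a - 1) * exp (- A * u)) * indicator {0<..} u \<partial>lborel)"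
    using assms by (simp add: mult.assoc [symmetric] ennreal_mult' [symmetric] powr_add [symmetric])
  finally show ?thesis using assms by (simp add: ennreal_mult' [symmetric] mult.commute)
qed

text \<open>The same integral after the inversion \<open>u = 1 / \<tau>\<close>.\<close>
lemma nn_integral_Gamma_inverted:
  fixes a A :: real
  assumes "0 < a" "0 < A"
  shows "(\<integral>\<^sup>+\<tau>. ennreal (\<tau> powr (- a - 1) * exp (- A / \<tau>)) * indicator {0<..} \<tau> \<partial>lborel) =
    ennreal (Gamma a * A powr (- a))"
proof -
  let ?f = "\<lambda>u. u powr (a - 1) * exp (- A * u)"
  let ?I = "Gamma a * A powr (- a)"
  have I: "?I \<ge> 0" using assms by (simp add: Gamma_real_pos less_imp_le)
  have "integrable lborel (\<lambda>u. ?f u * indicator {0<..} u)"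
    by (rule integrableI_nonneg)
      (use nn_integral_Gamma_scaled[OF assms] in \<open>auto simp: indicator_mult_ennreal mult.commute intro!: le_less_trans[OF nn_integral_mono, of _ _ "\<lambda>u. ennreal (?f u) * indicator {0<..} u"] split: split_indicator\<close>)
  hence int: "set_integrable lborel {0<..} ?f"
    by (simp add: set_integrable_def mult.commute)
  have 1: "?f absolutely_integrable_on {0<..}"
    using int by (simp add: set_integrable_def integrable_completion)
  have "ennreal (integral {0<..} ?f) = (\<integral>\<^sup>+u. ennreal (?f u) * indicator {0<..} u \<partial>lborel)"
    using 1 by (intro nn_integral_has_integral_lebesgue' [symmetric] integrable_integral set_lebesgue_integral_eq_integral(1)) auto
  also have "\<dots> = ennreal ?I" by (rule nn_integral_Gamma_scaled[OF assms])
  finally have 2: "integral {0<..} ?f = ?I"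
    using I integral_nonneg[OF set_lebesgue_integral_eq_integral(1)[OF 1]] by (subst (asm) ennreal_inj) auto
  have img: "inverse ` {0<..} = ({0<..} :: real set)"
    by (auto simp: image_iff intro!: bexI[of _ "inverse _"])
  have "(\<lambda>x. \<bar>- (inverse x ^ 2)\<bar> * ?f (inverse x)) absolutely_integrable_on {0<..} \<and>
     integral {0<..} (\<lambda>x. \<bar>- (inverse x ^ 2)\<bar> * ?f (inverse x)) = ?I"
    using 1 2 by (subst has_absolute_integral_change_of_variables_1')
      (auto simp: img power2_eq_square intro!: derivative_eq_intros inj_onI)
  hence "((\<lambda>x. \<bar>- (inverse x ^ 2)\<bar> * ?f (inverse x)) has_integral ?I) {0<..}"
    by (metis (no_types, lifting) integrable_integral set_lebesgue_integral_eq_integral(1))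
  hence "(\<integral>\<^sup>+\<tau>. ennreal (\<bar>- (inverse \<tau> ^ 2)\<bar> * ?f (inverse \<tau>)) * indicator {0<..} \<tau> \<partial>lborel) = ennreal ?I"
    by (intro nn_integral_has_integral_lebesgue') auto
  moreover have "\<bar>- (inverse \<tau> ^ 2)\<bar> * ?f (inverse \<tau>) = \<tau> powr (- a - 1) * exp (- A / \<tau>)" if "\<tau> > 0" for \<tau>
  proof -
    have "\<bar>- (inverse \<tau> ^ 2)\<bar> = \<tau> powr (- 2)"
      using that by (simp add: powr_minus powr_numeral power_inverse)
    moreover have "inverse \<tau> powr (a - 1) = \<tau> powr (- (a - 1))"
      using that powr_minus[of \<tau> "a - 1"] by (simp add: inverse_powr)
    ultimately show ?thesis
      using that by (simp add: powr_add [symmetric] divide_inverse minus_diff_commute)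
  qed
  ultimately show ?thesis
    by (subst (asm) nn_integral_cong[where v="\<lambda>\<tau>. ennreal (\<tau> powr (- a - 1) * exp (- A / \<tau>)) * indicator {0<..} \<tau>"])
      (auto simp: indicator_def)
qed

lemma nn_integral_Beta_scaled:
  fixes a b \<rho> :: real
  assumes "0 < a" "0 < b" "0 < \<rho>"
  shows "(\<integral>\<^sup>+\<tau>. ennreal (\<tau> powr (a - 1) * (\<rho> - \<tau>) powr (b - 1)) * indicator {0<..<\<rho>} \<tau> \<partial>lborel) =
    ennreal (Beta a b * \<rho> powr (a + b - 1))"
proof -
  have B: "(\<integral>\<^sup>+t. ennreal (t powr (a - 1) * (1 - t) powr (b - 1)) * indicator {0..1} t \<partial>lborel) = ennreal (Beta a b)"
    by (intro nn_integral_has_integral_lebesgue' has_integral_Beta_real assms) auto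
  have "(\<integral>\<^sup>+\<tau>. ennreal (\<tau> powr (a - 1) * (\<rho> - \<tau>) powr (b - 1)) * indicator {0<..<\<rho>} \<tau> \<partial>lborel) =
    ennreal \<rho> * (\<integral>\<^sup>+t. ennreal ((\<rho> * t) powr (a - 1) * (\<rho> - \<rho> * t) powr (b - 1)) * indicator {0<..<\<rho>} (\<rho> * t) \<partial>lborel)"
    using assms by (subst nn_integral_real_affine[where c=\<rho> and t=0]) auto
  also have "(\<integral>\<^sup>+t. ennreal ((\<rho> * t) powr (a - 1) * (\<rho> - \<rho> * t) powr (b - 1)) * indicator {0<..<\<rho>} (\<rho> * t) \<partial>lborel) =
     (\<integral>\<^sup>+t. ennreal (\<rho> powr (a + b - 2)) * (ennreal (t powr (a - 1) * (1 - t) powr (b - 1)) * indicator {0..1} t) \<partial>lborel)"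
  proof (intro nn_integral_cong_AE eventually_mono[OF eventually_conj[OF AE_lborel_singleton[of 0] AE_lborel_singleton[of 1]]])
    fix t :: real assume t: "t \<noteq> 0 \<and> t \<noteq> 1"
    show "ennreal ((\<rho> * t) powr (a - 1) * (\<rho> - \<rho> * t) powr (b - 1)) * indicator {0<..<\<rho>} (\<rho> * t) =
      ennreal (\<rho> powr (a + b - 2)) * (ennreal (t powr (a - 1) * (1 - t) powr (b - 1)) * indicator {0..1} t)"
    proof (cases "0 < t \<and> t < 1")
      case True
      have "\<rho> - \<rho> * t = \<rho> * (1 - t)" by (simp add: algebra_simps)
      hence "(\<rho> * t) powr (a - 1) * (\<rho> - \<rho> * t) powr (b - 1) =
         (\<rho> powr (a - 1) * \<rho> powr (b - 1)) * (t powr (a - 1) * (1 - t) powr (b - 1))"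
        using True assms by (simp add: powr_mult)
      also have "\<rho> powr (a - 1) * \<rho> powr (b - 1) = \<rho> powr (a + b - 2)"
        by (simp add: powr_add [symmetric])
      finally show ?thesis using True assms by (simp add: ennreal_mult' [symmetric])
    next
      case False
      thus ?thesis using t assms by (auto simp: indicator_def zero_less_mult_iff)
    qed
  qed
  also have "ennreal \<rho> * \<dots> = ennreal (\<rho> * \<rho> powr (a + b - 2) * Beta a b)"
    using assms by (subst nn_integral_cmult) (auto simp: B ennreal_mult' [symmetric] mult.assoc)
  also have "\<rho> * \<rho> powr (a + b - 2) = \<rho> powr (a + b - 1)"
    using assms powr_add[of \<rho> 1 "a + b - 2"] by (simp add: algebra_simps)
  finally show ?thesis by (simp add: mult.commute)
qed

text \<open>
  This is the density of the sum of two independent Gamma variables, without the exponential weight.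
  It turns iterated integrals over heat kernels into a single one.
\<close>
lemma nn_integral_powr_convolution:
  fixes a b :: real and f :: "real \<Rightarrow> ennreal"
  assumes "0 < a" "0 < b" and [measurable]: "f \<in> borel_measurable borel"
  shows "(\<integral>\<^sup>+\<tau>. \<integral>\<^sup>+\<sigma>. ennreal (\<tau> powr (a - 1)) * indicator {0<..} \<tau> *
      (ennreal (\<sigma> powr (b - 1)) * indicator {0<..} \<sigma>) * f (\<tau> + \<sigma>) \<partial>lborel \<partial>lborel) =
    ennreal (Beta a b) * (\<integral>\<^sup>+\<rho>. ennreal (\<rho> powr (a + b - 1)) * indicator {0<..} \<rho> * f \<rho> \<partial>lborel)"
proof -
  have "(\<integral>\<^sup>+\<tau>. \<integral>\<^sup>+\<sigma>. ennreal (\<tau> powr (a - 1)) * indicator {0<..} \<tau> *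
      (ennreal (\<sigma> powr (b - 1)) * indicator {0<..} \<sigma>) * f (\<tau> + \<sigma>) \<partial>lborel \<partial>lborel) =
    (\<integral>\<^sup>+\<tau>. \<integral>\<^sup>+\<rho>. ennreal (\<tau> powr (a - 1)) * indicator {0<..} \<tau> *
      (ennreal ((\<rho> - \<tau>) powr (b - 1)) * indicator {0<..} (\<rho> - \<tau>)) * f \<rho> \<partial>lborel \<partial>lborel)"
  proof (rule nn_integral_cong)
    fix \<tau> :: real
    show "(\<integral>\<^sup>+\<sigma>. ennreal (\<tau> powr (a - 1)) * indicator {0<..} \<tau> *
      (ennreal (\<sigma> powr (b - 1)) * indicator {0<..} \<sigma>) * f (\<tau> + \<sigma>) \<partial>lborel) =
      (\<integral>\<^sup>+\<rho>. ennreal (\<tau> powr (a - 1)) * indicator {0<..} \<tau> *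
      (ennreal ((\<rho> - \<tau>) powr (b - 1)) * indicator {0<..} (\<rho> - \<tau>)) * f \<rho> \<partial>lborel)"
      by (subst nn_integral_lborel_shift[where t=\<tau>, symmetric]) auto
  qed
  also have "\<dots> = (\<integral>\<^sup>+\<rho>. \<integral>\<^sup>+\<tau>. ennreal (\<tau> powr (a - 1)) * indicator {0<..} \<tau> *
      (ennreal ((\<rho> - \<tau>) powr (b - 1)) * indicator {0<..} (\<rho> - \<tau>)) * f \<rho> \<partial>lborel \<partial>lborel)"
    by (rule lborel_pair.Fubini') (auto simp: case_prod_unfold)
  also have "\<dots> = (\<integral>\<^sup>+\<rho>. ennreal (Beta a b) * (ennreal (\<rho> powr (a + b - 1)) * indicator {0<..} \<rho> * f \<rho>) \<partial>lborel)"
  proof (rule nn_integral_cong)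
    fix \<rho> :: real
    have "(\<integral>\<^sup>+\<tau>. ennreal (\<tau> powr (a - 1)) * indicator {0<..} \<tau> *
      (ennreal ((\<rho> - \<tau>) powr (b - 1)) * indicator {0<..} (\<rho> - \<tau>)) * f \<rho> \<partial>lborel) =
      (\<integral>\<^sup>+\<tau>. (ennreal (\<tau> powr (a - 1) * (\<rho> - \<tau>) powr (b - 1)) * indicator {0<..<\<rho>} \<tau>) * f \<rho> \<partial>lborel)"
      by (intro nn_integral_cong) (auto simp: indicator_def ennreal_mult')
    also have "\<dots> = (\<integral>\<^sup>+\<tau>. ennreal (\<tau> powr (a - 1) * (\<rho> - \<tau>) powr (b - 1)) * indicator {0<..<\<rho>} \<tau> \<partial>lborel) * f \<rho>"
      by (subst nn_integral_multc) auto
    also have "\<dots> = ennreal (Beta a b) * (ennreal (\<rho> powr (a + b - 1)) * indicator {0<..} \<rho> * f \<rho>)"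
    proof (cases "0 < \<rho>")
      case True
      have "0 \<le> Beta a b" using assms by (simp add: Beta_def Gamma_real_pos less_imp_le)
      thus ?thesis using True
        by (simp only: nn_integral_Beta_scaled[OF assms(1,2)]) (simp add: ennreal_mult mult.assoc)
    qed auto
    finally show "(\<integral>\<^sup>+\<tau>. ennreal (\<tau> powr (a - 1)) * indicator {0<..} \<tau> *
      (ennreal ((\<rho> - \<tau>) powr (b - 1)) * indicator {0<..} (\<rho> - \<tau>)) * f \<rho> \<partial>lborel) =
      ennreal (Beta a b) * (ennreal (\<rho> powr (a + b - 1)) * indicator {0<..} \<rho> * f \<rho>)" .
  qed
  also have "\<dots> = ennreal (Beta a b) * (\<integral>\<^sup>+\<rho>. ennreal (\<rho> powr (a + b - 1)) * indicator {0<..} \<rho> * f \<rho> \<partial>lborel)"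
    by (subst nn_integral_cmult) auto
  finally show ?thesis .
qed

section \<open>The gradient of the heat kernel\<close>

definition heat_grad :: "real \<Rightarrow> 'a::euclidean_space \<Rightarrow> 'a" where
  "heat_grad \<tau> z = - (heat_kernel \<tau> z / (2 * \<tau>)) *\<^sub>R z"

lemma measurable_heat_grad [measurable]:
  fixes z :: "'b \<Rightarrow> 'a::euclidean_space"
  assumes [measurable]: "\<tau> \<in> borel_measurable M" "z \<in> borel_measurable M"
  shows "(\<lambda>x. heat_grad (\<tau> x) (z x)) \<in> borel_measurable M"
  unfolding heat_grad_def by measurable

lemma integrable_heat_kernel:
  assumes "0 < \<tau>"
  shows "integrable (lborel :: 'a::euclidean_space measure) (heat_kernel \<tau>)"
  by (rule integrableI_nonneg) (auto simp: nn_integral_heat_kernel[OF assms])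

lemma integral_heat_kernel:
  assumes "0 < \<tau>"
  shows "(\<integral>z. heat_kernel \<tau> z \<partial>(lborel :: 'a::euclidean_space measure)) = 1"
  using nn_integral_eq_integral[OF integrable_heat_kernel[OF assms, where 'a='a]]
    nn_integral_heat_kernel[OF assms, where 'a='a]
  by (simp add: ennreal_eq_1)

text \<open>
  Doubling the time leaves a Gaussian factor that absorbs \<open>|z|\<close>.
\<close>
lemma norm_mult_heat_kernel_le:
  fixes z :: "'a::euclidean_space"
  assumes "0 < \<tau>"
  shows "norm z * heat_kernel \<tau> z \<le> (1 + 8 * \<tau>) * 2 powr (real DIM('a) / 2) * heat_kernel (2 * \<tau>) z"
proof -
  define u where "u = (norm z)\<^sup>2 / (8 * \<tau>)"
  have u: "0 \<le> u" using assms by (simp add: u_def)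
  have "0 \<le> (norm z)\<^sup>2 + 1 - 2 * norm z"
    using zero_le_power2[of "norm z - 1"] unfolding power2_diff by simp
  hence "norm z \<le> 1 + (norm z)\<^sup>2"
    using norm_ge_zero[of z] by linarith
  also have "\<dots> = 1 + 8 * \<tau> * u" using assms by (simp add: u_def)
  also have "\<dots> \<le> (1 + 8 * \<tau>) * (1 + u)"
    using u assms by (simp add: algebra_simps)
  also have "\<dots> \<le> (1 + 8 * \<tau>) * exp u"
    using assms exp_ge_add_one_self[of u] by (intro mult_left_mono) auto
  finally have "norm z * heat_kernel \<tau> z \<le> (1 + 8 * \<tau>) * (exp u * heat_kernel \<tau> z)"
    unfolding mult.assoc [symmetric] by (intro mult_right_mono) auto
  also have "exp u * heat_kernel \<tau> z = 2 powr (real DIM('a) / 2) * heat_kernel (2 * \<tau>) z"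
  proof -
    have "u + - (norm z)\<^sup>2 / (4 * \<tau>) = - (norm z)\<^sup>2 / (4 * (2 * \<tau>))"
      using assms by (simp add: u_def field_simps)
    moreover have "(4 * pi * \<tau>) powr (- real DIM('a) / 2) =
        2 powr (real DIM('a) / 2) * (4 * pi * (2 * \<tau>)) powr (- real DIM('a) / 2)"
    proof -
      have "4 * pi * (2 * \<tau>) = 2 * (4 * pi * \<tau>)" by simp
      moreover have "2 powr (real DIM('a) / 2) * 2 powr (- real DIM('a) / 2) = (1::real)"
        by (simp add: powr_add [symmetric])
      ultimately show ?thesis using assms by (simp only: powr_mult mult.assoc [symmetric])
    qed
    ultimately show ?thesis
      using exp_weights_mult[of 1 "(4 * pi * \<tau>) powr (- real DIM('a) / 2)" "2 powr (real DIM('a) / 2)"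
        "(4 * pi * (2 * \<tau>)) powr (- real DIM('a) / 2)" u "- (norm z)\<^sup>2 / (4 * \<tau>)" 0
        "- (norm z)\<^sup>2 / (4 * (2 * \<tau>))"]
      by (simp add: heat_kernel_def)
  qed
  finally show ?thesis by (simp add: mult.assoc)
qed

lemma integrable_norm_heat_kernel:
  assumes "0 < \<tau>"
  shows "integrable (lborel :: 'a::euclidean_space measure) (\<lambda>z. heat_kernel \<tau> z *\<^sub>R z)"
proof (rule Bochner_Integration.integrable_bound)
  show "integrable (lborel :: 'a measure)
      (\<lambda>z. (1 + 8 * \<tau>) * 2 powr (real DIM('a) / 2) * heat_kernel (2 * \<tau>) z)"
    using assms by (intro integrable_mult_right integrable_heat_kernel) auto
qed (use assms norm_mult_heat_kernel_le in \<open>auto simp: mult.commute intro!: AE_I2 order_trans[OF norm_mult_heat_kernel_le]\<close>)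

lemma integral_heat_kernel_odd:
  assumes "0 < \<tau>"
  shows "(\<integral>z. heat_kernel \<tau> z *\<^sub>R z \<partial>(lborel :: 'a::euclidean_space measure)) = 0"
proof -
  have "(\<integral>z. heat_kernel \<tau> z *\<^sub>R z \<partial>(lborel :: 'a measure)) = - (\<integral>z. heat_kernel \<tau> z *\<^sub>R z \<partial>lborel)"
    using integral_lborel_reflect[of "\<lambda>z. heat_kernel \<tau> z *\<^sub>R z :: 'a" 0] by simp
  thus ?thesis by (simp add: eq_neg_iff_add_eq_0 flip: scaleR_2)
qed

lemma integrable_heat_grad:
  assumes "0 < \<tau>"
  shows "integrable (lborel :: 'a::euclidean_space measure) (heat_grad \<tau>)"
  using integrable_scaleR_right[of "- 1 / (2 * \<tau>)", OF integrable_norm_heat_kernel[OF assms, where 'a='a]]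
  by (simp add: heat_grad_def[abs_def])

text \<open>
  After completing the square, \<open>x - y\<close> is a fixed multiple of \<open>x\<close> plus a vector that is odd about the
  centre of the remaining Gaussian and integrates to \<open>0\<close>.
\<close>
lemma heat_grad_convolution:
  fixes x :: "'a::euclidean_space"
  assumes "0 < \<tau>" "0 < \<sigma>"
  shows "(\<integral>y. heat_kernel \<sigma> y *\<^sub>R heat_grad \<tau> (x - y) \<partial>lborel) = heat_grad (\<tau> + \<sigma>) x"
proof -
  define \<theta> c where "\<theta> = \<tau> * \<sigma> / (\<tau> + \<sigma>)" and "c = \<sigma> / (\<tau> + \<sigma>)"
  have \<theta>: "0 < \<theta>" using assms by (simp add: \<theta>_def)
  define G where "G = (\<lambda>w::'a. - (heat_kernel (\<tau> + \<sigma>) x / (2 * \<tau>)) *\<^sub>R (heat_kernel \<theta> w *\<^sub>R ((1 - c) *\<^sub>R x) - heat_kernel \<theta> w *\<^sub>R w))"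
  have int: "integrable lborel (\<lambda>w. heat_kernel \<theta> w *\<^sub>R ((1 - c) *\<^sub>R x))" "integrable lborel (\<lambda>w::'a. heat_kernel \<theta> w *\<^sub>R w)"
    using \<theta> by (auto intro: integrable_norm_heat_kernel integrable_heat_kernel simp del: scaleR_scaleR)
  have intG: "integrable lborel G"
    unfolding G_def using int by (intro integrable_scaleR_right Bochner_Integration.integrable_diff)
  have eq: "heat_kernel \<sigma> y *\<^sub>R heat_grad \<tau> (x - y) = G (- (c *\<^sub>R x) + 1 *\<^sub>R y)" for y
  proof -
    have distrib: "- (A * h / (2 * \<tau>)) *\<^sub>R (u - w) = - (A / (2 * \<tau>)) *\<^sub>R (h *\<^sub>R u - h *\<^sub>R w)" for A h and u w :: 'a
      by (simp add: scaleR_right_diff_distrib)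
    have "heat_kernel \<sigma> y *\<^sub>R heat_grad \<tau> (x - y) =
        - (heat_kernel (\<tau> + \<sigma>) x * heat_kernel \<theta> (y - c *\<^sub>R x) / (2 * \<tau>)) *\<^sub>R (x - y)"
      using heat_kernel_mult[OF assms, of x y] by (simp add: heat_grad_def \<theta>_def c_def mult.commute)
    also have "\<dots> = - (heat_kernel (\<tau> + \<sigma>) x * heat_kernel \<theta> (y - c *\<^sub>R x) / (2 * \<tau>)) *\<^sub>R
        ((1 - c) *\<^sub>R x - (y - c *\<^sub>R x))"
      by (rule arg_cong) (simp add: algebra_simps)
    finally show ?thesis unfolding distrib by (simp add: G_def)
  qed
  have "(\<integral>y. heat_kernel \<sigma> y *\<^sub>R heat_grad \<tau> (x - y) \<partial>lborel) = (\<integral>w. G w \<partial>lborel)"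
    unfolding eq using integral_lborel_affine[of 1 G "- (c *\<^sub>R x)"] intG by simp
  also have "\<dots> = - (heat_kernel (\<tau> + \<sigma>) x / (2 * \<tau>)) *\<^sub>R ((1 - c) *\<^sub>R x)"
    unfolding G_def using int \<theta>
    by (subst integral_scaleR_right, subst Bochner_Integration.integral_diff)
      (auto simp: integral_heat_kernel_odd integral_heat_kernel integrable_heat_kernel simp del: scaleR_scaleR)
  also have "1 - c = \<tau> / (\<tau> + \<sigma>)"
    using assms by (simp add: c_def field_simps)
  also have "- (heat_kernel (\<tau> + \<sigma>) x / (2 * \<tau>)) *\<^sub>R ((\<tau> / (\<tau> + \<sigma>)) *\<^sub>R x) = heat_grad (\<tau> + \<sigma>) x"
    using assms by (simp add: heat_grad_def)
  finally show ?thesis .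
qed

section \<open>Riesz kernels\<close>

text \<open>
  In the usual form this constant is \<open>\<Gamma>((d - a) / 2) / (2\<^sup>a \<pi>\<^bsup>d/2\<^esup> \<Gamma>(a / 2))\<close>.
\<close>
definition riesz_const :: "nat \<Rightarrow> real \<Rightarrow> real" where
  "riesz_const d a = mu d (1 - a) / (real d - a)"

definition riesz_kernel :: "real \<Rightarrow> 'a::euclidean_space \<Rightarrow> real" where
  "riesz_kernel a z = riesz_const DIM('a) a / norm z powr (real DIM('a) - a)"

lemma measurable_riesz_kernel [measurable]:
  fixes z :: "'b \<Rightarrow> 'a::euclidean_space"
  assumes [measurable]: "z \<in> borel_measurable M"
  shows "(\<lambda>x. riesz_kernel a (z x)) \<in> borel_measurable M"
  unfolding riesz_kernel_def by measurable

lemma riesz_const_altdef: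
  assumes "0 < a" "a < real d"
  shows "riesz_const d a = Gamma ((real d - a) / 2) / (2 powr a * pi powr (real d / 2) * Gamma (a / 2))"
proof -
  have "Gamma ((real d + (1 - a) + 1) / 2) = Gamma ((real d - a) / 2 + 1)"
    by (rule arg_cong[where f=Gamma]) (simp add: field_simps)
  also have "\<dots> = (real d - a) / 2 * Gamma ((real d - a) / 2)"
    using assms by (intro Gamma_plus1) (auto simp: nonpos_Ints_def)
  finally have "Gamma ((real d + (1 - a) + 1) / 2) = (real d - a) / 2 * Gamma ((real d - a) / 2)" .
  moreover have "2 powr (1 - a) = 2 / 2 powr a" by (simp add: powr_diff)
  ultimately have "riesz_const d a = 2 / 2 powr a * ((real d - a) / 2 * Gamma ((real d - a) / 2)) /
      (pi powr (real d / 2) * Gamma ((1 - (1 - a)) / 2)) / (real d - a)"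
    by (simp only: riesz_const_def mu_def)
  thus ?thesis using assms by simp
qed

lemma riesz_const_pos:
  assumes "0 < a" "a < real d"
  shows "0 < riesz_const d a"
  using assms by (subst riesz_const_altdef) (auto intro!: divide_pos_pos mult_pos_pos Gamma_real_pos)

lemma riesz_kernel_nonneg:
  fixes z :: "'a::euclidean_space"
  assumes "0 < a" "a < real DIM('a)"
  shows "0 \<le> riesz_kernel a z"
  using riesz_const_pos[OF assms] by (simp add: riesz_kernel_def)

text \<open>
  Superpositions of heat kernels are powers of \<open>|z|\<close>, here also for exponents that do not belong to a
  Riesz kernel: for \<open>a = s - 1 \<le> 0\<close> the same integral gives the mass in time of the heat gradient.
\<close>
lemma nn_integral_heat_kernel_powr:
  fixes z :: "'a::euclidean_space"
  assumes "a < real DIM('a)" "z \<noteq> 0"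
  shows "(\<integral>\<^sup>+\<tau>. ennreal (\<tau> powr (a / 2 - 1)) * indicator {0<..} \<tau> * ennreal (heat_kernel \<tau> z) \<partial>lborel) =
    ennreal (Gamma ((real DIM('a) - a) / 2) / (2 powr a * pi powr (real DIM('a) / 2)) * norm z powr (a - real DIM('a)))"
proof -
  let ?d = "real DIM('a)"
  define b A where "b = (?d - a) / 2" and "A = (norm z)\<^sup>2 / 4"
  have b: "0 < b" and A: "0 < A" using assms by (auto simp: b_def A_def)
  have "(\<integral>\<^sup>+\<tau>. ennreal (\<tau> powr (a / 2 - 1)) * indicator {0<..} \<tau> * ennreal (heat_kernel \<tau> z) \<partial>lborel) =
    (\<integral>\<^sup>+\<tau>. ennreal ((4 * pi) powr (- ?d / 2)) * (ennreal (\<tau> powr (- b - 1) * exp (- A / \<tau>)) * indicator {0<..} \<tau>) \<partial>lborel)"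
  proof (rule nn_integral_cong)
    fix \<tau> :: real
    have "\<tau> powr (a / 2 - 1) * heat_kernel \<tau> z = (4 * pi) powr (- ?d / 2) * (\<tau> powr (- b - 1) * exp (- A / \<tau>))"
      if "0 < \<tau>"
    proof -
      have "a / 2 - 1 + - ?d / 2 = - b - 1" by (simp add: b_def field_simps)
      hence "\<tau> powr (a / 2 - 1) * \<tau> powr (- ?d / 2) = \<tau> powr (- b - 1)"
        by (simp only: powr_add [symmetric])
      thus ?thesis using that by (simp add: heat_kernel_def powr_mult A_def mult_ac)
    qed
    thus "ennreal (\<tau> powr (a / 2 - 1)) * indicator {0<..} \<tau> * ennreal (heat_kernel \<tau> z) =
      ennreal ((4 * pi) powr (- ?d / 2)) * (ennreal (\<tau> powr (- b - 1) * exp (- A / \<tau>)) * indicator {0<..} \<tau>)"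
      by (auto simp: indicator_def ennreal_mult' [symmetric])
  qed
  also have "\<dots> = ennreal ((4 * pi) powr (- ?d / 2) * (Gamma b * A powr (- b)))"
    using nn_integral_Gamma_inverted[OF b A] by (subst nn_integral_cmult) (auto simp: ennreal_mult' [symmetric])
  also have "(4 * pi) powr (- ?d / 2) * (Gamma b * A powr (- b)) =
     Gamma b / (2 powr a * pi powr (?d / 2)) * norm z powr (a - ?d)"
  proof -
    have "A powr (- b) = (norm z powr 2) powr (- b) / 4 powr (- b)"
      using assms by (simp add: A_def powr_divide powr_numeral)
    also have "(norm z powr 2) powr (- b) = norm z powr (a - ?d)"
    proof -
      have "2 * - b = a - ?d" by (simp add: b_def field_simps)
      thus ?thesis by (simp only: powr_powr)
    qed
    also have "norm z powr (a - ?d) / 4 powr (- b) = norm z powr (a - ?d) * (2 powr 2) powr b"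
      by (simp add: powr_minus divide_inverse)
    also have "(2 powr 2) powr b = 2 powr ?d / (2::real) powr a"
    proof -
      have "2 * b = ?d - a" by (simp add: b_def field_simps)
      thus ?thesis by (simp only: powr_powr) (simp add: powr_diff)
    qed
    finally have 1: "A powr (- b) = norm z powr (a - ?d) * (2 powr ?d / 2 powr a)" .
    have "(4 * pi) powr (- ?d / 2) = (2 powr 2) powr (- ?d / 2) * pi powr (- ?d / 2)"
      by (simp add: powr_mult)
    also have "\<dots> = 1 / (2 powr ?d * pi powr (?d / 2))"
      by (simp only: powr_powr) (simp add: powr_minus_divide)
    finally show ?thesis unfolding 1 by simp
  qed
  finally show ?thesis by (simp add: b_def)
qed

lemma riesz_kernel_subordination:
  fixes z :: "'a::euclidean_space"
  assumes "0 < a" "a < real DIM('a)" "z \<noteq> 0"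
  shows "(\<integral>\<^sup>+\<tau>. ennreal (\<tau> powr (a / 2 - 1)) * indicator {0<..} \<tau> * ennreal (heat_kernel \<tau> z) \<partial>lborel) =
    ennreal (Gamma (a / 2)) * ennreal (riesz_kernel a z)"
proof -
  have "0 < Gamma (a / 2)" using assms by (intro Gamma_real_pos) auto
  hence "0 \<le> Gamma (a / 2)" "Gamma (a / 2) \<noteq> 0" by linarith+
  moreover have "norm z powr (a - real DIM('a)) = 1 / norm z powr (real DIM('a) - a)"
    by (simp add: powr_minus_divide[symmetric])
  ultimately show ?thesis using assms
    by (subst nn_integral_heat_kernel_powr)
      (auto simp: ennreal_mult' [symmetric] riesz_kernel_def riesz_const_altdef)
qed

text \<open>
  Write both kernels as superpositions of heat kernels, convolve these first and combine the powers of
  the two times.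
\<close>
lemma riesz_kernel_convolution:
  fixes x :: "'a::euclidean_space"
  assumes "0 < a" "0 < b" "a + b < real DIM('a)" "x \<noteq> 0"
  shows "(\<integral>\<^sup>+y. ennreal (riesz_kernel a (x - y)) * ennreal (riesz_kernel b y) \<partial>lborel) =
    ennreal (riesz_kernel (a + b) x)"
proof -
  let ?wa = "\<lambda>\<tau>. ennreal (\<tau> powr (a / 2 - 1)) * indicator {0<..} \<tau> :: ennreal"
  let ?wb = "\<lambda>\<tau>. ennreal (\<tau> powr (b / 2 - 1)) * indicator {0<..} \<tau> :: ennreal"
  let ?H = "\<lambda>\<tau> z :: 'a. ennreal (heat_kernel \<tau> z)"
  have G: "0 < Gamma (a / 2)" "0 < Gamma (b / 2)" "0 < Gamma ((a + b) / 2)"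
    using assms by (auto intro: Gamma_real_pos)
  have "ennreal (Gamma (a / 2)) * ennreal (Gamma (b / 2)) *
      (\<integral>\<^sup>+y. ennreal (riesz_kernel a (x - y)) * ennreal (riesz_kernel b y) \<partial>lborel) =
    (\<integral>\<^sup>+y. (ennreal (Gamma (a / 2)) * ennreal (riesz_kernel a (x - y))) *
       (ennreal (Gamma (b / 2)) * ennreal (riesz_kernel b y)) \<partial>lborel)"
    by (subst nn_integral_cmult[symmetric]) (auto intro!: nn_integral_cong simp: mult_ac)
  also have "\<dots> = (\<integral>\<^sup>+y. (\<integral>\<^sup>+\<tau>. ?wa \<tau> * ?H \<tau> (x - y) \<partial>lborel) * (\<integral>\<^sup>+\<sigma>. ?wb \<sigma> * ?H \<sigma> y \<partial>lborel) \<partial>lborel)"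
  proof (intro nn_integral_cong_AE eventually_mono[OF eventually_conj[OF AE_lborel_singleton[of 0] AE_lborel_singleton[of x]]])
    fix y assume "y \<noteq> 0 \<and> y \<noteq> x"
    hence "y \<noteq> 0" "x - y \<noteq> 0" by auto
    thus "(ennreal (Gamma (a / 2)) * ennreal (riesz_kernel a (x - y))) * (ennreal (Gamma (b / 2)) * ennreal (riesz_kernel b y)) =
       (\<integral>\<^sup>+\<tau>. ?wa \<tau> * ?H \<tau> (x - y) \<partial>lborel) * (\<integral>\<^sup>+\<sigma>. ?wb \<sigma> * ?H \<sigma> y \<partial>lborel)"
      using assms by (subst (1 2) riesz_kernel_subordination) auto
  qed
  also have "\<dots> = (\<integral>\<^sup>+y. (\<integral>\<^sup>+\<tau>. \<integral>\<^sup>+\<sigma>. ?wa \<tau> * ?wb \<sigma> * (?H \<tau> (x - y) * ?H \<sigma> y) \<partial>lborel \<partial>lborel) \<partial>lborel)"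
    by (subst nn_integral_multc[symmetric], measurable)
      (intro nn_integral_cong, subst nn_integral_cmult[symmetric], auto intro!: nn_integral_cong simp: mult_ac)
  also have "\<dots> = (\<integral>\<^sup>+\<tau>. (\<integral>\<^sup>+y. \<integral>\<^sup>+\<sigma>. ?wa \<tau> * ?wb \<sigma> * (?H \<tau> (x - y) * ?H \<sigma> y) \<partial>lborel \<partial>lborel) \<partial>lborel)"
    by (rule lborel_pair.Fubini') (simp add: case_prod_unfold)
  also have "\<dots> = (\<integral>\<^sup>+\<tau>. (\<integral>\<^sup>+\<sigma>. \<integral>\<^sup>+y. ?wa \<tau> * ?wb \<sigma> * (?H \<tau> (x - y) * ?H \<sigma> y) \<partial>lborel \<partial>lborel) \<partial>lborel)"
    by (intro nn_integral_cong lborel_pair.Fubini') (simp add: case_prod_unfold)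
  also have "\<dots> = (\<integral>\<^sup>+\<tau>. (\<integral>\<^sup>+\<sigma>. ?wa \<tau> * ?wb \<sigma> * ?H (\<tau> + \<sigma>) x \<partial>lborel) \<partial>lborel)"
  proof (intro nn_integral_cong)
    fix \<tau> \<sigma> :: real
    show "(\<integral>\<^sup>+y. ?wa \<tau> * ?wb \<sigma> * (?H \<tau> (x - y) * ?H \<sigma> y) \<partial>lborel) = ?wa \<tau> * ?wb \<sigma> * ?H (\<tau> + \<sigma>) x"
      by (cases "0 < \<tau> \<and> 0 < \<sigma>")
        (auto simp: nn_integral_cmult heat_kernel_convolution indicator_def)
  qed
  also have "\<dots> = ennreal (Beta (a / 2) (b / 2)) *
      (\<integral>\<^sup>+\<rho>. ennreal (\<rho> powr (a / 2 + b / 2 - 1)) * indicator {0<..} \<rho> * ?H \<rho> x \<partial>lborel)"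
    using assms by (subst nn_integral_powr_convolution) auto
  also have "\<dots> = ennreal (Beta (a / 2) (b / 2)) * (ennreal (Gamma ((a + b) / 2)) * ennreal (riesz_kernel (a + b) x))"
    using assms by (subst riesz_kernel_subordination [symmetric]) (auto simp: add_divide_distrib)
  also have "\<dots> = ennreal (Gamma (a / 2)) * ennreal (Gamma (b / 2)) * ennreal (riesz_kernel (a + b) x)"
    using G by (simp add: mult.assoc[symmetric] ennreal_mult' [symmetric] Beta_def add_divide_distrib)
  finally have *: "ennreal (Gamma (a / 2) * Gamma (b / 2)) *
      (\<integral>\<^sup>+y. ennreal (riesz_kernel a (x - y)) * ennreal (riesz_kernel b y) \<partial>lborel) =
      ennreal (Gamma (a / 2) * Gamma (b / 2)) * ennreal (riesz_kernel (a + b) x)"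
    using G by (simp add: ennreal_mult' )
  show ?thesis
    using * G by (subst (asm) ennreal_mult_cancel_left) auto
qed

section \<open>Convolution with locally integrable kernels\<close>

definition locally_integrable :: "('a::euclidean_space \<Rightarrow> real) \<Rightarrow> bool" where
  "locally_integrable K \<longleftrightarrow> (\<forall>r. set_integrable lborel (cball 0 r) K)"

text \<open>
  Continuity is part of the notion, and the radius is explicit because the estimates depend on it.
\<close>
definition C0_ball :: "real \<Rightarrow> ('a::euclidean_space \<Rightarrow> 'b::euclidean_space) \<Rightarrow> bool" where
  "C0_ball R f \<longleftrightarrow> continuous_on UNIV f \<and> (\<forall>x. R \<le> norm x \<longrightarrow> f x = 0)"

definition convolve :: "('a::euclidean_space \<Rightarrow> real) \<Rightarrow> ('a \<Rightarrow> 'b::euclidean_space) \<Rightarrow> 'a \<Rightarrow> 'b" where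
  "convolve K f x = (\<integral>y. K (x - y) *\<^sub>R f y \<partial>lborel)"

lemma C0_ball_measurable:
  "C0_ball R f \<Longrightarrow> f \<in> borel_measurable borel"
  by (simp add: C0_ball_def borel_measurable_continuous_onI)

lemma C0_ball_bounded:
  assumes "C0_ball R f"
  obtains B where "0 \<le> B" "\<And>x. norm (f x) \<le> B"
proof -
  have "compact (f ` cball 0 R)"
    using assms by (intro compact_continuous_image)
      (auto simp: C0_ball_def intro: continuous_on_subset)
  then obtain B where B: "\<And>x. x \<in> cball 0 R \<Longrightarrow> norm (f x) \<le> B"
    by (metis bounded_iff compact_imp_bounded imageI)
  have "norm (f x) \<le> max 0 B" for x
  proof (cases "norm x \<le> R")
    case True
    thus ?thesis using B[of x] by auto
  next
    case False
    thus ?thesis using assms by (simp add: C0_ball_def)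
  qed
  thus ?thesis using that[of "max 0 B"] by auto
qed

lemma C0_ball_uniformly_continuous:
  assumes "C0_ball R f"
  shows "uniformly_continuous_on UNIV f"
  unfolding uniformly_continuous_on_def
proof (intro allI impI)
  fix e :: real assume e: "0 < e"
  have "uniformly_continuous_on (cball 0 (R + 1)) f"
    using assms by (intro compact_uniformly_continuous)
      (auto simp: C0_ball_def intro: continuous_on_subset)
  then obtain d where d: "0 < d"
    "\<And>x y. x \<in> cball 0 (R + 1) \<Longrightarrow> y \<in> cball 0 (R + 1) \<Longrightarrow> dist y x < d \<Longrightarrow> dist (f y) (f x) < e"
    using e unfolding uniformly_continuous_on_def by metis
  have "dist (f y) (f x) < e" if "dist y x < min 1 d" for x y
  proof (cases "norm x \<le> R \<or> norm y \<le> R")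
    case True
    have "norm x \<le> norm y + norm (y - x)" "norm y \<le> norm x + norm (y - x)"
      using norm_triangle_sub[of x y] norm_triangle_sub[of y x] by (simp_all add: norm_minus_commute)
    thus ?thesis using True that d(2)[of x y] by (auto simp: dist_norm)
  next
    case False
    thus ?thesis using assms e by (simp add: C0_ball_def)
  qed
  thus "\<exists>d>0. \<forall>x\<in>UNIV. \<forall>x'\<in>UNIV. dist x' x < d \<longrightarrow> dist (f x') (f x) < e"
    using d(1) by (intro exI[of _ "min 1 d"]) auto
qed

lemma locally_integrable_measurable:
  assumes "locally_integrable K"
  shows "K \<in> borel_measurable borel"
proof (rule borel_measurable_LIMSEQ_real)
  show "(\<lambda>i. indicat_real (cball 0 (real i)) x * K x) \<longlonglongrightarrow> K x" for x
  proof (rule tendsto_eventually)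
    obtain n :: nat where "norm x \<le> real n" using real_arch_simple by blast
    thus "\<forall>\<^sub>F i in sequentially. indicat_real (cball 0 (real i)) x * K x = K x"
      by (intro eventually_sequentiallyI[of n]) (auto simp: indicator_def)
  qed
  show "(\<lambda>x. indicat_real (cball 0 (real i)) x * K x) \<in> borel_measurable borel" for i
    using assms borel_measurable_integrable[of lborel]
    by (auto simp: locally_integrable_def set_integrable_def)
qed

lemma locally_integrable_nn_integral:
  assumes "locally_integrable K"
  shows "(\<integral>\<^sup>+z. ennreal (norm (K z)) * indicator (cball 0 r) z \<partial>lborel) < \<infinity>"
proof -
  have "integrable lborel (\<lambda>z. indicat_real (cball 0 r) z * K z)"
    using assms by (auto simp: locally_integrable_def set_integrable_def)
  hence "(\<integral>\<^sup>+z. ennreal (norm (indicat_real (cball 0 r) z * K z)) \<partial>lborel) < \<infinity>"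
    by (simp add: integrable_iff_bounded)
  also have "(\<integral>\<^sup>+z. ennreal (norm (indicat_real (cball 0 r) z * K z)) \<partial>lborel) =
    (\<integral>\<^sup>+z. ennreal (norm (K z)) * indicator (cball 0 r) z \<partial>lborel)"
    by (intro nn_integral_cong) (auto simp: indicator_def)
  finally show ?thesis .
qed

lemma convolution_integrable:
  fixes f :: "'a::euclidean_space \<Rightarrow> 'b::euclidean_space"
  assumes K: "locally_integrable K" and f: "C0_ball R f"
  shows "integrable lborel (\<lambda>y. K (x - y) *\<^sub>R f y)"
proof -
  obtain B where B: "0 \<le> B" "\<And>x. norm (f x) \<le> B" using C0_ball_bounded[OF f] by metis
  have [measurable]: "K \<in> borel_measurable borel" "f \<in> borel_measurable borel"
    using K f by (auto intro: locally_integrable_measurable C0_ball_measurable)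
  have "integrable lborel (\<lambda>z. B * (indicat_real (cball 0 (R + norm x)) z * K z))"
    using K by (auto simp: locally_integrable_def set_integrable_def)
  hence "integrable lborel (\<lambda>y. B * (indicat_real (cball 0 (R + norm x)) (x - y) * K (x - y)))"
    by (rule integrable_lborel_reflect)
  thus ?thesis
  proof (rule Bochner_Integration.integrable_bound)
    show "AE y in lborel. norm (K (x - y) *\<^sub>R f y) \<le> norm (B * (indicat_real (cball 0 (R + norm x)) (x - y) * K (x - y)))"
    proof (rule AE_I2)
      fix y
      show "norm (K (x - y) *\<^sub>R f y) \<le> norm (B * (indicat_real (cball 0 (R + norm x)) (x - y) * K (x - y)))"
      proof (cases "R \<le> norm y")
        case True thus ?thesis using f by (simp add: C0_ball_def)
      next
        case False
        hence "norm (x - y) \<le> R + norm x" using norm_triangle_ineq4[of x y] by linarith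
        thus ?thesis using B by (simp add: abs_mult mult.commute mult_right_mono mult_left_mono)
      qed
    qed
  qed auto
qed

lemma convolution_reflect:
  "convolve K f x = (\<integral>z. K z *\<^sub>R f (x - z) \<partial>lborel)"
  unfolding convolve_def using integral_lborel_reflect[of "\<lambda>z. K z *\<^sub>R f (x - z)" x] by simp

lemma convolution_integrable_reflect:
  assumes "locally_integrable K" "C0_ball R f"
  shows "integrable lborel (\<lambda>z. K z *\<^sub>R f (x - z))"
  using integrable_lborel_reflect[OF convolution_integrable[OF assms, of x], of x] by simp

lemma measurable_convolve [measurable]:
  fixes f :: "'a::euclidean_space \<Rightarrow> 'b::euclidean_space"
  assumes [measurable]: "K \<in> borel_measurable borel" "f \<in> borel_measurable borel"
  shows "convolve K f \<in> borel_measurable borel"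
  unfolding convolve_def[abs_def] by measurable

text \<open>
  This is applied to increments and to first-order remainders: they are uniformly small and vanish
  outside a fixed ball, and \<open>K\<close> has finite mass on bounded sets.
\<close>
lemma convolution_norm_bound:
  fixes f :: "'a::euclidean_space \<Rightarrow> 'b::euclidean_space"
  assumes K: "locally_integrable K" and f: "\<And>y. norm (f y) \<le> e" "\<And>y. R \<le> norm y \<Longrightarrow> f y = 0"
    and "0 \<le> e" "norm x + R \<le> r"
  shows "norm (\<integral>z. K z *\<^sub>R f (x - z) \<partial>lborel) \<le> e * (\<integral>z. indicat_real (cball 0 r) z * norm (K z) \<partial>lborel)"
proof -
  have "norm (\<integral>z. K z *\<^sub>R f (x - z) \<partial>lborel) \<le> (\<integral>z. e * (indicat_real (cball 0 r) z * norm (K z)) \<partial>lborel)"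
  proof (rule order_trans[OF integral_norm_bound integral_mono'])
    show "integrable lborel (\<lambda>z. e * (indicat_real (cball 0 r) z * norm (K z)))"
      using integrable_norm[of lborel "\<lambda>z. indicat_real (cball 0 r) z * K z"] K
      by (auto simp: locally_integrable_def set_integrable_def abs_mult)
    show "norm (K z *\<^sub>R f (x - z)) \<le> e * (indicat_real (cball 0 r) z * norm (K z))" for z
    proof (cases "R \<le> norm (x - z)")
      case False
      hence "norm z \<le> r" using assms norm_triangle_sub[of z x] by (simp add: norm_minus_commute)
      thus ?thesis using mult_right_mono[OF f(1)[of "x - z"], of "\<bar>K z\<bar>"] by (simp add: mult.commute)
    qed (use f assms in auto)
    show "0 \<le> e * (indicat_real (cball 0 r) z * norm (K z))" for z using assms by simp
  qed
  thus ?thesis by simp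
qed

lemma convolution_continuous:
  fixes f :: "'a::euclidean_space \<Rightarrow> 'b::euclidean_space"
  assumes K: "locally_integrable K" and f: "C0_ball R f"
  shows "continuous_on UNIV (convolve K f)"
  unfolding continuous_on_iff
proof (intro ballI allI impI)
  fix x :: 'a and e :: real assume e: "0 < e"
  define C where "C = (\<integral>z. indicat_real (cball 0 (norm x + (R + 1))) z * norm (K z) \<partial>lborel)"
  have C: "0 \<le> C" unfolding C_def by (intro integral_nonneg_AE) auto
  have e': "0 < e / (C + 1)" using e C by simp
  obtain d where d: "0 < d" "\<And>x y. dist y x < d \<Longrightarrow> dist (f y) (f x) < e / (C + 1)"
    using C0_ball_uniformly_continuous[OF f] e' unfolding uniformly_continuous_on_def by (metis UNIV_I)
  show "\<exists>d>0. \<forall>x'\<in>UNIV. dist x' x < d \<longrightarrow> dist (convolve K f x') (convolve K f x) < e"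
  proof (intro exI[of _ "min 1 d"] conjI ballI impI)
    fix x' assume x': "dist x' x < min 1 d"
    define h where "h = x' - x"
    have h: "norm h < 1" "norm h < d" using x' by (auto simp: h_def dist_norm)
    have "convolve K f x' - convolve K f x = (\<integral>z. K z *\<^sub>R (f (x - z + h) - f (x - z)) \<partial>lborel)"
      using convolution_integrable_reflect[OF K f, of x'] convolution_integrable_reflect[OF K f, of x]
      unfolding convolution_reflect
      by (subst Bochner_Integration.integral_diff[symmetric]) (auto simp: h_def scaleR_diff_right algebra_simps)
    also have "norm \<dots> \<le> e / (C + 1) * C"
    proof (rule convolution_norm_bound[OF K, where r="norm x + (R + 1)", folded C_def, where f="\<lambda>y. f (y + h) - f y" and x=x and R="R + 1"])
      show "norm (f (y + h) - f y) \<le> e / (C + 1)" for y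
        using d(2)[of "y + h" y] h by (auto simp: dist_norm)
      show "R + 1 \<le> norm y \<Longrightarrow> f (y + h) - f y = 0" for y
        using f h norm_triangle_sub[of y "y + h"] by (simp add: C0_ball_def)
    qed (use e C in auto)
    also have "\<dots> < e" using e C by (simp add: field_simps)
    finally show "dist (convolve K f x') (convolve K f x) < e" by (simp add: dist_norm)
  qed (use d in auto)
qed

section \<open>Differentiation of convolutions\<close>

definition C1_ball :: "real \<Rightarrow> ('a::euclidean_space \<Rightarrow> real) \<Rightarrow> ('a \<Rightarrow> 'a) \<Rightarrow> bool" where
  "C1_ball R \<phi> g \<longleftrightarrow> (\<forall>x. (\<phi> has_derivative (\<lambda>h. g x \<bullet> h)) (at x)) \<and>
     C0_ball R \<phi> \<and> C0_ball R g"

lemma C1_ball_remainder: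
  assumes "C1_ball R \<phi> g" "0 < e"
  obtains d where "0 < d" "\<And>y h. norm h < d \<Longrightarrow> \<bar>\<phi> (y + h) - \<phi> y - g y \<bullet> h\<bar> \<le> e * norm h"
proof -
  have "uniformly_continuous_on UNIV g"
    using assms by (auto simp: C1_ball_def intro: C0_ball_uniformly_continuous)
  then obtain d where d: "0 < d" "\<And>x y. dist y x < d \<Longrightarrow> dist (g y) (g x) < e"
    using assms(2) unfolding uniformly_continuous_on_def by (metis UNIV_I)
  have "\<bar>\<phi> (y + h) - \<phi> y - g y \<bullet> h\<bar> \<le> e * norm h" if h: "norm h < d" for y h
  proof -
    have "norm (\<phi> (y + h) - \<phi> y - (g y \<bullet> (y + h - y))) \<le> norm (y + h - y) * e"
    proof (rule differentiable_bound_linearization[where S="ball y d" and f'="\<lambda>x h. g x \<bullet> h" and ?x0.0=y and a=y and b="y + h"])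
      show "y + t *\<^sub>R (y + h - y) \<in> ball y d" if "t \<in> {0..1}" for t
        using that h mult_right_mono[of t 1 "norm h"] by (auto simp: dist_norm)
      show "(\<phi> has_derivative (\<lambda>h. g x \<bullet> h)) (at x within ball y d)" for x
        using assms by (auto simp: C1_ball_def intro: has_derivative_at_withinI)
      show "onorm ((\<lambda>h. g x \<bullet> h) - (\<lambda>h. g y \<bullet> h)) \<le> e" if "x \<in> ball y d" for x
        unfolding fun_diff_def
      proof (rule onorm_le)
        fix v
        have "norm (g x \<bullet> v - g y \<bullet> v) \<le> norm (g x - g y) * norm v"
          by (simp add: inner_diff_left [symmetric] Cauchy_Schwarz_ineq2)
        also have "\<dots> \<le> e * norm v"
          using d(2)[of x y] that by (intro mult_right_mono) (auto simp: dist_norm norm_minus_commute)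
        finally show "norm (g x \<bullet> v - g y \<bullet> v) \<le> e * norm v" .
      qed
      show "y \<in> ball y d" using d by simp
    qed
    thus ?thesis by (simp add: mult.commute)
  qed
  thus ?thesis using that d(1) by blast
qed

text \<open>
  The remainder of the first-order expansion of \<open>\<phi>\<close> is uniformly \<open>o(h)\<close> and supported in one fixed
  ball, where the kernel has finite mass.
\<close>
lemma convolution_has_derivative:
  fixes \<phi> :: "'a::euclidean_space \<Rightarrow> real"
  assumes K: "locally_integrable K" and \<phi>: "C1_ball R \<phi> g"
  shows "(convolve K \<phi> has_derivative (\<lambda>h. convolve K g x \<bullet> h)) (at x)"
  unfolding has_derivative_at_alt
proof (intro conjI allI impI)
  show "bounded_linear (\<lambda>h. convolve K g x \<bullet> h)" by (rule bounded_linear_inner_right)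
  fix e :: real assume e: "0 < e"
  define C where "C = (\<integral>z. indicat_real (cball 0 (norm x + (R + 1))) z * norm (K z) \<partial>lborel)"
  have C: "0 \<le> C" unfolding C_def by (intro integral_nonneg_AE) auto
  have e': "0 < e / (C + 1)" using e C by simp
  obtain d where d: "0 < d" "\<And>y h. norm h < d \<Longrightarrow> \<bar>\<phi> (y + h) - \<phi> y - g y \<bullet> h\<bar> \<le> e / (C + 1) * norm h"
    using C1_ball_remainder[OF \<phi> e'] by metis
  have cs: "C0_ball R \<phi>" "C0_ball R g" using \<phi> by (auto simp: C1_ball_def)
  show "\<exists>d>0. \<forall>x'. norm (x' - x) < d \<longrightarrow> norm (convolve K \<phi> x' - convolve K \<phi> x - convolve K g x \<bullet> (x' - x)) \<le> e * norm (x' - x)"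
  proof (intro exI[of _ "min 1 d"] conjI allI impI)
    fix x' assume x': "norm (x' - x) < min 1 d"
    define h where "h = x' - x"
    have h: "norm h < 1" "norm h < d" using x' by (auto simp: h_def)
    note i = convolution_integrable_reflect[OF K cs(1)] convolution_integrable_reflect[OF K cs(2)]
    have "convolve K \<phi> x' - convolve K \<phi> x - convolve K g x \<bullet> h =
       (\<integral>z. K z *\<^sub>R \<phi> (x' - z) - K z *\<^sub>R \<phi> (x - z) - (K z *\<^sub>R g (x - z)) \<bullet> h \<partial>lborel)"
      unfolding convolution_reflect using i(1)[of x'] i(1)[of x] i(2)[of x]
      by (simp del: inner_scaleR_left real_scaleR_def)
    also have "\<dots> = (\<integral>z. K z *\<^sub>R (\<phi> (x - z + h) - \<phi> (x - z) - g (x - z) \<bullet> h) \<partial>lborel)"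
      by (intro Bochner_Integration.integral_cong) (auto simp: h_def algebra_simps)
    also have "norm \<dots> \<le> (e / (C + 1) * norm h) * C"
    proof (rule convolution_norm_bound[OF K, where r="norm x + (R + 1)", folded C_def, where f="\<lambda>y. \<phi> (y + h) - \<phi> y - g y \<bullet> h" and x=x and R="R + 1"])
      show "norm (\<phi> (y + h) - \<phi> y - g y \<bullet> h) \<le> e / (C + 1) * norm h" for y
        using d(2)[of h y] h by auto
      show "R + 1 \<le> norm y \<Longrightarrow> \<phi> (y + h) - \<phi> y - g y \<bullet> h = 0" for y
        using cs h norm_triangle_sub[of y "y + h"] by (simp add: C0_ball_def)
    qed (use e C in auto)
    also have "\<dots> \<le> e * norm h" using e C by (simp add: field_simps mult_left_mono)
    finally show "norm (convolve K \<phi> x' - convolve K \<phi> x - convolve K g x \<bullet> (x' - x)) \<le> e * norm (x' - x)"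
      by (simp add: h_def)
  qed (use d in auto)
qed

lemma locally_integrable_const: "locally_integrable (\<lambda>_::'a::euclidean_space. c)"
proof -
  have "integrable lborel (\<lambda>x. c * indicat_real (cball 0 r :: 'a set) x)" for r
    using emeasure_lborel_cball_finite[of "0::'a" r]
    by (intro integrable_mult_right integrable_real_indicator) auto
  thus ?thesis by (simp add: locally_integrable_def set_integrable_def mult.commute)
qed

text \<open>Convolution with a constant does not depend on the point, so its gradient vanishes.\<close>
lemma integral_gradient_eq_0:
  assumes "C1_ball R \<phi> g"
  shows "(\<integral>x. g x \<partial>lborel) = 0"
proof -
  have const: "convolve (\<lambda>_. 1) \<phi> = (\<lambda>x. \<integral>y. \<phi> y \<partial>lborel)"
    by (simp add: convolve_def fun_eq_iff)
  have "((\<lambda>x. \<integral>y. \<phi> y \<partial>lborel) has_derivative (\<lambda>h. convolve (\<lambda>_. 1) g 0 \<bullet> h)) (at 0)"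
    using convolution_has_derivative[OF locally_integrable_const[of 1] assms, of 0] unfolding const by simp
  hence "(\<lambda>h. convolve (\<lambda>_. 1) g 0 \<bullet> h) = (\<lambda>h. 0)"
    by (rule has_derivative_unique) (rule has_derivative_const)
  hence "convolve (\<lambda>_. 1) g 0 \<bullet> convolve (\<lambda>_. 1) g 0 = 0" by metis
  thus ?thesis by (simp add: convolve_def)
qed

text \<open>
  The gradient of the product \<open>u \<psi>\<close> has integral zero.
\<close>
lemma integration_by_parts:
  fixes u \<psi> :: "'a::euclidean_space \<Rightarrow> real"
  assumes u: "\<And>x. (u has_derivative (\<lambda>h. v x \<bullet> h)) (at x)" "continuous_on UNIV v"
    and \<psi>: "C1_ball R \<psi> g"
  shows "(\<integral>x. u x * (g x \<bullet> i) \<partial>lborel) = - (\<integral>x. (v x \<bullet> i) * \<psi> x \<partial>lborel)"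
proof -
  have cu: "continuous_on UNIV u"
    using u(1) by (intro continuous_at_imp_continuous_on ballI has_derivative_continuous) auto
  have cs: "C0_ball R \<psi>" "C0_ball R g" and d: "\<And>x. (\<psi> has_derivative (\<lambda>h. g x \<bullet> h)) (at x)"
    using \<psi> by (auto simp: C1_ball_def)
  have cc: "C0_ball R (\<lambda>x. u x *\<^sub>R g x)" "C0_ball R (\<lambda>x. \<psi> x *\<^sub>R v x)"
     "C0_ball R (\<lambda>x. u x * \<psi> x)"
    using cs cu u(2) by (auto simp: C0_ball_def intro!: continuous_intros)
  have int: "integrable lborel (\<lambda>x. u x *\<^sub>R g x)" "integrable lborel (\<lambda>x. \<psi> x *\<^sub>R v x)"
    using convolution_integrable[OF locally_integrable_const[of 1] cc(1)]
      convolution_integrable[OF locally_integrable_const[of 1] cc(2)] by auto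
  have "C1_ball R (\<lambda>x. u x * \<psi> x) (\<lambda>x. u x *\<^sub>R g x + \<psi> x *\<^sub>R v x)"
    unfolding C1_ball_def
  proof (intro conjI allI)
    show "((\<lambda>x. u x * \<psi> x) has_derivative (\<lambda>h. (u x *\<^sub>R g x + \<psi> x *\<^sub>R v x) \<bullet> h)) (at x)" for x
      by (rule has_derivative_eq_rhs[OF has_derivative_mult[OF u(1) d]]) (auto simp: inner_add_left algebra_simps)
    show "C0_ball R (\<lambda>x. u x *\<^sub>R g x + \<psi> x *\<^sub>R v x)"
      using cc by (auto simp: C0_ball_def intro!: continuous_intros)
  qed fact
  from integral_gradient_eq_0[OF this]
  have "(\<integral>x. u x *\<^sub>R g x \<partial>lborel) + (\<integral>x. \<psi> x *\<^sub>R v x \<partial>lborel) = 0"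
    using int by simp
  hence "(\<integral>x. u x *\<^sub>R g x \<partial>lborel) \<bullet> i = - ((\<integral>x. \<psi> x *\<^sub>R v x \<partial>lborel) \<bullet> i)"
    by (simp add: eq_neg_iff_add_eq_0 flip: inner_add_left)
  also have "(\<integral>x. u x *\<^sub>R g x \<partial>lborel) \<bullet> i = (\<integral>x. (u x *\<^sub>R g x) \<bullet> i \<partial>lborel)"
    using int by (intro integral_inner_left [symmetric]) auto
  also have "(\<integral>x. \<psi> x *\<^sub>R v x \<partial>lborel) \<bullet> i = (\<integral>x. (\<psi> x *\<^sub>R v x) \<bullet> i \<partial>lborel)"
    using int by (intro integral_inner_left [symmetric]) auto
  finally show ?thesis by (simp add: mult.commute)
qed

text \<open>
  Fubini's theorem, with \<open>K(x - y) = K(y - x)\<close>.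
\<close>
lemma convolution_adjoint:
  fixes a b :: "'a::euclidean_space \<Rightarrow> real"
  assumes K: "locally_integrable K" "\<And>z. K (- z) = K z"
    and a: "C0_ball R a" and b: "C0_ball R b"
  shows "(\<integral>x. a x * convolve K b x \<partial>lborel) = (\<integral>x. convolve K a x * b x \<partial>lborel)"
proof -
  have [measurable]: "K \<in> borel_measurable borel" "a \<in> borel_measurable borel" "b \<in> borel_measurable borel"
    using K a b by (auto intro: locally_integrable_measurable C0_ball_measurable)
  obtain B where B: "0 \<le> B" "\<And>x. norm (b x) \<le> B" using C0_ball_bounded[OF b] by metis
  have meas': "(\<lambda>z. ennreal (norm (K z)) * indicator (cball 0 r) z) \<in> borel_measurable lborel" for r
    by (intro borel_measurable_times_ennreal borel_measurable_indicator) auto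
  have meas: "(\<lambda>z. ennreal B * (ennreal (norm (K z)) * indicator (cball 0 r) z)) \<in> borel_measurable borel" for r
    by (intro borel_measurable_times_ennreal borel_measurable_indicator) auto
  have bb: "(\<integral>\<^sup>+y. ennreal (norm (K (x - y) * b y)) \<partial>lborel) \<le>
      ennreal B * (\<integral>\<^sup>+z. ennreal (norm (K z)) * indicator (cball 0 (2 * R)) z \<partial>lborel)" if "norm x \<le> R" for x
  proof -
    have "(\<integral>\<^sup>+y. ennreal (norm (K (x - y) * b y)) \<partial>lborel) \<le>
      (\<integral>\<^sup>+y. ennreal B * (ennreal (norm (K (x - y))) * indicator (cball 0 (2 * R)) (x - y)) \<partial>lborel)"
    proof (rule nn_integral_mono)
      fix y
      show "ennreal (norm (K (x - y) * b y)) \<le> ennreal B * (ennreal (norm (K (x - y))) * indicator (cball 0 (2 * R)) (x - y))"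
      proof (cases "R \<le> norm y")
        case True thus ?thesis using b by (simp add: C0_ball_def)
      next
        case False
        hence "norm (x - y) \<le> 2 * R" using norm_triangle_ineq4[of x y] that by linarith
        thus ?thesis using B(1) mult_right_mono[OF B(2)[of y], of "\<bar>K (x - y)\<bar>"]
          by (simp add: ennreal_mult' [symmetric] abs_mult mult.commute ennreal_leI)
      qed
    qed
    also have "\<dots> = (\<integral>\<^sup>+z. ennreal B * (ennreal (norm (K z)) * indicator (cball 0 (2 * R)) z) \<partial>lborel)"
      by (rule nn_integral_lborel_reflect[OF meas])
    finally show ?thesis by (simp only: nn_integral_cmult[OF meas'])
  qed
  have fin: "ennreal B * (\<integral>\<^sup>+z. ennreal (norm (K z)) * indicator (cball 0 (2 * R)) z \<partial>lborel) < \<infinity>"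
    using locally_integrable_nn_integral[OF K(1)] by (simp add: ennreal_mult_less_top)
  have "integrable lborel a" using convolution_integrable[OF locally_integrable_const[of 1] a] by simp
  hence ia: "(\<integral>\<^sup>+x. ennreal (norm (a x)) \<partial>lborel) < \<infinity>" by (simp add: integrable_iff_bounded)
  have int: "integrable (lborel \<Otimes>\<^sub>M lborel) (\<lambda>(x, y). a x * (K (x - y) * b y))"
  proof (rule integrableI_bounded)
    have "(\<integral>\<^sup>+p. ennreal (norm (case p of (x, y) \<Rightarrow> a x * (K (x - y) * b y))) \<partial>(lborel \<Otimes>\<^sub>M lborel)) =
      (\<integral>\<^sup>+x. \<integral>\<^sup>+y. ennreal (norm (a x)) * ennreal (norm (K (x - y) * b y)) \<partial>lborel \<partial>lborel)"
      by (subst lborel.nn_integral_fst [symmetric]) (auto simp: ennreal_mult' abs_mult)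
    also have "\<dots> \<le> (\<integral>\<^sup>+x. ennreal (norm (a x)) * (ennreal B * (\<integral>\<^sup>+z. ennreal (norm (K z)) * indicator (cball 0 (2 * R)) z \<partial>lborel)) \<partial>lborel)"
    proof (rule nn_integral_mono)
      fix x
      show "(\<integral>\<^sup>+y. ennreal (norm (a x)) * ennreal (norm (K (x - y) * b y)) \<partial>lborel) \<le>
        ennreal (norm (a x)) * (ennreal B * (\<integral>\<^sup>+z. ennreal (norm (K z)) * indicator (cball 0 (2 * R)) z \<partial>lborel))"
        using a bb[of x] by (cases "R \<le> norm x") (auto simp: C0_ball_def nn_integral_cmult intro!: mult_left_mono)
    qed
    also have "\<dots> = (\<integral>\<^sup>+x. ennreal (norm (a x)) \<partial>lborel) * (ennreal B * (\<integral>\<^sup>+z. ennreal (norm (K z)) * indicator (cball 0 (2 * R)) z \<partial>lborel))"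
      by (subst nn_integral_multc) auto
    also have "\<dots> < \<infinity>" using fin ia by (simp add: ennreal_mult_less_top)
    finally show "(\<integral>\<^sup>+p. ennreal (norm (case p of (x, y) \<Rightarrow> a x * (K (x - y) * b y))) \<partial>(lborel \<Otimes>\<^sub>M lborel)) < \<infinity>" .
  qed (simp add: case_prod_unfold)
  have "(\<integral>x. a x * convolve K b x \<partial>lborel) = (\<integral>x. \<integral>y. a x * (K (x - y) * b y) \<partial>lborel \<partial>lborel)"
    by (simp add: convolve_def)
  also have "\<dots> = (\<integral>y. \<integral>x. a x * (K (x - y) * b y) \<partial>lborel \<partial>lborel)"
    using lborel_pair.Fubini_integral[OF int] by simp
  also have "\<dots> = (\<integral>y. convolve K a y * b y \<partial>lborel)"
  proof (rule Bochner_Integration.integral_cong)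
    fix y
    have "K (x - y) = K (y - x)" for x using K(2)[of "x - y"] by simp
    hence "(\<integral>x. a x * (K (x - y) * b y) \<partial>lborel) = (\<integral>x. (K (y - x) *\<^sub>R a x) * b y \<partial>lborel)"
      by (intro Bochner_Integration.integral_cong) auto
    also have "\<dots> = convolve K a y * b y" unfolding convolve_def by (rule integral_mult_left_zero)
    finally show "(\<integral>x. a x * (K (x - y) * b y) \<partial>lborel) = convolve K a y * b y" .
  qed simp
  finally show ?thesis .
qed

section \<open>Test functions and their fractional gradients\<close>

lemma Ck_imp_continuous: "Ck k f \<Longrightarrow> continuous_on UNIV f"
  by (cases k) (auto intro!: continuous_at_imp_continuous_on differentiable_imp_continuous_within)

lemma Ck_bounded_linear:
  assumes "bounded_linear L" "Ck k f"
  shows "Ck k (\<lambda>x. L (f x))"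
  using assms(2)
proof (induction k arbitrary: f)
  case 0
  thus ?case using bounded_linear.continuous_on[OF assms(1)] by simp
next
  case (Suc k)
  have d: "((\<lambda>x. L (f x)) has_derivative (\<lambda>h. L (frechet_derivative f (at x) h))) (at x)" for x
    using Suc.prems by (intro bounded_linear.has_derivative[OF assms(1)]) (auto simp: frechet_derivative_works)
  hence "frechet_derivative (\<lambda>x. L (f x)) (at x) = (\<lambda>h. L (frechet_derivative f (at x) h))" for x
    by (rule frechet_derivative_at[symmetric])
  thus ?case using Suc d by (auto simp: differentiable_def)
qed

lemma Ck_diff:
  assumes "Ck k f" "Ck k g"
  shows "Ck k (\<lambda>x. f x - g x)"
  using assms
proof (induction k arbitrary: f g)
  case 0
  thus ?case by (auto intro: continuous_intros)
next
  case (Suc k)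
  have d: "((\<lambda>x. f x - g x) has_derivative (\<lambda>h. frechet_derivative f (at x) h - frechet_derivative g (at x) h)) (at x)" for x
    using Suc.prems by (intro has_derivative_diff) (auto simp: frechet_derivative_works)
  hence "frechet_derivative (\<lambda>x. f x - g x) (at x) = (\<lambda>h. frechet_derivative f (at x) h - frechet_derivative g (at x) h)" for x
    by (rule frechet_derivative_at[symmetric])
  moreover have "(\<lambda>x. f x - g x) differentiable (at x)" for x
    using d[of x] unfolding differentiable_def by blast
  ultimately show ?case using Suc by auto
qed

lemma Cc_infinity_support_subset:
  assumes "\<phi> \<in> Cc_infinity \<Omega>" "\<And>k. Ck k \<psi>" "{x. \<psi> x \<noteq> 0} \<subseteq> closure {x. \<phi> x \<noteq> 0}"
  shows "\<psi> \<in> Cc_infinity \<Omega>"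
proof -
  have sub: "closure {x. \<psi> x \<noteq> 0} \<subseteq> closure {x. \<phi> x \<noteq> 0}"
    using assms(3) by (simp add: closure_minimal)
  have "compact (closure {x. \<phi> x \<noteq> 0})" using assms(1) by (simp add: Cc_infinity_def)
  hence "compact (closure {x. \<phi> x \<noteq> 0} \<inter> closure {x. \<psi> x \<noteq> 0})" by (rule compact_Int_closed) simp
  hence "compact (closure {x. \<psi> x \<noteq> 0})" using sub by (simp add: Int_absorb1)
  thus ?thesis using sub assms(1,2) by (auto simp: Cc_infinity_def)
qed

lemma Cc_infinity_mono: "\<phi> \<in> Cc_infinity \<Omega> \<Longrightarrow> \<Omega> \<subseteq> \<Omega>' \<Longrightarrow> \<phi> \<in> Cc_infinity \<Omega>'"
  by (auto simp: Cc_infinity_def)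

lemma Cc_infinity_inner:
  assumes "\<Phi> \<in> Cc_infinity \<Omega>"
  shows "(\<lambda>x. \<Phi> x \<bullet> j) \<in> Cc_infinity \<Omega>"
proof (rule Cc_infinity_support_subset[OF assms])
  show "Ck k (\<lambda>x. \<Phi> x \<bullet> j)" for k
    using assms by (intro Ck_bounded_linear[OF bounded_linear_inner_left]) (simp add: Cc_infinity_def)
  show "{x. \<Phi> x \<bullet> j \<noteq> 0} \<subseteq> closure {x. \<Phi> x \<noteq> 0}"
    using closure_subset by fastforce
qed

lemma Cc_infinity_diff:
  assumes "\<phi> \<in> Cc_infinity \<Omega>" "\<psi> \<in> Cc_infinity \<Omega>"
  shows "(\<lambda>x. \<phi> x - \<psi> x) \<in> Cc_infinity \<Omega>"
proof -
  have sub: "closure {x. \<phi> x - \<psi> x \<noteq> 0} \<subseteq> closure {x. \<phi> x \<noteq> 0} \<union> closure {x. \<psi> x \<noteq> 0}"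
    by (subst closure_Un [symmetric], rule closure_mono) auto
  have "compact (closure {x. \<phi> x \<noteq> 0} \<union> closure {x. \<psi> x \<noteq> 0})"
    using assms by (intro compact_Un) (auto simp: Cc_infinity_def)
  hence "compact ((closure {x. \<phi> x \<noteq> 0} \<union> closure {x. \<psi> x \<noteq> 0}) \<inter> closure {x. \<phi> x - \<psi> x \<noteq> 0})"
    by (rule compact_Int_closed) simp
  hence "compact (closure {x. \<phi> x - \<psi> x \<noteq> 0})" using sub by (simp only: Int_absorb1)
  thus ?thesis using sub assms by (auto simp: Cc_infinity_def intro: Ck_diff)
qed

lemma grad_eqI:
  assumes "(f has_derivative (\<lambda>h. v \<bullet> h)) (at x)"
  shows "grad f x = v"
  using frechet_derivative_at[OF assms, symmetric] by (simp add: grad_def euclidean_representation)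

lemma grad_inner:
  assumes "f differentiable (at x)"
  shows "grad f x \<bullet> h = frechet_derivative f (at x) h"
proof -
  have lin: "linear (frechet_derivative f (at x))" by (rule linear_frechet_derivative[OF assms])
  have "frechet_derivative f (at x) h = frechet_derivative f (at x) (\<Sum>i\<in>Basis. (h \<bullet> i) *\<^sub>R i)"
    by (simp add: euclidean_representation)
  also have "\<dots> = (\<Sum>i\<in>Basis. (h \<bullet> i) * frechet_derivative f (at x) i)"
    by (simp add: linear_sum[OF lin] linear_cmul[OF lin])
  also have "\<dots> = grad f x \<bullet> h"
    unfolding grad_def inner_sum_left by (intro sum.cong) (auto simp: inner_commute)
  finally show ?thesis ..
qed

lemma Cc_infinity_differentiable:
  assumes "\<phi> \<in> Cc_infinity \<Omega>"
  shows "\<phi> differentiable (at x)"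
proof -
  have "Ck (Suc 0) \<phi>" using assms by (simp only: Cc_infinity_def mem_Collect_eq)
  thus ?thesis by simp
qed

lemma Cc_infinity_has_derivative:
  assumes "\<phi> \<in> Cc_infinity \<Omega>"
  shows "(\<phi> has_derivative (\<lambda>h. grad \<phi> x \<bullet> h)) (at x)"
  using Cc_infinity_differentiable[OF assms, of x] by (simp add: grad_inner frechet_derivative_works)

lemma grad_zero_outside:
  assumes "x \<notin> closure {x. \<phi> x \<noteq> (0::real)}"
  shows "grad \<phi> x = 0"
proof (rule grad_eqI)
  have "((\<lambda>x. 0::real) has_derivative (\<lambda>h. 0 \<bullet> h)) (at x)" by simp
  thus "(\<phi> has_derivative (\<lambda>h. 0 \<bullet> h)) (at x)"
  proof (rule has_derivative_transform_within_open)
    show "open (- closure {x. \<phi> x \<noteq> 0})" by (simp add: open_Compl)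
    show "0 = \<phi> y" if "y \<in> - closure {x. \<phi> x \<noteq> 0}" for y
      using that closure_subset[of "{x. \<phi> x \<noteq> 0}"] by fastforce
  qed (use assms in simp)
qed

lemma Cc_infinity_grad:
  assumes "\<phi> \<in> Cc_infinity \<Omega>" "i \<in> Basis"
  shows "(\<lambda>x. grad \<phi> x \<bullet> i) \<in> Cc_infinity \<Omega>"
proof (rule Cc_infinity_support_subset[OF assms(1)])
  show "Ck k (\<lambda>x. grad \<phi> x \<bullet> i)" for k
  proof -
    have "Ck (Suc k) \<phi>" using assms by (simp only: Cc_infinity_def mem_Collect_eq)
    thus ?thesis using assms(2) by (simp add: grad_inner)
  qed
  show "{x. grad \<phi> x \<bullet> i \<noteq> 0} \<subseteq> closure {x. \<phi> x \<noteq> 0}"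
    using grad_zero_outside by fastforce
qed

lemma Cc_infinity_C1_ball:
  assumes \<phi>: "\<phi> \<in> Cc_infinity \<Omega>" and sub: "\<Omega> \<subseteq> ball 0 R"
  shows "C1_ball R \<phi> (grad \<phi>)"
  unfolding C1_ball_def
proof (intro conjI allI)
  show "(\<phi> has_derivative (\<lambda>h. grad \<phi> x \<bullet> h)) (at x)" for x by (rule Cc_infinity_has_derivative[OF \<phi>])
  have out: "x \<notin> closure {x. \<phi> x \<noteq> 0}" if "R \<le> norm x" for x
    using that \<phi> sub by (auto simp: Cc_infinity_def)
  have "Ck 0 \<phi>" using \<phi> by (simp only: Cc_infinity_def mem_Collect_eq)
  moreover have "\<phi> x = 0" if "R \<le> norm x" for x
    using out[OF that] closure_subset[of "{x. \<phi> x \<noteq> 0}"] by fastforce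
  ultimately show "C0_ball R \<phi>" by (simp add: C0_ball_def)
  have "continuous_on UNIV (\<lambda>x. grad \<phi> x \<bullet> i)" if "i \<in> Basis" for i
    using Cc_infinity_grad[OF \<phi> that] by (auto simp: Cc_infinity_def intro: Ck_imp_continuous)
  hence "continuous_on UNIV (\<lambda>x. \<Sum>i\<in>Basis. (grad \<phi> x \<bullet> i) *\<^sub>R i)"
    by (intro continuous_on_sum continuous_on_scaleR continuous_on_const) auto
  thus "C0_ball R (grad \<phi>)"
    using grad_zero_outside[OF out] by (simp add: C0_ball_def euclidean_representation)
qed

lemma Cc_infinity_obtain_radius:
  assumes "\<phi> \<in> Cc_infinity \<Omega>"
  obtains R where "0 < R" "\<phi> \<in> Cc_infinity (ball 0 R)"
proof -
  have "bounded (closure {x. \<phi> x \<noteq> 0})" using assms by (simp add: Cc_infinity_def compact_imp_bounded)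
  then obtain R where "0 < R" "closure {x. \<phi> x \<noteq> 0} \<subseteq> ball 0 R"
    using bounded_subset_ballD by blast
  thus ?thesis using assms that by (auto simp: Cc_infinity_def)
qed

subsection \<open>The Riesz potential of a test function\<close>

lemma locally_integrable_riesz_kernel:
  assumes "0 < a" "a < real DIM('a)"
  shows "locally_integrable (riesz_kernel a :: 'a::euclidean_space \<Rightarrow> real)"
  unfolding locally_integrable_def set_integrable_def
proof (intro allI integrableI_nonneg)
  fix r :: real
  have "(\<integral>\<^sup>+x. ennreal (indicat_real (cball 0 r) x *\<^sub>R riesz_kernel a x) \<partial>(lborel :: 'a measure)) =
     (\<integral>\<^sup>+x. ennreal (riesz_const DIM('a) a) * (ennreal (norm x powr (a - real DIM('a))) * indicator {..r} (norm x)) \<partial>(lborel :: 'a measure))"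
    using riesz_const_pos[OF assms]
    by (intro nn_integral_cong) (auto simp: riesz_kernel_def indicator_def ennreal_mult' [symmetric] powr_minus_divide[symmetric] powr_minus field_simps powr_diff)
  also have "\<dots> = ennreal (riesz_const DIM('a) a) * (\<integral>\<^sup>+x. ennreal (norm x powr (a - real DIM('a))) * indicator {..r} (norm x) \<partial>(lborel :: 'a measure))"
    by (subst nn_integral_cmult) auto
  also have "\<dots> \<le> ennreal (riesz_const DIM('a) a) * (\<integral>\<^sup>+x. ennreal (norm x powr (a - real DIM('a))) * indicator {..max 0 r} (norm x) \<partial>(lborel :: 'a measure))"
    by (intro mult_left_mono nn_integral_mono) (auto simp: indicator_def)
  also have "\<dots> < \<infinity>" using assms by (subst nn_integral_norm_powr_ball) (auto simp: ennreal_mult_less_top)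
  finally show "(\<integral>\<^sup>+x. ennreal (indicat_real (cball 0 r) x *\<^sub>R riesz_kernel a x) \<partial>(lborel :: 'a measure)) < \<infinity>" .
  show "(\<lambda>x. indicat_real (cball 0 r) x *\<^sub>R riesz_kernel a x) \<in> borel_measurable lborel"
    by (intro borel_measurable_scaleR borel_measurable_indicator) auto
qed (use riesz_kernel_nonneg[OF assms] in auto)

lemma riesz_potential_eq_convolve:
  fixes \<phi> :: "'a::euclidean_space \<Rightarrow> real"
  assumes "C0_ball R \<phi>"
  shows "riesz_potential a \<phi> = convolve (riesz_kernel a) \<phi>"
proof
  fix x
  have [measurable]: "\<phi> \<in> borel_measurable borel" using assms by (rule C0_ball_measurable)
  have "riesz_potential a \<phi> x = riesz_const DIM('a) a * (LINT y|lborel. \<phi> y / norm (x - y) powr (real DIM('a) - a))"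
    unfolding riesz_potential_def riesz_const_def by (subst integral_completion) auto
  also have "\<dots> = convolve (riesz_kernel a) \<phi> x"
    unfolding convolve_def by (subst integral_mult_right_zero[symmetric]) (simp add: riesz_kernel_def)
  finally show "riesz_potential a \<phi> x = convolve (riesz_kernel a) \<phi> x" .
qed

lemma test_frac_grad_eq_convolve:
  fixes \<phi> :: "'a::euclidean_space \<Rightarrow> real"
  assumes "C1_ball R \<phi> g" "0 < s" "s < 1"
  shows "test_frac_grad s \<phi> = convolve (riesz_kernel (1 - s)) g"
proof
  fix x
  have "1 - s < real DIM('a)" using assms DIM_positive[where 'a='a] by linarith
  hence "(riesz_potential (1 - s) \<phi> has_derivative (\<lambda>h. convolve (riesz_kernel (1 - s)) g x \<bullet> h)) (at x)"
    using assms by (subst riesz_potential_eq_convolve[of R])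
      (auto simp: C1_ball_def intro!: convolution_has_derivative[where R=R] locally_integrable_riesz_kernel)
  thus "test_frac_grad s \<phi> x = convolve (riesz_kernel (1 - s)) g x"
    using assms by (simp add: test_frac_grad_def grad_eqI)
qed

lemma test_frac_grad_1 [simp]: "test_frac_grad 1 \<phi> = grad \<phi>"
  by (simp add: test_frac_grad_def)

lemma test_frac_grad_continuous:
  fixes \<phi> :: "'a::euclidean_space \<Rightarrow> real"
  assumes "\<phi> \<in> Cc_infinity \<Omega>" "0 < s" "s \<le> 1"
  shows "continuous_on UNIV (test_frac_grad s \<phi>)"
proof -
  obtain R where "\<phi> \<in> Cc_infinity (ball 0 R)" using Cc_infinity_obtain_radius[OF assms(1)] by metis
  hence C1: "C1_ball R \<phi> (grad \<phi>)" by (intro Cc_infinity_C1_ball) auto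
  show ?thesis
  proof (cases "s = 1")
    case True
    thus ?thesis using C1 by (simp add: C1_ball_def C0_ball_def)
  next
    case False
    have "1 - s < real DIM('a)" using assms DIM_positive[where 'a='a] by linarith
    thus ?thesis using C1 False assms
      by (subst test_frac_grad_eq_convolve[OF C1])
        (auto simp: C1_ball_def intro!: convolution_continuous[where R=R] locally_integrable_riesz_kernel)
  qed
qed

lemma test_frac_grad_measurable [measurable]:
  assumes "\<phi> \<in> Cc_infinity \<Omega>" "0 < s" "s \<le> 1"
  shows "test_frac_grad s \<phi> \<in> borel_measurable borel"
  using test_frac_grad_continuous[OF assms] by (rule borel_measurable_continuous_onI)

lemma test_frac_grad_diff:
  fixes \<phi> \<psi> :: "'a::euclidean_space \<Rightarrow> real"
  assumes "\<phi> \<in> Cc_infinity \<Omega>" "\<psi> \<in> Cc_infinity \<Omega>" "0 < s" "s \<le> 1"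
  shows "test_frac_grad s (\<lambda>x. \<phi> x - \<psi> x) x = test_frac_grad s \<phi> x - test_frac_grad s \<psi> x"
proof -
  have grad: "grad (\<lambda>x. \<phi> x - \<psi> x) = (\<lambda>x. grad \<phi> x - grad \<psi> x)"
  proof
    fix x
    show "grad (\<lambda>x. \<phi> x - \<psi> x) x = grad \<phi> x - grad \<psi> x"
      by (rule grad_eqI, rule has_derivative_eq_rhs,
        rule has_derivative_diff[OF Cc_infinity_has_derivative[OF assms(1)] Cc_infinity_has_derivative[OF assms(2)]])
        (simp add: inner_diff_left)
  qed
  show ?thesis
  proof (cases "s = 1")
    case True
    thus ?thesis by (simp add: grad)
  next
    case False
    hence s: "0 < s" "s < 1" "1 - s < real DIM('a)" "0 < 1 - s"
      using assms DIM_positive[where 'a='a] by linarith+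
    obtain R1 R2 where "\<phi> \<in> Cc_infinity (ball 0 R1)" "\<psi> \<in> Cc_infinity (ball 0 R2)"
      using Cc_infinity_obtain_radius[OF assms(1)] Cc_infinity_obtain_radius[OF assms(2)] by metis
    moreover have "ball 0 R1 \<subseteq> ball (0::'a) (max R1 R2)" "ball 0 R2 \<subseteq> ball (0::'a) (max R1 R2)" by auto
    ultimately have C: "\<phi> \<in> Cc_infinity (ball 0 (max R1 R2))" "\<psi> \<in> Cc_infinity (ball 0 (max R1 R2))"
      using Cc_infinity_mono by blast+
    note C1 = Cc_infinity_C1_ball[OF C(1) order_refl] Cc_infinity_C1_ball[OF C(2) order_refl]
      Cc_infinity_C1_ball[OF Cc_infinity_diff[OF C] order_refl]
    note K = locally_integrable_riesz_kernel[OF s(4,3)]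
    have "integrable lborel (\<lambda>y. riesz_kernel (1 - s) (x - y) *\<^sub>R grad \<phi> y)"
      "integrable lborel (\<lambda>y. riesz_kernel (1 - s) (x - y) *\<^sub>R grad \<psi> y)"
      using C1 by (auto simp: C1_ball_def intro!: convolution_integrable[OF K])
    thus ?thesis
      unfolding test_frac_grad_eq_convolve[OF C1(1) s(1,2)] test_frac_grad_eq_convolve[OF C1(2) s(1,2)]
        test_frac_grad_eq_convolve[OF C1(3) s(1,2)] grad
      by (simp add: convolve_def scaleR_diff_right)
  qed
qed

text \<open>
  Move the even Riesz kernel from \<open>D\<psi>\<close> to \<open>\<phi>\<close>, integrate by parts, and use that the gradient of a
  convolution of \<open>\<phi>\<close> is the convolution of its gradient.
\<close>
lemma frac_grad_integration_by_parts:
  fixes \<phi> \<psi> :: "'a::euclidean_space \<Rightarrow> real"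
  assumes "\<phi> \<in> Cc_infinity UNIV" "\<psi> \<in> Cc_infinity UNIV" "0 < s" "s \<le> 1" "i \<in> Basis"
  shows "(\<integral>x. \<phi> x * (test_frac_grad s \<psi> x \<bullet> i) \<partial>lborel) = - (\<integral>x. (test_frac_grad s \<phi> x \<bullet> i) * \<psi> x \<partial>lborel)"
proof -
  obtain R1 R2 where "\<phi> \<in> Cc_infinity (ball 0 R1)" "\<psi> \<in> Cc_infinity (ball 0 R2)"
    using Cc_infinity_obtain_radius[OF assms(1)] Cc_infinity_obtain_radius[OF assms(2)] by metis
  hence C1: "C1_ball R1 \<phi> (grad \<phi>)" "C1_ball R2 \<psi> (grad \<psi>)"
    by (auto intro: Cc_infinity_C1_ball)
  show ?thesis
  proof (cases "s = 1")
    case True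
    thus ?thesis using integration_by_parts[OF Cc_infinity_has_derivative[OF assms(1)] _ C1(2)] C1(1)
      by (simp add: C1_ball_def C0_ball_def)
  next
    case False
    hence s: "0 < s" "s < 1" "1 - s < real DIM('a)" "0 < 1 - s"
      using assms DIM_positive[where 'a='a] by linarith+
    define K where "K = (riesz_kernel (1 - s) :: 'a \<Rightarrow> real)"
    have K: "locally_integrable K" "K (- z) = K z" for z
      using s by (auto simp: K_def riesz_kernel_def locally_integrable_riesz_kernel)
    have cs: "C0_ball R1 \<phi>" "C0_ball R1 (grad \<phi>)" "C0_ball R2 (grad \<psi>)"
      using C1 by (auto simp: C1_ball_def)
    have csi: "C0_ball (max R1 R2) \<phi>" "C0_ball (max R1 R2) (\<lambda>y. grad \<psi> y \<bullet> i)"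
      using cs by (auto simp: C0_ball_def intro!: continuous_intros)
    have inner: "convolve K (\<lambda>y. g y \<bullet> i) x = convolve K g x \<bullet> i" if "C0_ball R g" for R g and x :: 'a
      using convolution_integrable[OF K(1) that, of x] unfolding convolve_def
      by (subst integral_inner_left [symmetric]) auto
    have "(\<integral>x. \<phi> x * (convolve K (grad \<psi>) x \<bullet> i) \<partial>lborel) = (\<integral>x. \<phi> x * convolve K (\<lambda>y. grad \<psi> y \<bullet> i) x \<partial>lborel)"
      by (simp add: inner[OF cs(3)])
    also have "\<dots> = (\<integral>x. convolve K \<phi> x * (grad \<psi> x \<bullet> i) \<partial>lborel)"
      by (rule convolution_adjoint[OF K csi])
    also have "\<dots> = - (\<integral>x. (convolve K (grad \<phi>) x \<bullet> i) * \<psi> x \<partial>lborel)"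
      using convolution_has_derivative[OF K(1) C1(1)] convolution_continuous[OF K(1) cs(2)] C1(2)
      by (rule integration_by_parts)
    finally show ?thesis
      by (simp add: test_frac_grad_eq_convolve[OF C1(1) s(1,2)] test_frac_grad_eq_convolve[OF C1(2) s(1,2)] K_def)
  qed
qed

section \<open>Decay at infinity\<close>

lemma powr_minus_lipschitz:
  fixes a b m q :: real
  assumes "0 < m" "m \<le> a" "m \<le> b" "0 \<le> q"
  shows "\<bar>a powr (- q) - b powr (- q)\<bar> \<le> q * m powr (- q - 1) * \<bar>a - b\<bar>"
proof -
  have "norm (a powr (- q) - b powr (- q)) \<le> q * m powr (- q - 1) * norm (a - b)"
  proof (rule field_differentiable_bound[where S="{m..}" and f'="\<lambda>z. - q * z powr (- q - 1)"])
    show "((\<lambda>z. z powr (- q)) has_field_derivative - q * z powr (- q - 1)) (at z within {m..})" if "z \<in> {m..}" for z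
      using that assms by (intro has_real_derivative_powr[THEN has_field_derivative_at_within]) auto
    show "norm (- q * z powr (- q - 1)) \<le> q * m powr (- q - 1)" if "z \<in> {m..}" for z
      using that assms by (auto simp: abs_mult intro!: mult_left_mono powr_mono2')
  qed (use assms in auto)
  thus ?thesis by simp
qed

lemma norm_gradient_le_lipschitz:
  fixes f :: "'a::euclidean_space \<Rightarrow> real"
  assumes d: "(f has_derivative (\<lambda>h. v \<bullet> h)) (at x)" and "0 < \<delta>"
    and L: "\<And>h. norm h < \<delta> \<Longrightarrow> \<bar>f (x + h) - f x\<bar> \<le> L * norm h"
  shows "norm v \<le> L"
proof (cases "v = 0")
  case True
  obtain h :: 'a where h: "norm h = \<delta> / 2" using vector_choose_size[of "\<delta> / 2"] assms by auto
  hence "0 \<le> L * norm h" using L[of h] assms by linarith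
  thus ?thesis using True h assms by (simp add: zero_le_mult_iff)
next
  case False
  show ?thesis
  proof (rule field_le_epsilon)
    fix e :: real assume e: "0 < e"
    obtain d where d: "0 < d" "\<And>y. norm (y - x) < d \<Longrightarrow> norm (f y - f x - v \<bullet> (y - x)) \<le> e * norm (y - x)"
      using assms(1) e unfolding has_derivative_at_alt by metis
    define t where "t = min \<delta> d / (2 * norm v)"
    have t: "0 < t" using d assms False by (simp add: t_def)
    have "t * norm v = min \<delta> d / 2" using False by (simp add: t_def)
    hence n: "norm (t *\<^sub>R v) < \<delta>" "norm (t *\<^sub>R v) < d" using t assms d by auto
    have "t * norm v * norm v = v \<bullet> (t *\<^sub>R v)" by (simp add: power2_norm_eq_inner[symmetric] power2_eq_square)
    also have "\<dots> \<le> (L + e) * norm (t *\<^sub>R v)"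
      using L[OF n(1)] d(2)[of "x + t *\<^sub>R v"] n(2) by (simp add: algebra_simps abs_le_iff)
    also have "\<dots> = t * norm v * (L + e)" using t by simp
    finally show "norm v \<le> L + e" using t False by (subst (asm) mult_le_cancel_left_pos) auto
  qed
qed

lemma mu_pos: "0 < s \<Longrightarrow> s < 1 \<Longrightarrow> 0 < mu d s"
  unfolding mu_def by (intro divide_pos_pos mult_pos_pos Gamma_real_pos) auto

text \<open>
  The factor \<open>\<Gamma>((1 - s) / 2)\<close> has a pole at \<open>s = 1\<close>, but only its reciprocal enters, and that is continuous
  up to the end points.
\<close>
lemma mu_bounded: "\<exists>B>0. \<forall>s. 0 < s \<and> s < 1 \<longrightarrow> mu d s \<le> B"
proof -
  define m where "m = (\<lambda>s. 2 powr s * Gamma ((real d + s + 1) / 2) * rGamma ((1 - s) / 2) / pi powr (real d / 2))"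
  have "continuous_on {0..1} m"
    unfolding m_def
  proof (intro continuous_intros)
    show "continuous_on {0..1} (\<lambda>x. Gamma ((real d + x + 1) / 2))"
    proof (rule continuous_on_compose2[OF continuous_on_Gamma])
      show "{0<..} \<inter> \<int>\<^sub>\<le>\<^sub>0 = ({} :: real set)" by (auto dest!: nonpos_Ints_nonpos)
    qed (auto intro!: continuous_intros)
    show "continuous_on {0..1} (\<lambda>x::real. rGamma ((1 - x) / 2))"
      by (intro continuous_on_compose2[OF continuous_on_rGamma] continuous_intros) auto
  qed auto
  hence "bounded (m ` {0..1})" by (intro compact_imp_bounded compact_continuous_image) auto
  then obtain B where "\<forall>y\<in>m ` {0..1}. norm y \<le> B" unfolding bounded_iff by blast
  hence B: "\<And>s. s \<in> {0..1} \<Longrightarrow> norm (m s) \<le> B" by blast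
  have "mu d s = m s" for s by (simp add: mu_def m_def rGamma_inverse_Gamma field_simps)
  hence "mu d s \<le> max 1 B" if "0 < s" "s < 1" for s using B[of s] that by (auto simp: abs_le_iff)
  thus ?thesis by (intro exI[of _ "max 1 B"]) auto
qed

lemma riesz_kernel_altdef:
  fixes z :: "'a::euclidean_space"
  shows "riesz_kernel a z = riesz_const DIM('a) a * norm z powr (- (real DIM('a) - a))"
  unfolding riesz_kernel_def by (subst powr_minus) (simp add: divide_inverse)

text \<open>
  The gradient of a differentiable function is bounded by its Lipschitz constant near the point.
  Far from the support of \<open>\<phi>\<close> this needs the Lipschitz constant of the kernel, and no derivative of \<open>\<phi>\<close>.
\<close>
lemma convolve_riesz_decay:
  fixes \<phi> :: "'a::euclidean_space \<Rightarrow> real"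
  assumes C1: "C1_ball R \<phi> g" and s: "0 < s" "s < 1" and R: "0 < R" and x: "2 * R \<le> norm x"
  shows "norm (convolve (riesz_kernel (1 - s)) g x) \<le>
    4 powr (real DIM('a) + s) * mu DIM('a) s * (\<integral>y. \<bar>\<phi> y\<bar> \<partial>lborel) * norm x powr (- real DIM('a) - s)"
proof -
  let ?d = "real DIM('a)"
  \<comment> \<open>For \<open>|h| < m\<close> and \<open>y\<close> in the support, \<open>x - y\<close> and \<open>x + h - y\<close> keep distance \<open>m\<close> from the origin.\<close>
  define m where "m = norm x / 4"
  define K where "K = (riesz_kernel (1 - s) :: 'a \<Rightarrow> real)"
  define L where "L = mu DIM('a) s * m powr (- ?d - s) * (\<integral>y. \<bar>\<phi> y\<bar> \<partial>lborel)"
  have d1: "1 \<le> ?d" using DIM_positive[where 'a='a] by linarith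
  have "0 < norm x" using R x by linarith
  hence m: "0 < m" by (simp add: m_def)
  have K: "locally_integrable K" unfolding K_def using s d1 by (intro locally_integrable_riesz_kernel) linarith+
  have cs: "C0_ball R \<phi>" using C1 by (simp add: C1_ball_def)
  have int1: "integrable lborel \<phi>" using convolution_integrable[OF locally_integrable_const[of 1] cs] by simp
  have "norm (convolve K g x) \<le> L"
  proof (rule norm_gradient_le_lipschitz[OF convolution_has_derivative[OF K C1] m])
    fix h :: 'a assume h: "norm h < m"
    have "convolve K \<phi> (x + h) - convolve K \<phi> x = (\<integral>y. (K (x + h - y) - K (x - y)) * \<phi> y \<partial>lborel)"
      unfolding convolve_def using convolution_integrable[OF K cs, of x] convolution_integrable[OF K cs, of "x + h"]
      by (subst Bochner_Integration.integral_diff[symmetric]) (auto simp: algebra_simps)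
    also have "norm \<dots> \<le> (\<integral>y. norm ((K (x + h - y) - K (x - y)) * \<phi> y) \<partial>lborel)"
      by (rule integral_norm_bound)
    also have "\<dots> \<le> (\<integral>y. mu DIM('a) s * m powr (- ?d - s) * norm h * \<bar>\<phi> y\<bar> \<partial>lborel)"
    proof (rule integral_mono')
      show "integrable lborel (\<lambda>y. mu DIM('a) s * m powr (- ?d - s) * norm h * \<bar>\<phi> y\<bar>)"
        using int1 by (intro integrable_mult_right integrable_abs)
      fix y :: 'a
      show "0 \<le> mu DIM('a) s * m powr (- ?d - s) * norm h * \<bar>\<phi> y\<bar>"
        using mu_pos[OF s, of "DIM('a)"] by simp
      show "norm ((K (x + h - y) - K (x - y)) * \<phi> y) \<le> mu DIM('a) s * m powr (- ?d - s) * norm h * \<bar>\<phi> y\<bar>"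
      proof (cases "R \<le> norm y")
        case True
        thus ?thesis using cs by (simp add: C0_ball_def)
      next
        case False
        have y: "norm y < 2 * m" using False x by (simp add: m_def)
        have a: "m \<le> norm (x + h - y)" "m \<le> norm (x - y)"
        proof -
          have "norm x \<le> norm (x + h - y) + norm (h - y)" "norm x \<le> norm (x - y) + norm y" "norm (h - y) \<le> norm h + norm y"
            using norm_triangle_ineq4[of "x + h - y" "h - y"] norm_triangle_ineq[of "x - y" y] norm_triangle_ineq4[of h y] by simp_all
          thus "m \<le> norm (x + h - y)" "m \<le> norm (x - y)" using y h norm_ge_zero[of x] unfolding m_def by linarith+
        qed
        define q where "q = ?d - (1 - s)"
        have q: "0 < q" using d1 s unfolding q_def by linarith
        have c: "riesz_const DIM('a) (1 - s) * q = mu DIM('a) s"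
          using q by (simp add: riesz_const_def q_def)
        have c0: "0 < riesz_const DIM('a) (1 - s)" using s d1 by (intro riesz_const_pos) linarith+
        have "\<bar>K (x + h - y) - K (x - y)\<bar> = riesz_const DIM('a) (1 - s) * \<bar>norm (x + h - y) powr (- q) - norm (x - y) powr (- q)\<bar>"
          using c0 unfolding K_def riesz_kernel_altdef q_def by (simp add: abs_mult right_diff_distrib[symmetric] del: minus_diff_eq)
        also have "\<dots> \<le> riesz_const DIM('a) (1 - s) * (q * m powr (- q - 1) * \<bar>norm (x + h - y) - norm (x - y)\<bar>)"
          using c0 q m a by (intro mult_left_mono powr_minus_lipschitz) auto
        also have "\<dots> \<le> riesz_const DIM('a) (1 - s) * (q * m powr (- q - 1) * norm h)"
          using c0 q norm_triangle_ineq3[of "x + h - y" "x - y"] by (intro mult_left_mono) auto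
        also have "\<dots> = mu DIM('a) s * m powr (- ?d - s) * norm h"
        proof -
          have "- q - 1 = - ?d - s" by (simp add: q_def)
          thus ?thesis unfolding c[symmetric] by (simp only: mult.assoc)
        qed
        finally show ?thesis by (simp add: abs_mult mult_right_mono)
      qed
    qed
    also have "\<dots> = L * norm h" by (simp add: L_def)
    finally show "\<bar>convolve K \<phi> (x + h) - convolve K \<phi> x\<bar> \<le> L * norm h" by simp
  qed
  also have "m powr (- ?d - s) = 4 powr (?d + s) * norm x powr (- ?d - s)"
  proof -
    have "m powr (- ?d - s) = norm x powr (- ?d - s) / 4 powr (- (?d + s))"
      by (simp add: m_def powr_divide)
    thus ?thesis by (simp only: powr_minus[of 4 "?d + s"] divide_inverse inverse_inverse_eq mult.commute)
  qed
  hence "L = 4 powr (?d + s) * mu DIM('a) s * (\<integral>y. \<bar>\<phi> y\<bar> \<partial>lborel) * norm x powr (- ?d - s)"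
    by (simp add: L_def)
  finally show ?thesis by (simp add: K_def)
qed

lemma test_frac_grad_decay:
  "\<exists>B>0. \<forall>s R (\<phi> :: 'a::euclidean_space \<Rightarrow> real) x. 0 < s \<and> s \<le> 1 \<and> 0 < R \<and> \<phi> \<in> Cc_infinity (ball 0 R) \<and> 2 * R \<le> norm x \<longrightarrow>
    norm (test_frac_grad s \<phi> x) \<le> B * (\<integral>y. \<bar>\<phi> y\<bar> \<partial>lborel) * norm x powr (- real DIM('a) - s)"
proof -
  obtain B where B: "0 < B" "\<And>s. 0 < s \<Longrightarrow> s < 1 \<Longrightarrow> mu DIM('a) s \<le> B" using mu_bounded by metis
  define B' where "B' = 4 powr (real DIM('a) + 1) * B"
  have "norm (test_frac_grad s \<phi> x) \<le> B' * (\<integral>y. \<bar>\<phi> y\<bar> \<partial>lborel) * norm x powr (- real DIM('a) - s)"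
    if *: "0 < s" "s \<le> 1" "0 < R" "\<phi> \<in> Cc_infinity (ball 0 R)" "2 * R \<le> norm x" for s R and \<phi> :: "'a \<Rightarrow> real" and x
  proof -
    have C1: "C1_ball R \<phi> (grad \<phi>)" using * by (intro Cc_infinity_C1_ball) auto
    have I: "0 \<le> (\<integral>y. \<bar>\<phi> y\<bar> \<partial>lborel)" by (intro integral_nonneg_AE) auto
    show ?thesis
    proof (cases "s = 1")
      case True
      have "grad \<phi> x = 0" using C1 * by (auto simp: C1_ball_def C0_ball_def)
      thus ?thesis using True I B by (auto simp: B'_def)
    next
      case False
      hence s: "0 < s" "s < 1" using * by auto
      have "norm (test_frac_grad s \<phi> x) \<le>
         4 powr (real DIM('a) + s) * mu DIM('a) s * (\<integral>y. \<bar>\<phi> y\<bar> \<partial>lborel) * norm x powr (- real DIM('a) - s)"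
        unfolding test_frac_grad_eq_convolve[OF C1 s] using convolve_riesz_decay[OF C1 s *(3,5)] .
      also have "\<dots> \<le> B' * (\<integral>y. \<bar>\<phi> y\<bar> \<partial>lborel) * norm x powr (- real DIM('a) - s)"
        unfolding B'_def using I B(2)[OF s] mu_pos[OF s, of "DIM('a)"] s
        by (intro mult_right_mono mult_mono powr_mono) auto
      finally show ?thesis .
    qed
  qed
  moreover have "0 < B'" using B by (simp add: B'_def)
  ultimately show ?thesis by (intro exI[of _ B']) blast
qed

lemma nn_integral_cball_finite:
  "(\<integral>\<^sup>+x. ennreal c * indicator (cball (a::'a::euclidean_space) r) x \<partial>lborel) < \<infinity>"
  using emeasure_lborel_cball_finite[of a r] by (simp add: nn_integral_cmult_indicator ennreal_mult_less_top)

text \<open>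
  Bounded on a ball, and outside of it dominated by \<open>|x|\<^bsup>-(d+s)p\<^esup>\<close>, which is integrable at infinity.
\<close>
lemma test_frac_grad_nn_integral_powr:
  fixes \<phi> :: "'a::euclidean_space \<Rightarrow> real"
  assumes \<phi>: "\<phi> \<in> Cc_infinity \<Omega>" and s: "0 < s" "s \<le> 1" and p: "1 < p"
  shows "(\<integral>\<^sup>+x. ennreal (norm (test_frac_grad s \<phi> x) powr p) \<partial>lborel) < \<infinity>"
proof -
  let ?d = "real DIM('a)"
  have d1: "1 \<le> ?d" using DIM_positive[where 'a='a] by linarith
  obtain R where R: "0 < R" "\<phi> \<in> Cc_infinity (ball 0 R)" using Cc_infinity_obtain_radius[OF \<phi>] by metis
  obtain B where B: "\<And>x. 2 * R \<le> norm x \<Longrightarrow> norm (test_frac_grad s \<phi> x) \<le> B * norm x powr (- ?d - s)" "0 \<le> B"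
  proof -
    obtain B0 where B0: "0 < B0" "\<forall>s R (\<phi> :: 'a \<Rightarrow> real) x. 0 < s \<and> s \<le> 1 \<and> 0 < R \<and> \<phi> \<in> Cc_infinity (ball 0 R) \<and> 2 * R \<le> norm x \<longrightarrow>
        norm (test_frac_grad s \<phi> x) \<le> B0 * (\<integral>y. \<bar>\<phi> y\<bar> \<partial>lborel) * norm x powr (- ?d - s)"
      using test_frac_grad_decay[where 'a='a] by (elim exE conjE)
    have "\<And>x. 2 * R \<le> norm x \<Longrightarrow> norm (test_frac_grad s \<phi> x) \<le> B0 * (\<integral>y. \<bar>\<phi> y\<bar> \<partial>lborel) * norm x powr (- ?d - s)"
      using B0(2)[rule_format, of s R \<phi>] R s by simp
    moreover have "0 \<le> (\<integral>y. \<bar>\<phi> y\<bar> \<partial>lborel)" by (intro integral_nonneg_AE) auto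
    ultimately show ?thesis using that[of "B0 * (\<integral>y. \<bar>\<phi> y\<bar> \<partial>lborel)"] B0(1) by simp
  qed
  have "compact (test_frac_grad s \<phi> ` cball 0 (2 * R))"
    using test_frac_grad_continuous[OF \<phi> s] by (intro compact_continuous_image) (auto intro: continuous_on_subset)
  then obtain M where M: "\<And>x. x \<in> cball 0 (2 * R) \<Longrightarrow> norm (test_frac_grad s \<phi> x) \<le> M"
  proof -
    assume *: "\<And>M. (\<And>x. x \<in> cball 0 (2 * R) \<Longrightarrow> norm (test_frac_grad s \<phi> x) \<le> M) \<Longrightarrow> thesis"
    obtain M where "\<forall>y\<in>test_frac_grad s \<phi> ` cball 0 (2 * R). norm y \<le> M"
      using compact_imp_bounded[OF \<open>compact (test_frac_grad s \<phi> ` cball 0 (2 * R))\<close>] unfolding bounded_iff ..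
    thus thesis using *[of M] by simp
  qed
  define e where "e = (?d + s) * p - ?d"
  have e: "0 < e"
  proof -
    have "?d * 1 \<le> ?d * p" using p d1 by (intro mult_left_mono) auto
    moreover have "0 < s * p" using s p by simp
    ultimately show ?thesis unfolding e_def distrib_right by linarith
  qed
  have "(\<integral>\<^sup>+x. ennreal (norm (test_frac_grad s \<phi> x) powr p) \<partial>lborel) \<le>
    (\<integral>\<^sup>+x. ennreal (M powr p) * indicator (cball 0 (2 * R)) x + ennreal (B powr p) * (ennreal (norm x powr (- ?d - e)) * indicator {2 * R..} (norm x)) \<partial>(lborel :: 'a measure))"
  proof (rule nn_integral_mono)
    fix x :: 'a
    show "ennreal (norm (test_frac_grad s \<phi> x) powr p) \<le>
      ennreal (M powr p) * indicator (cball 0 (2 * R)) x + ennreal (B powr p) * (ennreal (norm x powr (- ?d - e)) * indicator {2 * R..} (norm x))"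
    proof (cases "norm x \<le> 2 * R")
      case True
      hence "ennreal (norm (test_frac_grad s \<phi> x) powr p) \<le> ennreal (M powr p) * indicator (cball 0 (2 * R)) x"
        using M[of x] p by (auto intro!: ennreal_leI powr_mono2)
      thus ?thesis by (rule order_trans) simp
    next
      case False
      have "norm (test_frac_grad s \<phi> x) powr p \<le> (B * norm x powr (- ?d - s)) powr p"
        using B False p by (intro powr_mono2) auto
      also have "\<dots> = B powr p * norm x powr (- ?d - e)"
      proof -
        have "(- ?d - s) * p = - ?d - e" unfolding e_def by algebra
        hence "(norm x powr (- ?d - s)) powr p = norm x powr (- ?d - e)" by (simp only: powr_powr)
        thus ?thesis using B(2) by (subst powr_mult) simp_all
      qed
      finally show ?thesis using False by (simp add: ennreal_mult' [symmetric] ennreal_leI)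
    qed
  qed
  also have "\<dots> = (\<integral>\<^sup>+x. ennreal (M powr p) * indicator (cball (0::'a) (2 * R)) x \<partial>lborel) +
      ennreal (B powr p) * (\<integral>\<^sup>+x. ennreal (norm x powr (- ?d - e)) * indicator {2 * R..} (norm x) \<partial>(lborel :: 'a measure))"
  proof -
    have "(\<lambda>x. ennreal (M powr p) * indicator (cball (0::'a) (2 * R)) x) \<in> borel_measurable lborel"
      by (intro borel_measurable_times_ennreal borel_measurable_indicator) auto
    moreover have m: "(\<lambda>x. ennreal (norm x powr (- ?d - e)) * indicator {2 * R..} (norm x)) \<in> borel_measurable (lborel :: 'a measure)"
      by measurable
    ultimately show ?thesis
      using m by (simp only: nn_integral_add borel_measurable_times_ennreal borel_measurable_const nn_integral_cmult)
  qed
  also have "\<dots> < \<infinity>"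
    using R e nn_integral_cball_finite[of "M powr p" "0::'a" "2 * R"]
    by (subst nn_integral_norm_powr_outside_ball) (auto simp: ennreal_mult_less_top)
  finally show ?thesis .
qed

section \<open>Lowering the order of a fractional gradient\<close>

lemma riesz_kernel_convolution_shift:
  fixes x w :: "'a::euclidean_space"
  assumes "0 < a" "0 < b" "a + b < real DIM('a)" "x \<noteq> w"
  shows "(\<integral>\<^sup>+y. ennreal (riesz_kernel a (x - y) * riesz_kernel b (y - w)) \<partial>lborel) =
    ennreal (riesz_kernel (a + b) (x - w))"
proof -
  have nn: "0 \<le> riesz_kernel a z" "0 \<le> riesz_kernel b z" for z :: 'a
    using assms by (auto intro!: riesz_kernel_nonneg)
  have "(\<integral>\<^sup>+y. ennreal (riesz_kernel a (x - y) * riesz_kernel b (y - w)) \<partial>lborel) =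
    (\<integral>\<^sup>+y. ennreal (riesz_kernel a ((x - w) - (y - w))) * ennreal (riesz_kernel b (y - w)) \<partial>lborel)"
    using nn by (intro nn_integral_cong) (simp add: ennreal_mult)
  also have "\<dots> = (\<integral>\<^sup>+y. ennreal (riesz_kernel a ((x - w) - y)) * ennreal (riesz_kernel b y) \<partial>lborel)"
    by (rule nn_integral_lborel_shift[where f="\<lambda>y. ennreal (riesz_kernel a ((x - w) - y)) * ennreal (riesz_kernel b y)"]) measurable
  also have "\<dots> = ennreal (riesz_kernel (a + b) (x - w))"
    using assms by (intro riesz_kernel_convolution) auto
  finally show ?thesis .
qed

text \<open>
  Integrate the composition law of the kernels against \<open>g\<close>.  The interchange of the integrals is
  justified by the same law, applied to \<open>|g|\<close>.
\<close>
lemma convolve_riesz_semigroup: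
  fixes g :: "'a::euclidean_space \<Rightarrow> 'b::euclidean_space"
  assumes "0 < a" "0 < b" "a + b < real DIM('a)" and g: "C0_ball R g"
  shows "integrable lborel (\<lambda>y. riesz_kernel a (x - y) *\<^sub>R convolve (riesz_kernel b) g y)"
    and "convolve (riesz_kernel (a + b)) g x = (\<integral>y. riesz_kernel a (x - y) *\<^sub>R convolve (riesz_kernel b) g y \<partial>lborel)"
proof -
  let ?k = "\<lambda>y w. riesz_kernel a (x - y) * riesz_kernel b (y - w)"
  have [measurable]: "g \<in> borel_measurable borel" using g by (rule C0_ball_measurable)
  have nn: "0 \<le> riesz_kernel a z" "0 \<le> riesz_kernel b z" "0 \<le> riesz_kernel (a + b) z" for z :: 'a
    using assms by (auto intro!: riesz_kernel_nonneg)
  have ne: "AE w in lborel. x \<noteq> w" using AE_lborel_singleton[of x] by eventually_elim auto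
  have int: "integrable (lborel \<Otimes>\<^sub>M lborel) (\<lambda>(w, y). ?k y w *\<^sub>R g w)"
  proof (rule integrableI_bounded)
    have "(\<integral>\<^sup>+p. ennreal (norm (case p of (w, y) \<Rightarrow> ?k y w *\<^sub>R g w)) \<partial>(lborel \<Otimes>\<^sub>M lborel)) =
      (\<integral>\<^sup>+w. \<integral>\<^sup>+y. ennreal (?k y w) * ennreal (norm (g w)) \<partial>lborel \<partial>lborel)"
      using nn by (subst lborel.nn_integral_fst [symmetric]) (auto simp: ennreal_mult)
    also have "\<dots> = (\<integral>\<^sup>+w. ennreal (norm (riesz_kernel (a + b) (x - w) *\<^sub>R g w)) \<partial>lborel)"
      using ne
    proof (intro nn_integral_cong_AE, eventually_elim)
      fix w :: 'a assume w: "x \<noteq> w"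
      have "(\<integral>\<^sup>+y. ennreal (?k y w) * ennreal (norm (g w)) \<partial>lborel) = (\<integral>\<^sup>+y. ennreal (?k y w) \<partial>lborel) * ennreal (norm (g w))"
        by (subst nn_integral_multc) auto
      also have "\<dots> = ennreal (norm (riesz_kernel (a + b) (x - w) *\<^sub>R g w))"
        unfolding riesz_kernel_convolution_shift[OF assms(1-3) w] using nn by (simp add: ennreal_mult)
      finally show "(\<integral>\<^sup>+y. ennreal (?k y w) * ennreal (norm (g w)) \<partial>lborel) = ennreal (norm (riesz_kernel (a + b) (x - w) *\<^sub>R g w))" .
    qed
    also have "\<dots> < \<infinity>"
      using convolution_integrable[OF locally_integrable_riesz_kernel g, of "a + b" x] assms
      by (simp add: integrable_iff_bounded)
    finally show "(\<integral>\<^sup>+p. ennreal (norm (case p of (w, y) \<Rightarrow> ?k y w *\<^sub>R g w)) \<partial>(lborel \<Otimes>\<^sub>M lborel)) < \<infinity>" .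
  qed (simp add: case_prod_unfold)
  have inner_w: "(\<integral>w. ?k y w *\<^sub>R g w \<partial>lborel) = riesz_kernel a (x - y) *\<^sub>R convolve (riesz_kernel b) g y" for y
    unfolding convolve_def by (subst integral_scaleR_right[symmetric]) simp
  show "integrable lborel (\<lambda>y. riesz_kernel a (x - y) *\<^sub>R convolve (riesz_kernel b) g y)"
    using lborel_pair.integrable_snd[OF int] unfolding inner_w .
  have "convolve (riesz_kernel (a + b)) g x = (\<integral>w. \<integral>y. ?k y w *\<^sub>R g w \<partial>lborel \<partial>lborel)"
    unfolding convolve_def
  proof (rule integral_cong_AE)
    show "AE w in lborel. riesz_kernel (a + b) (x - w) *\<^sub>R g w = (\<integral>y. ?k y w *\<^sub>R g w \<partial>lborel)"
      using ne
    proof eventually_elim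
      fix w :: 'a assume w: "x \<noteq> w"
      have "(\<integral>y. ?k y w \<partial>lborel) = riesz_kernel (a + b) (x - w)"
        using nn riesz_kernel_convolution_shift[OF assms(1-3) w]
        by (subst integral_eq_nn_integral) auto
      moreover have "integrable lborel (\<lambda>y. ?k y w)"
        using nn riesz_kernel_convolution_shift[OF assms(1-3) w] by (intro integrableI_nonneg) auto
      ultimately show "riesz_kernel (a + b) (x - w) *\<^sub>R g w = (\<integral>y. ?k y w *\<^sub>R g w \<partial>lborel)" by simp
    qed
  qed measurable
  also have "\<dots> = (\<integral>y. \<integral>w. ?k y w *\<^sub>R g w \<partial>lborel \<partial>lborel)"
    using lborel_pair.Fubini_integral[OF int] by simp
  finally show "convolve (riesz_kernel (a + b)) g x = (\<integral>y. riesz_kernel a (x - y) *\<^sub>R convolve (riesz_kernel b) g y \<partial>lborel)"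
    unfolding inner_w .
qed

text \<open>
  \<open>D\<^sup>t\<phi> = I\<^sub>1\<^sub>-\<^sub>t D\<phi> = I\<^sub>s\<^sub>-\<^sub>t (I\<^sub>1\<^sub>-\<^sub>s D\<phi>) = I\<^sub>s\<^sub>-\<^sub>t D\<^sup>s\<phi>\<close>, where the middle step is void for \<open>s = 1\<close>.
\<close>
lemma test_frac_grad_le_riesz:
  fixes \<phi> :: "'a::euclidean_space \<Rightarrow> real"
  assumes \<phi>: "\<phi> \<in> Cc_infinity \<Omega>" and st: "0 < t" "t < s" "s \<le> 1"
  shows "ennreal (norm (test_frac_grad t \<phi> x)) \<le>
    (\<integral>\<^sup>+y. ennreal (riesz_kernel (s - t) (x - y)) * ennreal (norm (test_frac_grad s \<phi> y)) \<partial>lborel)"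
proof -
  have d1: "1 \<le> real DIM('a)" using DIM_positive[where 'a='a] by linarith
  obtain R where "\<phi> \<in> Cc_infinity (ball 0 R)" using Cc_infinity_obtain_radius[OF \<phi>] by metis
  hence C1: "C1_ball R \<phi> (grad \<phi>)" by (intro Cc_infinity_C1_ball) auto
  hence cs: "C0_ball R (grad \<phi>)" by (simp add: C1_ball_def)
  have t: "0 < t" "t < 1" using st by auto
  have nn: "0 \<le> riesz_kernel (s - t) z" for z :: 'a
    using st d1 by (intro riesz_kernel_nonneg) linarith+
  have *: "integrable lborel (\<lambda>y. riesz_kernel (s - t) (x - y) *\<^sub>R test_frac_grad s \<phi> y) \<and>
    test_frac_grad t \<phi> x = (\<integral>y. riesz_kernel (s - t) (x - y) *\<^sub>R test_frac_grad s \<phi> y \<partial>lborel)"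
  proof (cases "s = 1")
    case True
    have "0 < 1 - t" "1 - t < real DIM('a)" using t d1 by linarith+
    from convolution_integrable[OF locally_integrable_riesz_kernel[OF this] cs, of x] show ?thesis using True
      by (simp add: test_frac_grad_eq_convolve[OF C1 t] convolve_def)
  next
    case False
    hence s: "0 < s" "s < 1" using st by auto
    have "0 < s - t" "0 < 1 - s" "s - t + (1 - s) < real DIM('a)" using st s d1 by linarith+
    from convolve_riesz_semigroup[OF this cs, of x] show ?thesis
      by (simp add: test_frac_grad_eq_convolve[OF C1 t] test_frac_grad_eq_convolve[OF C1 s])
  qed
  hence "ennreal (norm (test_frac_grad t \<phi> x)) \<le>
    (\<integral>\<^sup>+y. ennreal (norm (riesz_kernel (s - t) (x - y) *\<^sub>R test_frac_grad s \<phi> y)) \<partial>lborel)"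
    using integral_norm_bound_ennreal by fastforce
  thus ?thesis using nn by (simp add: ennreal_mult)
qed

section \<open>Recovering a test function from its fractional gradient\<close>

lemma nn_integral_heat_kernel_reflect:
  assumes "0 < \<sigma>"
  shows "(\<integral>\<^sup>+w. ennreal (heat_kernel \<sigma> (y - w)) \<partial>(lborel :: 'a::euclidean_space measure)) = 1"
  using nn_integral_lborel_reflect[of "\<lambda>z. ennreal (heat_kernel \<sigma> z)" y] nn_integral_heat_kernel[OF assms, where 'a='a]
  by simp

lemma heat_kernel_le:
  fixes z :: "'a::euclidean_space"
  assumes "0 < \<tau>"
  shows "heat_kernel \<tau> z \<le> (4 * pi * \<tau>) powr (- real DIM('a) / 2)"
proof -
  have "exp (- (norm z)\<^sup>2 / (4 * \<tau>)) \<le> 1" using assms by simp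
  thus ?thesis unfolding heat_kernel_def by (intro mult_left_le) auto
qed

lemma locally_integrable_heat_kernel:
  assumes "0 < \<sigma>"
  shows "locally_integrable (heat_kernel \<sigma>)"
  unfolding locally_integrable_def set_integrable_def
  by (intro allI integrable_mult_indicator integrable_heat_kernel assms) simp

text \<open>
  The first bound is needed for short times, the second one for long times.
\<close>
lemma heat_flow_bounds:
  fixes g :: "'a::euclidean_space \<Rightarrow> 'b::euclidean_space"
  assumes g: "C0_ball R g" "\<And>x. norm (g x) \<le> B" and \<sigma>: "0 < \<sigma>"
  shows "norm (convolve (heat_kernel \<sigma>) g y) \<le> B"
    and "norm (convolve (heat_kernel \<sigma>) g y) \<le> (4 * pi * \<sigma>) powr (- real DIM('a) / 2) * (\<integral>w. norm (g w) \<partial>lborel)"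
proof -
  note i = integrable_lborel_reflect[OF integrable_heat_kernel[OF \<sigma>, where 'a='a], of y]
  have ig: "integrable lborel g" using convolution_integrable[OF locally_integrable_const[of 1] g(1)] by simp
  have B: "0 \<le> B" using g(2)[of 0] norm_ge_zero[of "g 0"] by linarith
  have "norm (convolve (heat_kernel \<sigma>) g y) \<le> (\<integral>w. norm (heat_kernel \<sigma> (y - w) *\<^sub>R g w) \<partial>lborel)"
    unfolding convolve_def by (rule integral_norm_bound)
  also have "\<dots> \<le> (\<integral>w. heat_kernel \<sigma> (y - w) * B \<partial>lborel)"
    using i g B by (intro integral_mono') (auto intro!: mult_left_mono)
  also have "\<dots> = B"
    using integral_heat_kernel[OF \<sigma>, where 'a='a] by (simp add: integral_lborel_reflect)
  finally show "norm (convolve (heat_kernel \<sigma>) g y) \<le> B" .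
  have "norm (convolve (heat_kernel \<sigma>) g y) \<le> (\<integral>w. norm (heat_kernel \<sigma> (y - w) *\<^sub>R g w) \<partial>lborel)"
    unfolding convolve_def by (rule integral_norm_bound)
  also have "\<dots> \<le> (\<integral>w. (4 * pi * \<sigma>) powr (- real DIM('a) / 2) * norm (g w) \<partial>lborel)"
    using ig heat_kernel_le[OF \<sigma>, where 'a='a] by (intro integral_mono') (auto intro!: mult_right_mono)
  finally show "norm (convolve (heat_kernel \<sigma>) g y) \<le> (4 * pi * \<sigma>) powr (- real DIM('a) / 2) * (\<integral>w. norm (g w) \<partial>lborel)"
    by simp
qed

text \<open>
  For \<open>g = D\<phi>\<close> this is \<open>\<nabla>G\<^sub>\<rho> * D\<phi> = \<Delta>G\<^sub>\<rho> * \<phi>\<close>, the time derivative of the heat flow of \<open>\<phi>\<close> at \<open>x\<close>.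
\<close>
definition heat_flux :: "('a::euclidean_space \<Rightarrow> 'a) \<Rightarrow> 'a \<Rightarrow> real \<Rightarrow> real" where
  "heat_flux g x \<rho> = (\<integral>y. heat_grad \<rho> (x - y) \<bullet> g y \<partial>lborel)"

lemma measurable_heat_flux [measurable]:
  assumes [measurable]: "g \<in> borel_measurable borel"
  shows "heat_flux g x \<in> borel_measurable borel"
  unfolding heat_flux_def[abs_def] by measurable

text \<open>The semigroup law, integrated against \<open>g\<close>.\<close>
lemma heat_flux_heat_flow:
  assumes g: "C0_ball R g" and pos: "0 < \<tau>" "0 < \<sigma>"
  shows "heat_flux (convolve (heat_kernel \<sigma>) g) x \<tau> = heat_flux g x (\<tau> + \<sigma>)"
proof -
  have [measurable]: "g \<in> borel_measurable borel" using g by (rule C0_ball_measurable)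
  obtain B where B: "0 \<le> B" "\<And>x. norm (g x) \<le> B" using C0_ball_bounded[OF g] by metis
  let ?f = "\<lambda>y w. heat_grad \<tau> (x - y) \<bullet> (heat_kernel \<sigma> (y - w) *\<^sub>R g w)"
  have int: "integrable (lborel \<Otimes>\<^sub>M lborel) (\<lambda>(y, w). ?f y w)"
  proof (rule integrableI_bounded)
    have "(\<integral>\<^sup>+p. ennreal (norm (case p of (y, w) \<Rightarrow> ?f y w)) \<partial>(lborel \<Otimes>\<^sub>M lborel)) =
      (\<integral>\<^sup>+y. \<integral>\<^sup>+w. ennreal (norm (?f y w)) \<partial>lborel \<partial>lborel)"
      by (subst lborel.nn_integral_fst [symmetric]) auto
    also have "\<dots> \<le> (\<integral>\<^sup>+y. \<integral>\<^sup>+w. ennreal (B * norm (heat_grad \<tau> (x - y))) * ennreal (heat_kernel \<sigma> (y - w)) \<partial>lborel \<partial>lborel)"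
    proof (intro nn_integral_mono)
      fix y w :: 'a
      have "norm (?f y w) \<le> norm (heat_grad \<tau> (x - y)) * norm (heat_kernel \<sigma> (y - w) *\<^sub>R g w)"
        unfolding real_norm_def by (rule Cauchy_Schwarz_ineq2)
      also have "\<dots> \<le> norm (heat_grad \<tau> (x - y)) * (heat_kernel \<sigma> (y - w) * B)"
        using B by (intro mult_left_mono) (auto intro!: mult_left_mono)
      finally show "ennreal (norm (?f y w)) \<le> ennreal (B * norm (heat_grad \<tau> (x - y))) * ennreal (heat_kernel \<sigma> (y - w))"
        using B by (subst ennreal_mult [symmetric]) (auto intro!: ennreal_leI simp: mult_ac)
    qed
    also have "\<dots> = (\<integral>\<^sup>+y. ennreal (B * norm (heat_grad \<tau> (x - y))) \<partial>lborel)"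
      by (simp add: nn_integral_cmult nn_integral_heat_kernel_reflect[OF pos(2)])
    also have "\<dots> < \<infinity>"
      using integrable_norm[OF integrable_lborel_reflect[OF integrable_heat_grad[OF pos(1), where 'a='a], of x]] B(1)
      by (simp add: ennreal_mult nn_integral_cmult integrable_iff_bounded ennreal_mult_less_top)
    finally show "(\<integral>\<^sup>+p. ennreal (norm (case p of (y, w) \<Rightarrow> ?f y w)) \<partial>(lborel \<Otimes>\<^sub>M lborel)) < \<infinity>" .
  qed (simp add: case_prod_unfold)
  have "heat_flux (convolve (heat_kernel \<sigma>) g) x \<tau> = (\<integral>y. \<integral>w. ?f y w \<partial>lborel \<partial>lborel)"
    unfolding heat_flux_def convolve_def
    using convolution_integrable[OF locally_integrable_heat_kernel[OF pos(2)] g]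
    by (intro Bochner_Integration.integral_cong refl, subst integral_inner_right) auto
  also have "\<dots> = (\<integral>w. \<integral>y. ?f y w \<partial>lborel \<partial>lborel)"
    using lborel_pair.Fubini_integral[OF int] by simp
  also have "\<dots> = heat_flux g x (\<tau> + \<sigma>)"
    unfolding heat_flux_def
  proof (rule Bochner_Integration.integral_cong[OF refl])
    fix w :: 'a
    let ?v = "\<lambda>y. heat_kernel \<sigma> y *\<^sub>R heat_grad \<tau> ((x - w) - y)"
    have hb: "heat_kernel \<sigma> y \<le> (4 * pi * \<sigma>) powr (- real DIM('a) / 2)" for y :: 'a
      by (rule heat_kernel_le[OF pos(2)])
    have i: "integrable lborel ?v"
    proof (rule Bochner_Integration.integrable_bound)
      show "integrable lborel (\<lambda>y. (4 * pi * \<sigma>) powr (- real DIM('a) / 2) *\<^sub>R heat_grad \<tau> ((x - w) - y))"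
        by (intro integrable_scaleR_right integrable_lborel_reflect integrable_heat_grad pos)
      show "AE y in lborel. norm (?v y) \<le> norm ((4 * pi * \<sigma>) powr (- real DIM('a) / 2) *\<^sub>R heat_grad \<tau> ((x - w) - y))"
        using hb by (intro AE_I2) (auto intro!: mult_right_mono)
    qed simp
    have "(\<integral>y. ?f y w \<partial>lborel) = (\<integral>y. ?v (- w + 1 *\<^sub>R y) \<bullet> g w \<partial>lborel)"
      by (intro Bochner_Integration.integral_cong refl) (simp add: algebra_simps)
    also have "\<dots> = (\<integral>y. ?v (- w + 1 *\<^sub>R y) \<partial>lborel) \<bullet> g w"
      using integrable_lborel_affine[OF _ i, of 1 "- w"] by (intro integral_inner_left) auto
    also have "(\<integral>y. ?v (- w + 1 *\<^sub>R y) \<partial>lborel) = (\<integral>y. ?v y \<partial>lborel)"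
      using integral_lborel_affine[OF _ i, of 1 "- w"] by simp
    also have "\<dots> = heat_grad (\<tau> + \<sigma>) (x - w)"
      by (rule heat_grad_convolution[OF pos])
    finally show "(\<integral>y. ?f y w \<partial>lborel) = heat_grad (\<tau> + \<sigma>) (x - w) \<bullet> g w" .
  qed
  finally show ?thesis .
qed

text \<open>
  A Riesz potential is a superposition of heat flows.
\<close>
lemma convolve_riesz_eq_heat_flow:
  fixes g :: "'a::euclidean_space \<Rightarrow> 'b::euclidean_space"
  assumes b: "0 < b" "b < real DIM('a)" and g: "C0_ball R g"
  shows "Gamma (b / 2) *\<^sub>R convolve (riesz_kernel b) g y =
    (\<integral>\<sigma>. (indicator {0<..} \<sigma> * \<sigma> powr (b / 2 - 1)) *\<^sub>R convolve (heat_kernel \<sigma>) g y \<partial>lborel)"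
proof -
  have [measurable]: "g \<in> borel_measurable borel" using g by (rule C0_ball_measurable)
  let ?w = "\<lambda>\<sigma>::real. indicator {0<..} \<sigma> * \<sigma> powr (b / 2 - 1) :: real"
  let ?f = "\<lambda>w \<sigma>. (?w \<sigma> * heat_kernel \<sigma> (y - w)) *\<^sub>R g w"
  have G: "0 < Gamma (b / 2)" using b by (intro Gamma_real_pos) auto
  have nn: "0 \<le> riesz_kernel b z" for z :: 'a using b by (intro riesz_kernel_nonneg)
  have ne: "AE w in lborel. y \<noteq> w" using AE_lborel_singleton[of y] by eventually_elim auto
  have sub: "(\<integral>\<^sup>+\<sigma>. ennreal (?w \<sigma> * heat_kernel \<sigma> (y - w)) \<partial>lborel) = ennreal (Gamma (b / 2) * riesz_kernel b (y - w))"
    if "y \<noteq> w" for w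
  proof -
    have "(\<integral>\<^sup>+\<sigma>. ennreal (?w \<sigma> * heat_kernel \<sigma> (y - w)) \<partial>lborel) =
      (\<integral>\<^sup>+\<sigma>. ennreal (\<sigma> powr (b / 2 - 1)) * indicator {0<..} \<sigma> * ennreal (heat_kernel \<sigma> (y - w)) \<partial>lborel)"
      by (intro nn_integral_cong) (auto simp: indicator_def ennreal_mult)
    thus ?thesis using that b G nn by (simp add: riesz_kernel_subordination ennreal_mult)
  qed
  have int: "integrable (lborel \<Otimes>\<^sub>M lborel) (\<lambda>(w, \<sigma>). ?f w \<sigma>)"
  proof (rule integrableI_bounded)
    have "(\<integral>\<^sup>+p. ennreal (norm (case p of (w, \<sigma>) \<Rightarrow> ?f w \<sigma>)) \<partial>(lborel \<Otimes>\<^sub>M lborel)) =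
      (\<integral>\<^sup>+w. \<integral>\<^sup>+\<sigma>. ennreal (?w \<sigma> * heat_kernel \<sigma> (y - w)) * ennreal (norm (g w)) \<partial>lborel \<partial>lborel)"
      by (subst lborel.nn_integral_fst [symmetric]) (auto simp: ennreal_mult)
    also have "\<dots> = (\<integral>\<^sup>+w. ennreal (norm ((Gamma (b / 2) * riesz_kernel b (y - w)) *\<^sub>R g w)) \<partial>lborel)"
      using ne
    proof (intro nn_integral_cong_AE, eventually_elim)
      fix w :: 'a assume w: "y \<noteq> w"
      have "(\<integral>\<^sup>+\<sigma>. ennreal (?w \<sigma> * heat_kernel \<sigma> (y - w)) * ennreal (norm (g w)) \<partial>lborel) =
        (\<integral>\<^sup>+\<sigma>. ennreal (?w \<sigma> * heat_kernel \<sigma> (y - w)) \<partial>lborel) * ennreal (norm (g w))"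
        by (subst nn_integral_multc) auto
      thus "(\<integral>\<^sup>+\<sigma>. ennreal (?w \<sigma> * heat_kernel \<sigma> (y - w)) * ennreal (norm (g w)) \<partial>lborel) =
        ennreal (norm ((Gamma (b / 2) * riesz_kernel b (y - w)) *\<^sub>R g w))"
        unfolding sub[OF w] using nn G by (simp add: ennreal_mult abs_mult)
    qed
    also have "\<dots> < \<infinity>"
      using integrable_scaleR_right[OF convolution_integrable[OF locally_integrable_riesz_kernel g, of b y], of "Gamma (b / 2)"] b
      by (simp add: integrable_iff_bounded)
    finally show "(\<integral>\<^sup>+p. ennreal (norm (case p of (w, \<sigma>) \<Rightarrow> ?f w \<sigma>)) \<partial>(lborel \<Otimes>\<^sub>M lborel)) < \<infinity>" .
  qed (simp add: case_prod_unfold)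
  have "Gamma (b / 2) *\<^sub>R convolve (riesz_kernel b) g y = (\<integral>w. (Gamma (b / 2) * riesz_kernel b (y - w)) *\<^sub>R g w \<partial>lborel)"
    unfolding convolve_def by (subst integral_scaleR_right[symmetric]) simp
  also have "\<dots> = (\<integral>w. \<integral>\<sigma>. ?f w \<sigma> \<partial>lborel \<partial>lborel)"
  proof (rule integral_cong_AE)
    show "AE w in lborel. (Gamma (b / 2) * riesz_kernel b (y - w)) *\<^sub>R g w = (\<integral>\<sigma>. ?f w \<sigma> \<partial>lborel)"
      using ne
    proof eventually_elim
      fix w :: 'a assume w: "y \<noteq> w"
      have "(\<integral>\<sigma>. ?w \<sigma> * heat_kernel \<sigma> (y - w) \<partial>lborel) = Gamma (b / 2) * riesz_kernel b (y - w)"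
        using nn G sub[OF w] by (subst integral_eq_nn_integral) auto
      moreover have "integrable lborel (\<lambda>\<sigma>. ?w \<sigma> * heat_kernel \<sigma> (y - w))"
        using sub[OF w] by (intro integrableI_nonneg) auto
      ultimately show "(Gamma (b / 2) * riesz_kernel b (y - w)) *\<^sub>R g w = (\<integral>\<sigma>. ?f w \<sigma> \<partial>lborel)" by simp
    qed
  qed measurable
  also have "\<dots> = (\<integral>\<sigma>. \<integral>w. ?f w \<sigma> \<partial>lborel \<partial>lborel)"
    using lborel_pair.Fubini_integral[OF int] by simp
  also have "\<dots> = (\<integral>\<sigma>. ?w \<sigma> *\<^sub>R convolve (heat_kernel \<sigma>) g y \<partial>lborel)"
    unfolding convolve_def
    by (intro Bochner_Integration.integral_cong refl, subst integral_scaleR_right[symmetric]) simp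
  finally show ?thesis .
qed

text \<open>
  The flux of a Riesz potential is a fractional integral, over later times, of the flux of \<open>g\<close>.
\<close>
lemma heat_flux_riesz:
  fixes g :: "'a::euclidean_space \<Rightarrow> 'a"
  assumes b: "0 < b" "b < real DIM('a)" and g: "C0_ball R g" and \<tau>: "0 < \<tau>"
  shows "Gamma (b / 2) * heat_flux (convolve (riesz_kernel b) g) x \<tau> =
    (\<integral>\<sigma>. indicator {0<..} \<sigma> * \<sigma> powr (b / 2 - 1) * heat_flux g x (\<tau> + \<sigma>) \<partial>lborel)"
proof -
  let ?d = "real DIM('a)"
  have [measurable]: "g \<in> borel_measurable borel" using g by (rule C0_ball_measurable)
  obtain B where B: "0 \<le> B" "\<And>x. norm (g x) \<le> B" using C0_ball_bounded[OF g] by metis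
  define C where "C = (4 * pi) powr (- ?d / 2) * (\<integral>w. norm (g w) \<partial>lborel)"
  have C: "0 \<le> C" unfolding C_def by (intro mult_nonneg_nonneg integral_nonneg_AE) auto
  let ?w = "\<lambda>\<sigma>::real. indicator {0<..} \<sigma> * \<sigma> powr (b / 2 - 1) :: real"
  let ?P = "\<lambda>\<sigma> y. convolve (heat_kernel \<sigma>) g y"
  let ?f = "\<lambda>\<sigma> y. heat_grad \<tau> (x - y) \<bullet> (?w \<sigma> *\<^sub>R ?P \<sigma> y)"
  \<comment> \<open>Integrable in \<open>\<sigma>\<close> and a bound uniform in \<open>y\<close>; this makes Fubini's theorem applicable below.\<close>
  define M where "M = (\<lambda>\<sigma>::real. B * (indicator {0<..1} \<sigma> * \<sigma> powr (b / 2 - 1)) + C * (indicator {1..} \<sigma> * \<sigma> powr (- ((?d - b) / 2) - 1)))"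
  have M0: "0 \<le> M \<sigma>" for \<sigma> using B C by (simp add: M_def)
  have PM: "?w \<sigma> * norm (?P \<sigma> y) \<le> M \<sigma>" for \<sigma> y
  proof (cases "0 < \<sigma>")
    case \<sigma>: True
    note bd = heat_flow_bounds[OF g B(2) \<sigma>, of y]
    show ?thesis
    proof (cases "\<sigma> \<le> 1")
      case True
      have "\<sigma> powr (b / 2 - 1) * norm (?P \<sigma> y) \<le> \<sigma> powr (b / 2 - 1) * B"
        using bd(1) by (intro mult_left_mono) auto
      moreover have "0 \<le> C * (indicator {1..} \<sigma> * \<sigma> powr (- ((?d - b) / 2) - 1))" using C by simp
      moreover have "?w \<sigma> = \<sigma> powr (b / 2 - 1)" "indicator {0<..1} \<sigma> = (1::real)" using \<sigma> True by simp_all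
      ultimately show ?thesis unfolding M_def by (simp only: mult_1 mult.commute[of B])
    next
      case False
      have "\<sigma> powr (b / 2 - 1) * norm (?P \<sigma> y) \<le> \<sigma> powr (b / 2 - 1) * ((4 * pi * \<sigma>) powr (- ?d / 2) * (\<integral>w. norm (g w) \<partial>lborel))"
        using bd(2) by (intro mult_left_mono) auto
      also have "\<dots> = C * (\<sigma> powr (b / 2 - 1) * \<sigma> powr (- ?d / 2))"
        using \<sigma> by (simp add: C_def powr_mult)
      also have "\<sigma> powr (b / 2 - 1) * \<sigma> powr (- ?d / 2) = \<sigma> powr (- ((?d - b) / 2) - 1)"
      proof -
        have "b / 2 - 1 + - ?d / 2 = - ((?d - b) / 2) - 1" by (simp add: field_simps)
        thus ?thesis by (simp only: powr_add [symmetric])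
      qed
      finally show ?thesis using \<sigma> False unfolding M_def by simp
    qed
  qed (use M0 in auto)
  have [measurable]: "M \<in> borel_measurable borel" unfolding M_def by measurable
  have Mfin: "(\<integral>\<^sup>+\<sigma>. ennreal (M \<sigma>) \<partial>lborel) < \<infinity>"
  proof -
    have "(\<integral>\<^sup>+\<sigma>. ennreal (M \<sigma>) \<partial>lborel) =
      (\<integral>\<^sup>+\<sigma>. ennreal B * (ennreal (\<sigma> powr (b / 2 - 1)) * indicator {0<..1} \<sigma>) + ennreal C * (ennreal (\<sigma> powr (- ((?d - b) / 2) - 1)) * indicator {1..} \<sigma>) \<partial>lborel)"
      using B C by (intro nn_integral_cong) (auto simp: M_def indicator_def ennreal_mult)
    also have "\<dots> = ennreal B * (\<integral>\<^sup>+\<sigma>. ennreal (\<sigma> powr (b / 2 - 1)) * indicator {0<..1} \<sigma> \<partial>lborel) +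
      ennreal C * (\<integral>\<^sup>+\<sigma>. ennreal (\<sigma> powr (- ((?d - b) / 2) - 1)) * indicator {1..} \<sigma> \<partial>lborel)"
      by (simp add: nn_integral_add nn_integral_cmult)
    also have "\<dots> < \<infinity>"
      using b by (subst nn_integral_powr_Ioc, simp, simp, subst nn_integral_powr_Ici) (auto simp: ennreal_mult_less_top)
    finally show ?thesis .
  qed
  have int: "integrable (lborel \<Otimes>\<^sub>M lborel) (\<lambda>(\<sigma>, y). ?f \<sigma> y)"
  proof (rule integrableI_bounded)
    show "(\<lambda>(\<sigma>, y). ?f \<sigma> y) \<in> borel_measurable (lborel \<Otimes>\<^sub>M lborel)"
      unfolding convolve_def by (simp add: case_prod_unfold)
    have "(\<integral>\<^sup>+p. ennreal (norm (case p of (\<sigma>, y) \<Rightarrow> ?f \<sigma> y)) \<partial>(lborel \<Otimes>\<^sub>M lborel)) =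
      (\<integral>\<^sup>+\<sigma>. \<integral>\<^sup>+y. ennreal (norm (?f \<sigma> y)) \<partial>lborel \<partial>lborel)"
      unfolding convolve_def by (subst lborel.nn_integral_fst [symmetric]) (auto simp: case_prod_unfold)
    also have "\<dots> \<le> (\<integral>\<^sup>+\<sigma>. \<integral>\<^sup>+y. ennreal (M \<sigma>) * ennreal (norm (heat_grad \<tau> (x - y))) \<partial>lborel \<partial>lborel)"
    proof (intro nn_integral_mono)
      fix \<sigma> and y :: 'a
      have "norm (?f \<sigma> y) \<le> norm (heat_grad \<tau> (x - y)) * norm (?w \<sigma> *\<^sub>R ?P \<sigma> y)"
        unfolding real_norm_def by (rule Cauchy_Schwarz_ineq2)
      also have "\<dots> \<le> norm (heat_grad \<tau> (x - y)) * M \<sigma>"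
        using PM[of \<sigma> y] by (intro mult_left_mono) (auto simp: abs_mult)
      finally show "ennreal (norm (?f \<sigma> y)) \<le> ennreal (M \<sigma>) * ennreal (norm (heat_grad \<tau> (x - y)))"
        using M0 by (subst ennreal_mult [symmetric]) (auto intro!: ennreal_leI simp: mult_ac)
    qed
    also have "\<dots> = (\<integral>\<^sup>+\<sigma>. ennreal (M \<sigma>) \<partial>lborel) * (\<integral>\<^sup>+y. ennreal (norm (heat_grad \<tau> (x - y))) \<partial>lborel)"
      by (simp add: nn_integral_cmult nn_integral_multc)
    also have "\<dots> < \<infinity>"
      using Mfin integrable_norm[OF integrable_lborel_reflect[OF integrable_heat_grad[OF \<tau>, where 'a='a], of x]]
      by (simp add: integrable_iff_bounded ennreal_mult_less_top)
    finally show "(\<integral>\<^sup>+p. ennreal (norm (case p of (\<sigma>, y) \<Rightarrow> ?f \<sigma> y)) \<partial>(lborel \<Otimes>\<^sub>M lborel)) < \<infinity>" .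
  qed
  have intP: "integrable lborel (\<lambda>\<sigma>. ?w \<sigma> *\<^sub>R ?P \<sigma> y)" for y
  proof (rule integrableI_bounded)
    show "(\<lambda>\<sigma>. ?w \<sigma> *\<^sub>R ?P \<sigma> y) \<in> borel_measurable lborel"
      unfolding convolve_def by simp
    have "(\<integral>\<^sup>+\<sigma>. ennreal (norm (?w \<sigma> *\<^sub>R ?P \<sigma> y)) \<partial>lborel) \<le> (\<integral>\<^sup>+\<sigma>. ennreal (M \<sigma>) \<partial>lborel)"
      using PM by (intro nn_integral_mono ennreal_leI) (simp add: abs_mult)
    thus "(\<integral>\<^sup>+\<sigma>. ennreal (norm (?w \<sigma> *\<^sub>R ?P \<sigma> y)) \<partial>lborel) < \<infinity>" using Mfin by (rule le_less_trans)
  qed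
  have "Gamma (b / 2) * heat_flux (convolve (riesz_kernel b) g) x \<tau> =
    (\<integral>y. heat_grad \<tau> (x - y) \<bullet> (Gamma (b / 2) *\<^sub>R convolve (riesz_kernel b) g y) \<partial>lborel)"
    unfolding heat_flux_def by (subst integral_mult_right_zero[symmetric]) simp
  also have "\<dots> = (\<integral>y. \<integral>\<sigma>. ?f \<sigma> y \<partial>lborel \<partial>lborel)"
    unfolding convolve_riesz_eq_heat_flow[OF b g]
    using intP by (intro Bochner_Integration.integral_cong refl, subst integral_inner_right) auto
  also have "\<dots> = (\<integral>\<sigma>. \<integral>y. ?f \<sigma> y \<partial>lborel \<partial>lborel)"
    by (rule lborel_pair.Fubini_integral[OF int])
  also have "\<dots> = (\<integral>\<sigma>. ?w \<sigma> * heat_flux g x (\<tau> + \<sigma>) \<partial>lborel)"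
  proof (rule Bochner_Integration.integral_cong[OF refl])
    fix \<sigma> :: real
    have "(\<integral>y. ?f \<sigma> y \<partial>lborel) = ?w \<sigma> * heat_flux (?P \<sigma>) x \<tau>"
      unfolding heat_flux_def by (subst integral_mult_right_zero[symmetric]) (simp add: mult_ac)
    thus "(\<integral>y. ?f \<sigma> y \<partial>lborel) = ?w \<sigma> * heat_flux g x (\<tau> + \<sigma>)"
      using heat_flux_heat_flow[OF g \<tau>, of \<sigma> x] by (cases "0 < \<sigma>") auto
  qed
  finally show ?thesis .
qed

text \<open>
  The substitution \<open>z = \<surd>\<rho> w\<close> moves the time dependence from the kernel to the argument of \<open>g\<close>.
\<close>
lemma heat_flux_scaled:
  fixes g :: "'a::euclidean_space \<Rightarrow> 'a"
  assumes g: "C0_ball R g" and \<rho>: "0 < \<rho>"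
  shows "heat_flux g x \<rho> = (\<integral>w. - (heat_kernel 1 w * (w \<bullet> g (x - sqrt \<rho> *\<^sub>R w)) / (2 * sqrt \<rho>)) \<partial>lborel)"
proof -
  let ?d = "real DIM('a)"
  have [measurable]: "g \<in> borel_measurable borel" using g by (rule C0_ball_measurable)
  obtain B where B: "0 \<le> B" "\<And>x. norm (g x) \<le> B" using C0_ball_bounded[OF g] by metis
  let ?F = "\<lambda>z. heat_grad \<rho> z \<bullet> g (x - z)"
  have int: "integrable lborel ?F"
  proof (rule Bochner_Integration.integrable_bound)
    show "integrable lborel (\<lambda>z::'a. B * norm (heat_grad \<rho> z))"
      by (intro integrable_mult_right integrable_norm integrable_heat_grad \<rho>)
    have "norm (?F z) \<le> norm (B * norm (heat_grad \<rho> z))" for z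
    proof -
      have "norm (?F z) \<le> norm (heat_grad \<rho> z) * norm (g (x - z))"
        unfolding real_norm_def by (rule Cauchy_Schwarz_ineq2)
      also have "\<dots> \<le> norm (heat_grad \<rho> z) * B" using B by (intro mult_left_mono) auto
      finally show ?thesis using B by (simp add: mult.commute)
    qed
    thus "AE z in lborel. norm (?F z) \<le> norm (B * norm (heat_grad \<rho> z))" by simp
  qed simp
  have "heat_flux g x \<rho> = (\<integral>z. ?F z \<partial>lborel)"
    unfolding heat_flux_def using integral_lborel_reflect[of ?F x] by simp
  also have "\<dots> = sqrt \<rho> ^ DIM('a) * (\<integral>w. ?F (sqrt \<rho> *\<^sub>R w) \<partial>lborel)"
    using integral_lborel_affine[OF _ int, of "sqrt \<rho>" 0] \<rho> by simp
  also have "\<dots> = (\<integral>w. sqrt \<rho> ^ DIM('a) * ?F (sqrt \<rho> *\<^sub>R w) \<partial>lborel)" by simp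
  also have "\<dots> = (\<integral>w. - (heat_kernel 1 w * (w \<bullet> g (x - sqrt \<rho> *\<^sub>R w)) / (2 * sqrt \<rho>)) \<partial>lborel)"
  proof (rule Bochner_Integration.integral_cong[OF refl])
    fix w :: 'a
    have "sqrt \<rho> ^ DIM('a) = \<rho> powr (?d / 2)"
      using \<rho> by (simp add: powr_half_sqrt[symmetric] powr_realpow[symmetric] powr_powr)
    moreover have "(norm (sqrt \<rho> *\<^sub>R w))\<^sup>2 / (4 * \<rho>) = (norm w)\<^sup>2 / 4"
      using \<rho> by (simp add: power_mult_distrib)
    hence "heat_kernel \<rho> (sqrt \<rho> *\<^sub>R w) = \<rho> powr (- ?d / 2) * heat_kernel 1 w"
      using \<rho> by (simp add: heat_kernel_def powr_mult del: norm_scaleR)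
    ultimately have "sqrt \<rho> ^ DIM('a) * heat_kernel \<rho> (sqrt \<rho> *\<^sub>R w) = (\<rho> powr (?d / 2) * \<rho> powr (- ?d / 2)) * heat_kernel 1 w"
      by simp
    also have "\<rho> powr (?d / 2) * \<rho> powr (- ?d / 2) = 1" using \<rho> by (simp add: powr_add[symmetric])
    finally have h: "sqrt \<rho> ^ DIM('a) * heat_kernel \<rho> (sqrt \<rho> *\<^sub>R w) = heat_kernel 1 w" by simp
    have "sqrt \<rho> ^ DIM('a) * ?F (sqrt \<rho> *\<^sub>R w) =
       - ((sqrt \<rho> ^ DIM('a) * heat_kernel \<rho> (sqrt \<rho> *\<^sub>R w)) * (w \<bullet> g (x - sqrt \<rho> *\<^sub>R w)) * (sqrt \<rho> / (2 * \<rho>)))"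
      by (simp add: heat_grad_def)
    also have "sqrt \<rho> / (2 * \<rho>) = 1 / (2 * sqrt \<rho>)"
      using \<rho> real_sqrt_mult_self[of \<rho>] by (simp add: field_simps)
    finally show "sqrt \<rho> ^ DIM('a) * ?F (sqrt \<rho> *\<^sub>R w) = - (heat_kernel 1 w * (w \<bullet> g (x - sqrt \<rho> *\<^sub>R w)) / (2 * sqrt \<rho>))"
      unfolding h by simp
  qed
  finally show ?thesis .
qed

text \<open>
  For fixed \<open>w\<close> the integrand is \<open>\<partial>\<^sub>\<rho> \<phi>(x - \<surd>\<rho> w)\<close>, and \<open>\<phi>(x - \<surd>\<rho> w)\<close> runs from \<open>\<phi>(x)\<close> to \<open>0\<close>.
\<close>
lemma radial_derivative_integral:
  fixes \<phi> :: "'a::euclidean_space \<Rightarrow> real" and x w :: 'a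
  assumes C1: "C1_ball R \<phi> g" and B: "\<And>x. norm (g x) \<le> B" and w: "w \<noteq> 0"
  defines "f \<equiv> \<lambda>\<rho>. indicator {0<..} \<rho> * (- ((w \<bullet> g (x - sqrt \<rho> *\<^sub>R w)) / (2 * sqrt \<rho>)))"
  shows "(\<integral>\<^sup>+\<rho>. ennreal (norm (f \<rho>)) \<partial>lborel) \<le> ennreal (B * (\<bar>R\<bar> + norm x))"
    and "(\<integral>\<rho>. f \<rho> \<partial>lborel) = - \<phi> x"
proof -
  have cs: "C0_ball R \<phi>" "C0_ball R g" using C1 by (auto simp: C1_ball_def)
  have [measurable]: "g \<in> borel_measurable borel" using cs by (auto intro: C0_ball_measurable)
  have B0: "0 \<le> B" using B[of 0] norm_ge_zero[of "g 0"] by linarith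
  define q where "q = (\<bar>R\<bar> + norm x) / norm w"
  have q: "0 \<le> q" by (simp add: q_def)
  have out: "R \<le> norm (x - sqrt \<rho> *\<^sub>R w)" if "q\<^sup>2 \<le> \<rho>" for \<rho>
  proof -
    have "q \<le> sqrt \<rho>" using that q real_le_rsqrt by blast
    hence "q * norm w \<le> sqrt \<rho> * norm w" by (rule mult_right_mono) simp
    also have "sqrt \<rho> * norm w \<le> \<bar>sqrt \<rho>\<bar> * norm w" by (intro mult_right_mono) auto
    finally have "\<bar>R\<bar> + norm x \<le> \<bar>sqrt \<rho>\<bar> * norm w" using w by (simp add: q_def)
    thus ?thesis using norm_triangle_ineq2[of "sqrt \<rho> *\<^sub>R w" x] by (simp add: norm_minus_commute)
  qed
  have f0: "f \<rho> = 0" if "\<rho> \<notin> {0<..q\<^sup>2}" for \<rho>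
    using that out[of \<rho>] cs(2) by (auto simp: f_def C0_ball_def)
  have fb: "norm (f \<rho>) \<le> norm w * B / 2 * (\<rho> powr (1/2 - 1) * indicator {0<..q\<^sup>2} \<rho>)" for \<rho>
  proof (cases "\<rho> \<in> {0<..q\<^sup>2}")
    case True
    have "\<bar>w \<bullet> g (x - sqrt \<rho> *\<^sub>R w)\<bar> \<le> norm w * norm (g (x - sqrt \<rho> *\<^sub>R w))" by (rule Cauchy_Schwarz_ineq2)
    also have "\<dots> \<le> norm w * B" using B by (intro mult_left_mono) auto
    finally have "\<bar>w \<bullet> g (x - sqrt \<rho> *\<^sub>R w)\<bar> / (2 * sqrt \<rho>) \<le> norm w * B / (2 * sqrt \<rho>)"
      using True by (intro divide_right_mono) auto
    moreover have "\<rho> powr (1/2 - 1) = 1 / sqrt \<rho>" using True by (simp add: powr_minus_divide powr_half_sqrt)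
    ultimately show ?thesis using True by (simp add: f_def)
  next
    case False
    thus ?thesis using f0[OF False] by simp
  qed
  have "(\<integral>\<^sup>+\<rho>. ennreal (norm (f \<rho>)) \<partial>lborel) \<le>
    (\<integral>\<^sup>+\<rho>. ennreal (norm w * B / 2) * (ennreal (\<rho> powr (1/2 - 1)) * indicator {0<..q\<^sup>2} \<rho>) \<partial>lborel)"
  proof (rule nn_integral_mono)
    fix \<rho> :: real
    have "ennreal (norm (f \<rho>)) \<le> ennreal (norm w * B / 2 * (\<rho> powr (1/2 - 1) * indicator {0<..q\<^sup>2} \<rho>))"
      by (rule ennreal_leI[OF fb])
    also have "\<dots> = ennreal (norm w * B / 2) * (ennreal (\<rho> powr (1/2 - 1)) * indicator {0<..q\<^sup>2} \<rho>)"
      using B0 by (cases "\<rho> \<in> {0<..q\<^sup>2}") (simp_all add: ennreal_mult' [symmetric])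
    finally show "ennreal (norm (f \<rho>)) \<le> ennreal (norm w * B / 2) * (ennreal (\<rho> powr (1/2 - 1)) * indicator {0<..q\<^sup>2} \<rho>)" .
  qed
  also have "\<dots> = ennreal (norm w * B / 2) * ennreal ((q\<^sup>2) powr (1/2) / (1/2))"
    by (subst nn_integral_cmult, simp, subst nn_integral_powr_Ioc) auto
  also have "\<dots> = ennreal (B * (\<bar>R\<bar> + norm x))"
    using w q B0 by (subst ennreal_mult' [symmetric]) (auto simp: powr_half_sqrt q_def)
  finally show bound: "(\<integral>\<^sup>+\<rho>. ennreal (norm (f \<rho>)) \<partial>lborel) \<le> ennreal (B * (\<bar>R\<bar> + norm x))" .
  have [measurable]: "f \<in> borel_measurable borel" unfolding f_def by measurable
  have "integrable lborel f"
    by (rule integrableI_bounded) (use bound in \<open>auto intro: le_less_trans\<close>)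
  hence "(f has_integral (\<integral>\<rho>. f \<rho> \<partial>lborel)) UNIV" by (rule has_integral_integral_lborel)
  moreover have "(f has_integral - \<phi> x) UNIV"
  proof -
    let ?F = "\<lambda>\<rho>. \<phi> (x - sqrt \<rho> *\<^sub>R w)"
    have contphi: "continuous_on UNIV \<phi>" using cs by (simp add: C0_ball_def)
    have "(f has_integral (?F (q\<^sup>2) - ?F 0)) {0..q\<^sup>2}"
    proof (rule fundamental_theorem_of_calculus_interior)
      show "continuous_on {0..q\<^sup>2} ?F"
        by (intro continuous_on_compose2[OF contphi] continuous_intros) auto
      fix \<rho> assume \<rho>: "\<rho> \<in> {0<..<q\<^sup>2}"
      have "((\<lambda>\<rho>. x - sqrt \<rho> *\<^sub>R w) has_derivative (\<lambda>h. - (h * (inverse (sqrt \<rho>) / 2)) *\<^sub>R w)) (at \<rho>)"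
        using \<rho> by (auto intro!: derivative_eq_intros simp: field_simps)
      moreover have "(\<phi> has_derivative (\<lambda>h. g (x - sqrt \<rho> *\<^sub>R w) \<bullet> h)) (at (x - sqrt \<rho> *\<^sub>R w))"
        using C1 by (simp add: C1_ball_def)
      ultimately have "(?F has_derivative (\<lambda>h. g (x - sqrt \<rho> *\<^sub>R w) \<bullet> (- (h * (inverse (sqrt \<rho>) / 2)) *\<^sub>R w))) (at \<rho>)"
        by (rule has_derivative_compose)
      thus "(?F has_vector_derivative f \<rho>) (at \<rho>)"
        unfolding has_vector_derivative_def using \<rho>
        by (rule_tac has_derivative_eq_rhs) (auto simp: f_def inner_commute field_simps)
    qed simp
    moreover have "?F (q\<^sup>2) = 0" using out[of "q\<^sup>2"] cs(1) by (simp add: C0_ball_def)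
    ultimately have "(f has_integral - \<phi> x) {0..q\<^sup>2}" by simp
    thus ?thesis
      by (rule has_integral_on_superset) (use f0 in auto)
  qed
  ultimately show "(\<integral>\<rho>. f \<rho> \<partial>lborel) = - \<phi> x" by (rule has_integral_unique)
qed

text \<open>
  Integrate first over \<open>\<rho>\<close> and then over \<open>w\<close> against the probability density \<open>G\<^sub>1\<close>.
\<close>
lemma heat_flux_integral:
  fixes \<phi> :: "'a::euclidean_space \<Rightarrow> real"
  assumes C1: "C1_ball R \<phi> g"
  shows "integrable lborel (\<lambda>\<rho>. indicator {0<..} \<rho> * heat_flux g x \<rho>)"
    and "(\<integral>\<rho>. indicator {0<..} \<rho> * heat_flux g x \<rho> \<partial>lborel) = - \<phi> x"
proof -
  have cs: "C0_ball R g" using C1 by (auto simp: C1_ball_def)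
  have [measurable]: "g \<in> borel_measurable borel" using cs by (rule C0_ball_measurable)
  obtain B where B: "0 \<le> B" "\<And>x. norm (g x) \<le> B" using C0_ball_bounded[OF cs] by metis
  let ?r = "\<lambda>w \<rho>. indicator {0<..} \<rho> * (- ((w \<bullet> g (x - sqrt \<rho> *\<^sub>R w)) / (2 * sqrt \<rho>)))"
  let ?f = "\<lambda>w \<rho>. heat_kernel 1 w * ?r w \<rho>"
  have ne: "AE w::'a in lborel. w \<noteq> 0" by (rule AE_lborel_singleton)
  have int: "integrable (lborel \<Otimes>\<^sub>M lborel) (\<lambda>(w, \<rho>). ?f w \<rho>)"
  proof (rule integrableI_bounded)
    have "(\<integral>\<^sup>+p. ennreal (norm (case p of (w, \<rho>) \<Rightarrow> ?f w \<rho>)) \<partial>(lborel \<Otimes>\<^sub>M lborel)) =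
      (\<integral>\<^sup>+w. \<integral>\<^sup>+\<rho>. ennreal (heat_kernel 1 w) * ennreal (norm (?r w \<rho>)) \<partial>lborel \<partial>lborel)"
    proof -
      have "ennreal (norm (?f w \<rho>)) = ennreal (heat_kernel 1 w) * ennreal (norm (?r w \<rho>))" for w \<rho>
        by (subst ennreal_mult [symmetric]) (auto simp: abs_mult)
      thus ?thesis by (subst lborel.nn_integral_fst [symmetric]) (simp_all add: case_prod_unfold)
    qed
    also have "\<dots> \<le> (\<integral>\<^sup>+w. ennreal (heat_kernel 1 w) * ennreal (B * (\<bar>R\<bar> + norm x)) \<partial>(lborel :: 'a measure))"
      using ne
    proof (intro nn_integral_mono_AE, eventually_elim)
      fix w :: 'a assume w: "w \<noteq> 0"
      have "(\<integral>\<^sup>+\<rho>. ennreal (heat_kernel 1 w) * ennreal (norm (?r w \<rho>)) \<partial>lborel) =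
        ennreal (heat_kernel 1 w) * (\<integral>\<^sup>+\<rho>. ennreal (norm (?r w \<rho>)) \<partial>lborel)"
        by (rule nn_integral_cmult) measurable
      also have "\<dots> \<le> ennreal (heat_kernel 1 w) * ennreal (B * (\<bar>R\<bar> + norm x))"
        by (intro mult_left_mono radial_derivative_integral(1)[OF C1 B(2) w]) simp
      finally show "(\<integral>\<^sup>+\<rho>. ennreal (heat_kernel 1 w) * ennreal (norm (?r w \<rho>)) \<partial>lborel) \<le>
        ennreal (heat_kernel 1 w) * ennreal (B * (\<bar>R\<bar> + norm x))" .
    qed
    also have "\<dots> < \<infinity>"
      using nn_integral_heat_kernel[of 1, where 'a='a] by (simp add: nn_integral_multc)
    finally show "(\<integral>\<^sup>+p. ennreal (norm (case p of (w, \<rho>) \<Rightarrow> ?f w \<rho>)) \<partial>(lborel \<Otimes>\<^sub>M lborel)) < \<infinity>" .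
  qed (simp add: case_prod_unfold)
  have flux: "(\<integral>w. ?f w \<rho> \<partial>lborel) = indicator {0<..} \<rho> * heat_flux g x \<rho>" for \<rho>
    using heat_flux_scaled[OF cs, of \<rho> x] by (cases "0 < \<rho>") (auto simp: mult_ac)
  show "integrable lborel (\<lambda>\<rho>. indicator {0<..} \<rho> * heat_flux g x \<rho>)"
    using lborel_pair.integrable_snd[OF int] unfolding flux .
  have "(\<integral>\<rho>. indicator {0<..} \<rho> * heat_flux g x \<rho> \<partial>lborel) = (\<integral>\<rho>. \<integral>w. ?f w \<rho> \<partial>lborel \<partial>lborel)"
    unfolding flux ..
  also have "\<dots> = (\<integral>w. \<integral>\<rho>. ?f w \<rho> \<partial>lborel \<partial>lborel)"
    by (rule lborel_pair.Fubini_integral[OF int])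
  also have "\<dots> = (\<integral>w. heat_kernel 1 w * - \<phi> x \<partial>(lborel :: 'a measure))"
  proof (rule integral_cong_AE)
    show "AE w in lborel. (\<integral>\<rho>. ?f w \<rho> \<partial>lborel) = heat_kernel 1 w * - \<phi> x"
      using ne
    proof eventually_elim
      fix w :: 'a assume w: "w \<noteq> 0"
      show "(\<integral>\<rho>. ?f w \<rho> \<partial>lborel) = heat_kernel 1 w * - \<phi> x"
        by (simp only: integral_mult_right_zero radial_derivative_integral(2)[OF C1 B(2) w])
    qed
  qed measurable
  also have "\<dots> = - \<phi> x" using integral_heat_kernel[of 1, where 'a='a] by simp
  finally show "(\<integral>\<rho>. indicator {0<..} \<rho> * heat_flux g x \<rho> \<partial>lborel) = - \<phi> x" .
qed

text \<open>
  The identity for nonnegative functions, applied to the positive and the negative part of \<open>h\<close>.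
\<close>
lemma integral_powr_convolution:
  fixes a b :: real and h :: "real \<Rightarrow> real"
  assumes ab: "0 < a" "0 < b" "a + b = 1" and h: "integrable lborel (\<lambda>\<rho>. indicator {0<..} \<rho> * h \<rho>)"
  shows "integrable (lborel \<Otimes>\<^sub>M lborel) (\<lambda>(\<tau>, \<sigma>). (indicator {0<..} \<tau> * \<tau> powr (a - 1)) * ((indicator {0<..} \<sigma> * \<sigma> powr (b - 1)) * h (\<tau> + \<sigma>)))"
    and "(\<integral>\<tau>. \<integral>\<sigma>. (indicator {0<..} \<tau> * \<tau> powr (a - 1)) * ((indicator {0<..} \<sigma> * \<sigma> powr (b - 1)) * h (\<tau> + \<sigma>)) \<partial>lborel \<partial>lborel) =
      Beta a b * (\<integral>\<rho>. indicator {0<..} \<rho> * h \<rho> \<partial>lborel)"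
proof -
  let ?k = "\<lambda>\<rho>. indicator {0<..} \<rho> * h \<rho>"
  let ?F = "\<lambda>(\<tau>, \<sigma>). (indicator {0<..} \<tau> * \<tau> powr (a - 1)) * ((indicator {0<..} \<sigma> * \<sigma> powr (b - 1)) * h (\<tau> + \<sigma>)) :: real"
  have [measurable]: "?k \<in> borel_measurable borel" using borel_measurable_integrable[OF h] by simp
  have Feq: "?F = (\<lambda>(\<tau>, \<sigma>). (indicator {0<..} \<tau> * \<tau> powr (a - 1)) * ((indicator {0<..} \<sigma> * \<sigma> powr (b - 1)) * ?k (\<tau> + \<sigma>)))"
    by (auto simp: fun_eq_iff indicator_def)
  have meas: "?F \<in> borel_measurable (lborel \<Otimes>\<^sub>M lborel)"
    unfolding Feq by (simp add: case_prod_unfold)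
  have Beta0: "0 \<le> Beta a b" using ab by (simp add: Beta_def Gamma_real_pos less_imp_le)
  have nn: "(\<integral>\<^sup>+p. ennreal (c * ?F p) \<partial>(lborel \<Otimes>\<^sub>M lborel)) = ennreal (Beta a b) * (\<integral>\<^sup>+\<rho>. ennreal (c * ?k \<rho>) \<partial>lborel)" for c
  proof -
    have "(\<integral>\<^sup>+p. ennreal (c * ?F p) \<partial>(lborel \<Otimes>\<^sub>M lborel)) = (\<integral>\<^sup>+\<tau>. \<integral>\<^sup>+\<sigma>. ennreal (c * ?F (\<tau>, \<sigma>)) \<partial>lborel \<partial>lborel)"
      using meas by (subst lborel.nn_integral_fst [symmetric]) auto
    also have "\<dots> = (\<integral>\<^sup>+\<tau>. \<integral>\<^sup>+\<sigma>. ennreal (\<tau> powr (a - 1)) * indicator {0<..} \<tau> *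
      (ennreal (\<sigma> powr (b - 1)) * indicator {0<..} \<sigma>) * ennreal (c * ?k (\<tau> + \<sigma>)) \<partial>lborel \<partial>lborel)"
      by (intro nn_integral_cong) (auto simp: indicator_def ennreal_mult' [symmetric] mult_ac)
    also have "\<dots> = ennreal (Beta a b) * (\<integral>\<^sup>+\<rho>. ennreal (\<rho> powr (a + b - 1)) * indicator {0<..} \<rho> * ennreal (c * ?k \<rho>) \<partial>lborel)"
      by (rule nn_integral_powr_convolution[OF ab(1,2)]) measurable
    also have "(\<integral>\<^sup>+\<rho>. ennreal (\<rho> powr (a + b - 1)) * indicator {0<..} \<rho> * ennreal (c * ?k \<rho>) \<partial>lborel) = (\<integral>\<^sup>+\<rho>. ennreal (c * ?k \<rho>) \<partial>lborel)"
      using ab(3) by (intro nn_integral_cong) (auto simp: indicator_def)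
    finally show ?thesis .
  qed
  have fin: "(\<integral>\<^sup>+\<rho>. ennreal (c * ?k \<rho>) \<partial>lborel) < \<infinity>" if "\<bar>c\<bar> = 1" for c
  proof -
    have "(\<integral>\<^sup>+\<rho>. ennreal (c * ?k \<rho>) \<partial>lborel) \<le> (\<integral>\<^sup>+\<rho>. ennreal (norm (?k \<rho>)) \<partial>lborel)"
      using that by (intro nn_integral_mono ennreal_leI) (auto simp: abs_if split: if_splits)
    also have "\<dots> < \<infinity>" using h by (simp add: integrable_iff_bounded)
    finally show ?thesis .
  qed
  have fin': "(\<integral>\<^sup>+p. ennreal (?F p) \<partial>(lborel \<Otimes>\<^sub>M lborel)) < \<infinity>" "(\<integral>\<^sup>+p. ennreal (- ?F p) \<partial>(lborel \<Otimes>\<^sub>M lborel)) < \<infinity>"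
    using nn[of 1] nn[of "-1"] fin[of 1] fin[of "-1"] by (simp_all add: ennreal_mult_less_top)
  thus int: "integrable (lborel \<Otimes>\<^sub>M lborel) ?F"
    using meas by (auto simp: real_integrable_def)
  have "(\<integral>\<tau>. \<integral>\<sigma>. ?F (\<tau>, \<sigma>) \<partial>lborel \<partial>lborel) = (\<integral>p. ?F p \<partial>(lborel \<Otimes>\<^sub>M lborel))"
    by (rule lborel_pair.integral_fst'[OF int])
  also have "\<dots> = enn2real (\<integral>\<^sup>+p. ennreal (?F p) \<partial>(lborel \<Otimes>\<^sub>M lborel)) - enn2real (\<integral>\<^sup>+p. ennreal (- ?F p) \<partial>(lborel \<Otimes>\<^sub>M lborel))"
    by (rule real_lebesgue_integral_def[OF int])
  also have "\<dots> = Beta a b * (enn2real (\<integral>\<^sup>+\<rho>. ennreal (?k \<rho>) \<partial>lborel) - enn2real (\<integral>\<^sup>+\<rho>. ennreal (- ?k \<rho>) \<partial>lborel))"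
    using nn[of 1] nn[of "-1"] Beta0 by (simp add: enn2real_mult right_diff_distrib)
  also have "\<dots> = Beta a b * (\<integral>\<rho>. ?k \<rho> \<partial>lborel)"
    by (simp only: real_lebesgue_integral_def[OF h])
  finally show "(\<integral>\<tau>. \<integral>\<sigma>. (indicator {0<..} \<tau> * \<tau> powr (a - 1)) * ((indicator {0<..} \<sigma> * \<sigma> powr (b - 1)) * h (\<tau> + \<sigma>)) \<partial>lborel \<partial>lborel) =
      Beta a b * (\<integral>\<rho>. ?k \<rho> \<partial>lborel)" by simp
qed

text \<open>
  The weight \<open>\<tau>\<^bsup>(s-1)/2\<^esup>\<close> undoes the fractional integration hidden in \<open>D\<^sup>s\<phi>\<close>: the two weights
  combine to a Beta integral of total order one, and \<open>-\<integral> heat_flux\<close> is \<open>\<phi>\<close>.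
\<close>
lemma test_function_from_frac_grad:
  fixes \<phi> :: "'a::euclidean_space \<Rightarrow> real"
  assumes \<phi>: "\<phi> \<in> Cc_infinity \<Omega>" and s: "0 < s" "s \<le> 1"
  shows "integrable lborel (\<lambda>\<tau>. (indicator {0<..} \<tau> * \<tau> powr ((1 + s) / 2 - 1)) * heat_flux (test_frac_grad s \<phi>) x \<tau>)"
    and "(\<integral>\<tau>. (indicator {0<..} \<tau> * \<tau> powr ((1 + s) / 2 - 1)) * heat_flux (test_frac_grad s \<phi>) x \<tau> \<partial>lborel) = - Gamma ((1 + s) / 2) * \<phi> x"
proof -
  have d1: "1 \<le> real DIM('a)" using DIM_positive[where 'a='a] by linarith
  obtain R where "\<phi> \<in> Cc_infinity (ball 0 R)" using Cc_infinity_obtain_radius[OF \<phi>] by metis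
  hence C1: "C1_ball R \<phi> (grad \<phi>)" by (intro Cc_infinity_C1_ball) auto
  hence cs: "C0_ball R (grad \<phi>)" by (simp add: C1_ball_def)
  let ?wa = "\<lambda>\<tau>::real. indicator {0<..} \<tau> * \<tau> powr ((1 + s) / 2 - 1) :: real"
  note h = heat_flux_integral[OF C1, of x]
  have *: "integrable lborel (\<lambda>\<tau>. ?wa \<tau> * heat_flux (test_frac_grad s \<phi>) x \<tau>) \<and>
    (\<integral>\<tau>. ?wa \<tau> * heat_flux (test_frac_grad s \<phi>) x \<tau> \<partial>lborel) = - Gamma ((1 + s) / 2) * \<phi> x"
  proof (cases "s = 1")
    case True
    have "?wa \<tau> * heat_flux (test_frac_grad s \<phi>) x \<tau> = indicator {0<..} \<tau> * heat_flux (grad \<phi>) x \<tau>" for \<tau>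
      using True by (auto simp: indicator_def)
    hence eq: "(\<lambda>\<tau>. ?wa \<tau> * heat_flux (test_frac_grad s \<phi>) x \<tau>) = (\<lambda>\<tau>. indicator {0<..} \<tau> * heat_flux (grad \<phi>) x \<tau>)"
      by (rule ext)
    show ?thesis unfolding eq using h True by simp
  next
    case False
    define a b where "a = (1 + s) / 2" and "b = (1 - s) / 2"
    have ab: "0 < a" "0 < b" "a + b = 1" using s False by (auto simp: a_def b_def field_simps)
    have s1: "s < 1" using s False by simp
    have b': "0 < 1 - s" "1 - s < real DIM('a)" using s s1 d1 by linarith+
    have G: "0 < Gamma b" "0 < Gamma a" using ab by (auto intro: Gamma_real_pos)
    have inner: "(\<integral>\<sigma>. (indicator {0<..} \<tau> * \<tau> powr (a - 1)) * ((indicator {0<..} \<sigma> * \<sigma> powr (b - 1)) * heat_flux (grad \<phi>) x (\<tau> + \<sigma>)) \<partial>lborel) =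
      Gamma b * (?wa \<tau> * heat_flux (test_frac_grad s \<phi>) x \<tau>)" for \<tau>
    proof (cases "0 < \<tau>")
      case True
      have "(\<integral>\<sigma>. (indicator {0<..} \<sigma> * \<sigma> powr (b - 1)) * heat_flux (grad \<phi>) x (\<tau> + \<sigma>) \<partial>lborel) =
        Gamma b * heat_flux (test_frac_grad s \<phi>) x \<tau>"
        using heat_flux_riesz[OF b' cs True, of x]
        by (simp add: test_frac_grad_eq_convolve[OF C1 s(1) s1] b_def)
      thus ?thesis by (simp only: integral_mult_right_zero) (simp add: a_def)
    qed simp
    note c = integral_powr_convolution[OF ab h(1)]
    have "integrable lborel (\<lambda>\<tau>. Gamma b * (?wa \<tau> * heat_flux (test_frac_grad s \<phi>) x \<tau>))"
      using lborel_pair.integrable_fst'[OF c(1)] by (simp only: inner case_prod_conv)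
    hence "integrable lborel (\<lambda>\<tau>. 1 / Gamma b * (Gamma b * (?wa \<tau> * heat_flux (test_frac_grad s \<phi>) x \<tau>)))"
      by (rule integrable_mult_right)
    hence int: "integrable lborel (\<lambda>\<tau>. ?wa \<tau> * heat_flux (test_frac_grad s \<phi>) x \<tau>)"
      using G by simp
    have "Gamma b * (\<integral>\<tau>. ?wa \<tau> * heat_flux (test_frac_grad s \<phi>) x \<tau> \<partial>lborel) = Beta a b * - \<phi> x"
      using c(2) unfolding inner h(2) by simp
    also have "\<dots> = Gamma b * (- Gamma a * \<phi> x)" using ab by (simp add: Beta_def)
    finally have "(\<integral>\<tau>. ?wa \<tau> * heat_flux (test_frac_grad s \<phi>) x \<tau> \<partial>lborel) = - Gamma a * \<phi> x"
      using G by (subst (asm) mult_left_cancel) auto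
    thus ?thesis using int by (simp only: a_def simp_thms)
  qed
  from * show "integrable lborel (\<lambda>\<tau>. ?wa \<tau> * heat_flux (test_frac_grad s \<phi>) x \<tau>)" ..
  from * show "(\<integral>\<tau>. ?wa \<tau> * heat_flux (test_frac_grad s \<phi>) x \<tau> \<partial>lborel) = - Gamma ((1 + s) / 2) * \<phi> x" ..
qed

text \<open>
  Take absolute values in the representation and integrate over \<open>\<tau>\<close> first; the integral of \<open>|\<nabla>G\<^sub>\<tau>(z)|\<close> against
  the weight is a multiple of \<open>|z|\<^bsup>s-d\<^esup>\<close>.  Its constant extends continuously to \<open>s = 0\<close>, so it is bounded.
\<close>
lemma abs_test_function_le:
  "\<exists>N>0. \<forall>s (\<phi> :: 'a::euclidean_space \<Rightarrow> real) x. 0 < s \<and> s \<le> 1 \<and> \<phi> \<in> Cc_infinity UNIV \<longrightarrow>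
    ennreal \<bar>\<phi> x\<bar> \<le> ennreal N * (\<integral>\<^sup>+y. ennreal (norm (x - y) powr (s - real DIM('a))) * ennreal (norm (test_frac_grad s \<phi> y)) \<partial>lborel)"
proof -
  let ?d = "real DIM('a)"
  have d1: "1 \<le> ?d" using DIM_positive[where 'a='a] by linarith
  define m where "m = (\<lambda>s. Gamma ((?d - (s - 1)) / 2) * rGamma ((1 + s) / 2) / (2 powr (s - 1) * pi powr (?d / 2)) / 2)"
  have "continuous_on {0..1} m"
    unfolding m_def
  proof (intro continuous_intros)
    show "continuous_on {0..1} (\<lambda>s. Gamma ((?d - (s - 1)) / 2))"
    proof (rule continuous_on_compose2[OF continuous_on_Gamma])
      show "{0<..} \<inter> \<int>\<^sub>\<le>\<^sub>0 = ({} :: real set)" by (auto dest!: nonpos_Ints_nonpos)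
      have "s - 1 < ?d" if "s \<le> 1" for s using that d1 by linarith
      thus "(\<lambda>s. (?d - (s - 1)) / 2) ` {0..1} \<subseteq> {0<..}" by auto
    qed (auto intro!: continuous_intros)
    show "continuous_on {0..1} (\<lambda>s::real. rGamma ((1 + s) / 2))"
      by (intro continuous_on_compose2[OF continuous_on_rGamma] continuous_intros) auto
  qed auto
  hence "bounded (m ` {0..1})" by (intro compact_imp_bounded compact_continuous_image) auto
  then obtain N where "\<forall>y\<in>m ` {0..1}. norm y \<le> N" unfolding bounded_iff by blast
  hence N: "m s \<le> max 1 N" if "0 < s" "s \<le> 1" for s
  proof -
    have "m s \<in> m ` {0..1}" using that by auto
    hence "norm (m s) \<le> N" using \<open>\<forall>y\<in>m ` {0..1}. norm y \<le> N\<close> by blast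
    thus ?thesis by simp
  qed
  have "ennreal \<bar>\<phi> x\<bar> \<le> ennreal (max 1 N) * (\<integral>\<^sup>+y. ennreal (norm (x - y) powr (s - ?d)) * ennreal (norm (test_frac_grad s \<phi> y)) \<partial>lborel)"
    if *: "0 < s" "s \<le> 1" "\<phi> \<in> Cc_infinity UNIV" for s and \<phi> :: "'a \<Rightarrow> real" and x
  proof -
    define a where "a = (1 + s) / 2"
    have G: "0 < Gamma a" using * by (auto simp: a_def intro!: Gamma_real_pos)
    have [measurable]: "test_frac_grad s \<phi> \<in> borel_measurable borel"
      by (rule test_frac_grad_measurable[OF *(3,1,2)])
    let ?I = "\<integral>\<^sup>+y. ennreal (norm (x - y) powr (s - ?d)) * ennreal (norm (test_frac_grad s \<phi> y)) \<partial>lborel"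
    let ?wa = "\<lambda>\<tau>::real. indicator {0<..} \<tau> * \<tau> powr (a - 1) :: real"
    note rep = test_function_from_frac_grad[OF *(3,1,2), of x, folded a_def]
    have "s - 1 < ?d" using * d1 by linarith
    hence "0 < (?d - (s - 1)) / 2" by simp
    hence "0 < Gamma ((?d - (s - 1)) / 2)" by (rule Gamma_real_pos)
    hence m0: "0 \<le> m s" using G unfolding m_def a_def
      by (intro divide_nonneg_nonneg mult_nonneg_nonneg) (auto simp: rGamma_inverse_Gamma)
    have inner: "(\<integral>\<^sup>+\<tau>. ennreal (?wa \<tau>) * ennreal (norm (heat_grad \<tau> z)) \<partial>lborel) = ennreal (Gamma a * m s * norm z powr (s - ?d))"
      if "z \<noteq> 0" for z :: 'a
    proof -
      have "(\<integral>\<^sup>+\<tau>. ennreal (?wa \<tau>) * ennreal (norm (heat_grad \<tau> z)) \<partial>lborel) =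
        (\<integral>\<^sup>+\<tau>. ennreal (norm z / 2) * (ennreal (\<tau> powr ((s - 1) / 2 - 1)) * indicator {0<..} \<tau> * ennreal (heat_kernel \<tau> z)) \<partial>lborel)"
      proof (rule nn_integral_cong)
        fix \<tau> :: real
        have "\<tau> powr (a - 1) * norm (heat_grad \<tau> z) = norm z / 2 * (\<tau> powr ((s - 1) / 2 - 1) * heat_kernel \<tau> z)" if "0 < \<tau>"
        proof -
          have "(s - 1) / 2 - 1 = a - 1 - 1" by (simp add: a_def field_simps)
          hence "\<tau> powr ((s - 1) / 2 - 1) = \<tau> powr (a - 1) / \<tau>" using that by (simp only: powr_diff) simp
          thus ?thesis using that by (simp add: heat_grad_def)
        qed
        thus "ennreal (?wa \<tau>) * ennreal (norm (heat_grad \<tau> z)) =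
          ennreal (norm z / 2) * (ennreal (\<tau> powr ((s - 1) / 2 - 1)) * indicator {0<..} \<tau> * ennreal (heat_kernel \<tau> z))"
          by (cases "0 < \<tau>") (simp_all add: ennreal_mult' [symmetric])
      qed
      also have "\<dots> = ennreal (norm z / 2) * ennreal (Gamma ((?d - (s - 1)) / 2) / (2 powr (s - 1) * pi powr (?d / 2)) * norm z powr (s - 1 - ?d))"
      proof -
        have "s - 1 < ?d" using * d1 by linarith
        thus ?thesis using that by (subst nn_integral_cmult, simp, subst nn_integral_heat_kernel_powr) auto
      qed
      also have "\<dots> = ennreal (Gamma a * m s * norm z powr (s - ?d))"
      proof -
        have "norm z * norm z powr (s - 1 - ?d) = norm z powr (s - ?d)"
          using that powr_add[of "norm z" 1 "s - 1 - ?d"] by simp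
        hence "norm z / 2 * (Gamma ((?d - (s - 1)) / 2) / (2 powr (s - 1) * pi powr (?d / 2)) * norm z powr (s - 1 - ?d)) =
          Gamma a * m s * norm z powr (s - ?d)"
          using G by (simp add: m_def rGamma_inverse_Gamma a_def mult_ac)
        thus ?thesis by (subst ennreal_mult' [symmetric]) auto
      qed
      finally show ?thesis .
    qed
    have "ennreal (Gamma a) * ennreal \<bar>\<phi> x\<bar> = ennreal (norm (\<integral>\<tau>. ?wa \<tau> * heat_flux (test_frac_grad s \<phi>) x \<tau> \<partial>lborel))"
      unfolding rep(2) using G by (simp add: abs_mult ennreal_mult)
    also have "\<dots> \<le> (\<integral>\<^sup>+\<tau>. ennreal (norm (?wa \<tau> * heat_flux (test_frac_grad s \<phi>) x \<tau>)) \<partial>lborel)"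
      by (rule integral_norm_bound_ennreal[OF rep(1)])
    also have "\<dots> \<le> (\<integral>\<^sup>+\<tau>. \<integral>\<^sup>+y. ennreal (?wa \<tau>) * ennreal (norm (heat_grad \<tau> (x - y))) * ennreal (norm (test_frac_grad s \<phi> y)) \<partial>lborel \<partial>lborel)"
    proof (rule nn_integral_mono)
      fix \<tau> :: real
      have "ennreal (norm (heat_flux (test_frac_grad s \<phi>) x \<tau>)) \<le> (\<integral>\<^sup>+y. ennreal (norm (heat_grad \<tau> (x - y) \<bullet> test_frac_grad s \<phi> y)) \<partial>lborel)"
        unfolding heat_flux_def
      proof (cases "integrable lborel (\<lambda>y. heat_grad \<tau> (x - y) \<bullet> test_frac_grad s \<phi> y)")
        case True
        thus "ennreal (norm (\<integral>y. heat_grad \<tau> (x - y) \<bullet> test_frac_grad s \<phi> y \<partial>lborel)) \<le>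
          (\<integral>\<^sup>+y. ennreal (norm (heat_grad \<tau> (x - y) \<bullet> test_frac_grad s \<phi> y)) \<partial>lborel)"
          by (rule integral_norm_bound_ennreal)
      qed (simp add: not_integrable_integral_eq)
      also have "\<dots> \<le> (\<integral>\<^sup>+y. ennreal (norm (heat_grad \<tau> (x - y))) * ennreal (norm (test_frac_grad s \<phi> y)) \<partial>lborel)"
        by (intro nn_integral_mono) (auto simp: ennreal_mult' [symmetric] intro!: ennreal_leI Cauchy_Schwarz_ineq2)
      finally have "ennreal (?wa \<tau>) * ennreal (norm (heat_flux (test_frac_grad s \<phi>) x \<tau>)) \<le>
        ennreal (?wa \<tau>) * (\<integral>\<^sup>+y. ennreal (norm (heat_grad \<tau> (x - y))) * ennreal (norm (test_frac_grad s \<phi> y)) \<partial>lborel)"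
        by (intro mult_left_mono) auto
      also have "\<dots> = (\<integral>\<^sup>+y. ennreal (?wa \<tau>) * ennreal (norm (heat_grad \<tau> (x - y))) * ennreal (norm (test_frac_grad s \<phi> y)) \<partial>lborel)"
        by (subst nn_integral_cmult[symmetric]) (auto simp: mult.assoc)
      finally show "ennreal (norm (?wa \<tau> * heat_flux (test_frac_grad s \<phi>) x \<tau>)) \<le>
        (\<integral>\<^sup>+y. ennreal (?wa \<tau>) * ennreal (norm (heat_grad \<tau> (x - y))) * ennreal (norm (test_frac_grad s \<phi> y)) \<partial>lborel)"
        by (simp add: ennreal_mult abs_mult)
    qed
    also have "\<dots> = (\<integral>\<^sup>+y. \<integral>\<^sup>+\<tau>. ennreal (?wa \<tau>) * ennreal (norm (heat_grad \<tau> (x - y))) * ennreal (norm (test_frac_grad s \<phi> y)) \<partial>lborel \<partial>lborel)"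
      by (rule lborel_pair.Fubini') (simp add: case_prod_unfold)
    also have "\<dots> = (\<integral>\<^sup>+y. ennreal (Gamma a * m s) * (ennreal (norm (x - y) powr (s - ?d)) * ennreal (norm (test_frac_grad s \<phi> y))) \<partial>lborel)"
      using AE_lborel_singleton[of x]
    proof (intro nn_integral_cong_AE, eventually_elim)
      fix y assume "y \<noteq> x"
      hence z: "x - y \<noteq> 0" by simp
      have "(\<integral>\<^sup>+\<tau>. ennreal (?wa \<tau>) * ennreal (norm (heat_grad \<tau> (x - y))) * ennreal (norm (test_frac_grad s \<phi> y)) \<partial>lborel) =
        (\<integral>\<^sup>+\<tau>. ennreal (?wa \<tau>) * ennreal (norm (heat_grad \<tau> (x - y))) \<partial>lborel) * ennreal (norm (test_frac_grad s \<phi> y))"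
        by (subst nn_integral_multc) auto
      thus "(\<integral>\<^sup>+\<tau>. ennreal (?wa \<tau>) * ennreal (norm (heat_grad \<tau> (x - y))) * ennreal (norm (test_frac_grad s \<phi> y)) \<partial>lborel) =
        ennreal (Gamma a * m s) * (ennreal (norm (x - y) powr (s - ?d)) * ennreal (norm (test_frac_grad s \<phi> y)))"
        unfolding inner[OF z] using G m0 by (simp add: ennreal_mult mult.assoc)
    qed
    also have "\<dots> = ennreal (Gamma a * m s) * ?I" by (subst nn_integral_cmult) auto
    also have "\<dots> \<le> ennreal (Gamma a * max 1 N) * ?I"
      using N[OF *(1,2)] G by (intro mult_right_mono ennreal_leI mult_left_mono) auto
    also have "\<dots> = ennreal (Gamma a) * (ennreal (max 1 N) * ?I)"
      using G by (subst ennreal_mult) (auto simp: mult.assoc)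
    finally have "ennreal (Gamma a) * ennreal \<bar>\<phi> x\<bar> \<le> ennreal (Gamma a) * (ennreal (max 1 N) * ?I)" .
    thus ?thesis using G by (subst (asm) ennreal_mult_le_mult_iff) auto
  qed
  thus ?thesis by (intro exI[of _ "max 1 N"]) auto
qed

section \<open>Jensen's inequality with a weight\<close>

text \<open>
  The tangent of \<open>y \<mapsto> y\<^sup>p\<close> at \<open>L\<close> lies below the graph.
\<close>
lemma young_tangent:
  fixes y L p :: real
  assumes "1 < p" "0 \<le> y" "0 < L"
  shows "y \<le> L powr (1 - p) / p * y powr p + (1 - 1 / p) * L"
proof -
  define q where "q = p / (p - 1)"
  define E E' where "E = L powr (p - 1)" and "E' = L powr (1 - p)"
  have q: "1 < q" "1 / p + 1 / q = 1" using assms(1) by (simp_all add: q_def less_divide_eq diff_divide_distrib)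
  have EE: "E * E' = 1" using assms(3) by (simp add: E_def E'_def powr_add[symmetric])
  have E': "0 \<le> E'" by (simp add: E'_def)
  have LE: "L powr p = L * E" using assms(3) powr_add[of L 1 "p - 1"] by (simp add: E_def)
  have "y * E \<le> y powr p / p + E powr q / q"
    using assms q by (intro Youngs_inequality) (auto simp: E_def)
  also have "E powr q = L powr p"
    using assms(1) by (simp add: E_def powr_powr q_def)
  also have "L powr p / q = (1 - 1 / p) * (L * E)"
  proof -
    have "1 - 1 / p = 1 / q" using q by simp
    thus ?thesis unfolding LE by simp
  qed
  finally have "(y * E) * E' \<le> (y powr p / p + (1 - 1 / p) * (L * E)) * E'"
    using E' by (rule mult_right_mono)
  also have "\<dots> = E' / p * y powr p + (1 - 1 / p) * L * (E * E')"
  proof -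
    have "(a / p + c * (L * E)) * E' = E' / p * a + c * L * (E * E')" for a c :: real
      by (simp add: distrib_right)
    thus ?thesis .
  qed
  finally show ?thesis using EE by (simp add: mult.assoc E'_def)
qed

text \<open>
  Integrate the tangent inequality at points \<open>l > L\<close> and let them tend to \<open>L\<close>, which may be \<open>0\<close>.
\<close>
lemma weighted_jensen_le:
  fixes k :: "'b \<Rightarrow> ennreal" and f :: "'b \<Rightarrow> real"
  assumes [measurable]: "k \<in> borel_measurable M" "f \<in> borel_measurable M"
    and p: "1 < p" and f: "\<And>y. 0 \<le> f y" and L: "0 \<le> L" and A: "0 \<le> A"
    and mass: "(\<integral>\<^sup>+y. k y \<partial>M) \<le> ennreal A"
    and J: "(\<integral>\<^sup>+y. k y * ennreal (f y powr p) \<partial>M) \<le> ennreal (A * L powr p)"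
  shows "(\<integral>\<^sup>+y. k y * ennreal (f y) \<partial>M) \<le> ennreal (A * L)"
proof -
  have pos: "(\<integral>\<^sup>+y. k y * ennreal (f y) \<partial>M) \<le> ennreal (A * l)" if l: "0 < l" "L \<le> l" for l
  proof -
    have "(\<integral>\<^sup>+y. k y * ennreal (f y) \<partial>M) \<le>
      (\<integral>\<^sup>+y. ennreal (l powr (1 - p) / p) * (k y * ennreal (f y powr p)) + ennreal ((1 - 1 / p) * l) * k y \<partial>M)"
    proof (rule nn_integral_mono)
      fix y
      have "ennreal (f y) \<le> ennreal (l powr (1 - p) / p) * ennreal (f y powr p) + ennreal ((1 - 1 / p) * l)"
        using young_tangent[OF p f l(1), of y] p l
        by (simp add: ennreal_mult' [symmetric] ennreal_plus [symmetric] ennreal_leI del: ennreal_plus)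
      hence "k y * ennreal (f y) \<le> k y * (ennreal (l powr (1 - p) / p) * ennreal (f y powr p) + ennreal ((1 - 1 / p) * l))"
        by (rule mult_left_mono) simp
      thus "k y * ennreal (f y) \<le> ennreal (l powr (1 - p) / p) * (k y * ennreal (f y powr p)) + ennreal ((1 - 1 / p) * l) * k y"
        by (simp add: distrib_left mult_ac)
    qed
    also have "\<dots> = ennreal (l powr (1 - p) / p) * (\<integral>\<^sup>+y. k y * ennreal (f y powr p) \<partial>M) + ennreal ((1 - 1 / p) * l) * (\<integral>\<^sup>+y. k y \<partial>M)"
      by (simp add: nn_integral_add nn_integral_cmult)
    also have "\<dots> \<le> ennreal (l powr (1 - p) / p) * ennreal (A * l powr p) + ennreal ((1 - 1 / p) * l) * ennreal A"
    proof (intro add_mono mult_left_mono mass)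
      have "A * L powr p \<le> A * l powr p" using A L l p by (intro mult_left_mono powr_mono2) auto
      thus "(\<integral>\<^sup>+y. k y * ennreal (f y powr p) \<partial>M) \<le> ennreal (A * l powr p)"
        using J by (meson ennreal_leI order_trans)
    qed auto
    also have "\<dots> = ennreal (l powr (1 - p) / p * (A * l powr p) + (1 - 1 / p) * l * A)"
      using p l A by (simp add: ennreal_mult' [symmetric] ennreal_plus [symmetric] del: ennreal_plus)
    also have "l powr (1 - p) / p * (A * l powr p) + (1 - 1 / p) * l * A = A * l"
    proof -
      have "l powr (1 - p) * l powr p = l" using l by (simp add: powr_add[symmetric])
      hence "l powr (1 - p) / p * (A * l powr p) = A * l / p" by (simp add: mult_ac)
      thus ?thesis by (simp add: algebra_simps)
    qed
    finally show ?thesis .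
  qed
  show ?thesis
  proof (rule ennreal_le_epsilon)
    fix e :: real assume e: "0 < e"
    have "(\<integral>\<^sup>+y. k y * ennreal (f y) \<partial>M) \<le> ennreal (A * (L + e / (A + 1)))"
      using e A L by (intro pos) (auto intro!: add_nonneg_pos divide_pos_pos)
    also have "A * (L + e / (A + 1)) \<le> A * L + e" using e A by (simp add: field_simps)
    hence "ennreal (A * (L + e / (A + 1))) \<le> ennreal (A * L) + ennreal e"
      using e A L by (simp add: ennreal_plus [symmetric] ennreal_leI del: ennreal_plus)
    finally show "(\<integral>\<^sup>+y. k y * ennreal (f y) \<partial>M) \<le> ennreal (A * L) + ennreal e" .
  qed
qed

lemma weighted_jensen_powr:
  fixes k :: "'b \<Rightarrow> ennreal" and f :: "'b \<Rightarrow> real" and n :: real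
  assumes [measurable]: "k \<in> borel_measurable M" "f \<in> borel_measurable M"
    and p: "1 < p" and f: "\<And>y. 0 \<le> f y" and A: "0 < A"
    and mass: "(\<integral>\<^sup>+y. k y \<partial>M) \<le> ennreal A"
    and n: "0 \<le> n" "ennreal n \<le> (\<integral>\<^sup>+y. k y * ennreal (f y) \<partial>M)"
  shows "ennreal (n powr p) \<le> ennreal (A powr (p - 1)) * (\<integral>\<^sup>+y. k y * ennreal (f y powr p) \<partial>M)"
proof -
  define J where "J = (\<integral>\<^sup>+y. k y * ennreal (f y powr p) \<partial>M)"
  show ?thesis
  proof (cases J)
    case top
    have "0 < A powr (p - 1)" using A by simp
    hence "ennreal (A powr (p - 1)) * J = top" using top by (simp add: ennreal_mult_top)
    thus ?thesis unfolding J_def by simp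
  next
    case (real j)
    define L where "L = (j / A) powr (1 / p)"
    have L: "0 \<le> L" by (simp add: L_def)
    have Lp: "L powr p = j / A" using real A p by (simp add: L_def powr_powr)
    have "ennreal n \<le> (\<integral>\<^sup>+y. k y * ennreal (f y) \<partial>M)" by (rule n(2))
    also have "\<dots> \<le> ennreal (A * L)"
    proof (rule weighted_jensen_le[OF assms(1,2) p f L _ mass])
      show "(\<integral>\<^sup>+y. k y * ennreal (f y powr p) \<partial>M) \<le> ennreal (A * L powr p)"
        using A real by (simp add: Lp J_def)
    qed (use A in simp)
    finally have "n \<le> A * L" using A L by (subst (asm) ennreal_le_iff) auto
    hence "n powr p \<le> (A * L) powr p" using n p by (intro powr_mono2) auto
    also have "\<dots> = A powr p * (j / A)" using A L by (simp add: powr_mult Lp)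
    also have "\<dots> = A powr (p - 1) * j" using A by (simp add: powr_diff)
    finally have "ennreal (n powr p) \<le> ennreal (A powr (p - 1) * j)" by (rule ennreal_leI)
    also have "\<dots> = ennreal (A powr (p - 1)) * J" using real by (simp add: ennreal_mult)
    finally show ?thesis unfolding J_def .
  qed
qed

section \<open>The Poincare inequality\<close>

lemma ennreal_norm_powr_far:
  fixes x y :: "'a::euclidean_space"
  assumes "norm x \<le> r" "2 * r \<le> norm y" "0 < r" "0 \<le> a" "a \<le> real DIM('a)"
  shows "norm (x - y) powr (a - real DIM('a)) \<le> 2 powr real DIM('a) * norm y powr (a - real DIM('a))"
proof -
  have y: "0 < norm y" using assms by linarith
  have "norm y / 2 \<le> norm (x - y)" using norm_triangle_ineq2[of y x] assms by (simp add: norm_minus_commute)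
  hence "norm (x - y) powr (a - real DIM('a)) \<le> (norm y / 2) powr (a - real DIM('a))"
    using assms y by (intro powr_mono2') auto
  also have "\<dots> = 2 powr (real DIM('a) - a) * norm y powr (a - real DIM('a))"
    using y powr_minus_divide[of 2 "real DIM('a) - a"] by (simp add: powr_divide)
  also have "\<dots> \<le> 2 powr real DIM('a) * norm y powr (a - real DIM('a))"
    using assms by (intro mult_right_mono powr_mono) auto
  finally show ?thesis .
qed

lemma Cc_infinity_integrable:
  assumes "\<phi> \<in> Cc_infinity \<Omega>"
  shows "integrable lborel (\<phi> :: 'a::euclidean_space \<Rightarrow> real)"
proof -
  obtain R where "\<phi> \<in> Cc_infinity (ball 0 R)" using Cc_infinity_obtain_radius[OF assms] by metis
  hence "C0_ball R \<phi>" using Cc_infinity_C1_ball[of \<phi> "ball 0 R" R] by (simp add: C1_ball_def)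
  thus ?thesis using convolution_integrable[OF locally_integrable_const[of 1]] by force
qed

lemma emeasure_cball_eq:
  "0 \<le> r \<Longrightarrow> emeasure lborel (cball (0::'a::euclidean_space) r) = ennreal (unit_ball_vol (real DIM('a)) * r ^ DIM('a))"
  by (rule emeasure_cball)

lemma indicator_cball_measurable [measurable]:
  "indicator (cball (a::'a::euclidean_space) r) \<in> borel_measurable (borel :: 'a measure)"
  by (intro borel_measurable_indicator) auto

text \<open>
  Integrate the representation of \<open>\<phi>\<close> over the ball that contains its support.  The part of \<open>D\<^sup>s\<phi>\<close> far
  away is itself controlled by \<open>\<parallel>\<phi>\<parallel>\<^sub>1\<close>, with a factor that is at most \<open>1/2\<close> beyond a radius \<open>M\<close> that
  does not depend on \<open>s\<close>; so it can be absorbed.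
\<close>
lemma poincare_L1:
  fixes R :: real
  assumes R: "0 < R"
  shows "\<exists>C>0. \<exists>M>0. \<forall>s (\<phi> :: 'a::euclidean_space \<Rightarrow> real). 0 < s \<and> s \<le> 1 \<and> \<phi> \<in> Cc_infinity (ball 0 R) \<longrightarrow>
    ennreal (\<integral>y. \<bar>\<phi> y\<bar> \<partial>lborel) \<le> ennreal (C / s) * (\<integral>\<^sup>+y. indicator (cball 0 M) y * ennreal (norm (test_frac_grad s \<phi> y)) \<partial>lborel)"
proof -
  let ?d = "real DIM('a)"
  have d1: "1 \<le> ?d" using DIM_positive[where 'a='a] by linarith
  obtain B where B: "0 < B" "\<forall>s R (\<phi> :: 'a \<Rightarrow> real) x. 0 < s \<and> s \<le> 1 \<and> 0 < R \<and> \<phi> \<in> Cc_infinity (ball 0 R) \<and> 2 * R \<le> norm x \<longrightarrow>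
      norm (test_frac_grad s \<phi> x) \<le> B * (\<integral>y. \<bar>\<phi> y\<bar> \<partial>lborel) * norm x powr (- ?d - s)"
    using test_frac_grad_decay[where 'a='a] by (elim exE conjE)
  obtain N where N: "0 < N" "\<forall>s (\<phi> :: 'a \<Rightarrow> real) x. 0 < s \<and> s \<le> 1 \<and> \<phi> \<in> Cc_infinity UNIV \<longrightarrow>
      ennreal \<bar>\<phi> x\<bar> \<le> ennreal N * (\<integral>\<^sup>+y. ennreal (norm (x - y) powr (s - ?d)) * ennreal (norm (test_frac_grad s \<phi> y)) \<partial>lborel)"
    using abs_test_function_le[where 'a='a] by (elim exE conjE)
  define \<omega> where "\<omega> = unit_ball_vol ?d"
  have \<omega>: "0 < \<omega>" by (simp add: \<omega>_def)
  define V where "V = \<omega> * R ^ DIM('a)"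
  have V: "0 < V" using R \<omega> by (simp add: V_def)
  define T where "T = N * (2 powr ?d * V * B * \<omega>)"
  have T: "0 < T" using N B V \<omega> by (simp add: T_def)
  \<comment> \<open>\<open>T / M\<close> bounds the factor in front of \<open>\<parallel>\<phi>\<parallel>\<^sub>1\<close>, since the tail of \<open>|y|\<^bsup>-2d\<^esup>\<close> outside the ball of radius \<open>M \<ge> 1\<close> is at most \<open>\<omega> / M\<close>.\<close>
  define M where "M = max (2 * R) (max 1 (2 * T))"
  have M: "2 * R \<le> M" "1 \<le> M" "2 * T \<le> M" "0 < M" by (auto simp: M_def)
  define K1 where "K1 = ?d * \<omega> * (R + M)"
  have K1: "0 < K1" using d1 \<omega> R M by (auto simp: K1_def intro!: mult_pos_pos)
  have "ennreal (\<integral>y. \<bar>\<phi> y\<bar> \<partial>lborel) \<le> ennreal ((2 * N * K1) / s) * (\<integral>\<^sup>+y. indicator (cball 0 M) y * ennreal (norm (test_frac_grad s \<phi> y)) \<partial>lborel)"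
    if *: "0 < s" "s \<le> 1" "\<phi> \<in> Cc_infinity (ball 0 R)" for s and \<phi> :: "'a \<Rightarrow> real"
  proof -
    let ?F = "\<lambda>y. norm (test_frac_grad s \<phi> y)"
    have [measurable]: "test_frac_grad s \<phi> \<in> borel_measurable borel"
      by (rule test_frac_grad_measurable[OF *(3,1,2)])
    define I where "I = (\<integral>y. \<bar>\<phi> y\<bar> \<partial>lborel)"
    have I: "0 \<le> I" unfolding I_def by (intro integral_nonneg_AE) auto
    have [measurable]: "\<phi> \<in> borel_measurable borel" using Cc_infinity_integrable[OF *(3)] by auto
    have zero: "\<phi> x = 0" if "x \<notin> cball 0 R" for x
      using that Cc_infinity_C1_ball[OF *(3) order_refl] by (auto simp: C1_ball_def C0_ball_def)
    let ?W = "\<lambda>y. (\<integral>\<^sup>+x. indicator (cball 0 R) x * ennreal (norm (x - y) powr (s - ?d)) \<partial>lborel)"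
    let ?X = "\<integral>\<^sup>+y. indicator (cball 0 M) y * ennreal (?F y) \<partial>lborel"
    have sd: "s \<le> ?d" using * d1 by linarith
    have near: "?W y \<le> ennreal (K1 / s)" if "norm y \<le> M" for y :: 'a
    proof -
      have "?W y \<le> (\<integral>\<^sup>+x. ennreal (norm (x - y) powr (s - ?d)) * indicator {..R + M} (norm (x - y)) \<partial>lborel)"
      proof (rule nn_integral_mono)
        fix x :: 'a
        show "indicator (cball 0 R) x * ennreal (norm (x - y) powr (s - ?d)) \<le> ennreal (norm (x - y) powr (s - ?d)) * indicator {..R + M} (norm (x - y))"
          using that norm_triangle_ineq4[of x y] by (cases "norm x \<le> R") auto
      qed
      also have "\<dots> = (\<integral>\<^sup>+z. ennreal (norm z powr (s - ?d)) * indicator {..R + M} (norm z) \<partial>(lborel :: 'a measure))"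
        by (rule nn_integral_lborel_shift[where f="\<lambda>z. ennreal (norm z powr (s - ?d)) * indicator {..R + M} (norm z)"]) measurable
      also have "\<dots> = ennreal (?d * \<omega> * (R + M) powr s / s)"
        unfolding \<omega>_def using * R M by (intro nn_integral_norm_powr_ball) auto
      also have "\<dots> \<le> ennreal (K1 / s)"
      proof (intro ennreal_leI divide_right_mono)
        have "(R + M) powr s \<le> (R + M) powr 1" using * R M by (intro powr_mono) auto
        thus "?d * \<omega> * (R + M) powr s \<le> K1" unfolding K1_def using \<omega> R M by (intro mult_left_mono) auto
      qed (use * in auto)
      finally show ?thesis .
    qed
    have far: "?W y * ennreal (?F y) \<le> ennreal (2 powr ?d * V * B * I) * ennreal (norm y powr (- ?d - ?d))" if "M \<le> norm y" for y :: 'a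
    proof -
      have y: "2 * R \<le> norm y" "0 < norm y" using that M by linarith+
      have "?W y \<le> (\<integral>\<^sup>+x. ennreal (2 powr ?d * norm y powr (s - ?d)) * indicator (cball (0::'a) R) x \<partial>lborel)"
      proof (rule nn_integral_mono)
        fix x :: 'a
        show "indicator (cball 0 R) x * ennreal (norm (x - y) powr (s - ?d)) \<le> ennreal (2 powr ?d * norm y powr (s - ?d)) * indicator (cball 0 R) x"
          using sd * R y by (cases "norm x \<le> R") (auto intro!: ennreal_leI ennreal_norm_powr_far[of x R y])
      qed
      also have "\<dots> = ennreal (2 powr ?d * norm y powr (s - ?d)) * ennreal V"
        using R by (subst nn_integral_cmult_indicator) (auto simp: emeasure_cball_eq V_def \<omega>_def)
      also have "\<dots> = ennreal (2 powr ?d * V * norm y powr (s - ?d))"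
        using V by (subst ennreal_mult[symmetric]) (auto simp: mult_ac)
      finally have "?W y * ennreal (?F y) \<le> ennreal (2 powr ?d * V * norm y powr (s - ?d)) * ennreal (B * I * norm y powr (- ?d - s))"
        using B(2)[rule_format, of s R \<phi> y] * R y by (intro mult_mono ennreal_leI) (auto simp: I_def)
      also have "\<dots> = ennreal (2 powr ?d * V * B * I * (norm y powr (s - ?d) * norm y powr (- ?d - s)))"
        using V by (subst ennreal_mult' [symmetric]) (auto simp: mult_ac)
      also have "norm y powr (s - ?d) * norm y powr (- ?d - s) = norm y powr (- ?d - ?d)"
        by (simp add: powr_add[symmetric])
      finally show ?thesis using V B I by (simp add: ennreal_mult' [symmetric])
    qed
    have tail: "(\<integral>\<^sup>+y. ennreal (norm y powr (- ?d - ?d)) * indicator {M..} (norm y) \<partial>(lborel :: 'a measure)) \<le> ennreal (\<omega> / M)"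
    proof -
      have "M powr (- ?d) \<le> M powr (- 1)" using M d1 by (intro powr_mono) auto
      hence "\<omega> * M powr (- ?d) \<le> \<omega> / M" using M \<omega> by (simp add: powr_minus_divide mult_left_mono divide_inverse)
      thus ?thesis using M d1
        by (subst nn_integral_norm_powr_outside_ball) (auto simp: \<omega>_def ennreal_leI)
    qed
    have "ennreal I = (\<integral>\<^sup>+x. ennreal \<bar>\<phi> x\<bar> \<partial>lborel)"
      unfolding I_def using Cc_infinity_integrable[OF *(3)] by (subst nn_integral_eq_integral) auto
    also have "\<dots> \<le> (\<integral>\<^sup>+x. \<integral>\<^sup>+y. ennreal N * (indicator (cball 0 R) x * ennreal (norm (x - y) powr (s - ?d)) * ennreal (?F y)) \<partial>lborel \<partial>lborel)"
    proof (rule nn_integral_mono)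
      fix x :: 'a
      have N': "ennreal \<bar>\<phi> x\<bar> \<le> ennreal N * (\<integral>\<^sup>+y. ennreal (norm (x - y) powr (s - ?d)) * ennreal (?F y) \<partial>lborel)"
        using N(2)[rule_format, of s \<phi> x] * Cc_infinity_mono[OF *(3), of UNIV] by auto
      show "ennreal \<bar>\<phi> x\<bar> \<le> (\<integral>\<^sup>+y. ennreal N * (indicator (cball 0 R) x * ennreal (norm (x - y) powr (s - ?d)) * ennreal (?F y)) \<partial>lborel)"
      proof (cases "x \<in> cball 0 R")
        case True
        thus ?thesis using N' by (simp add: nn_integral_cmult)
      qed (use zero in auto)
    qed
    also have "\<dots> = (\<integral>\<^sup>+y. \<integral>\<^sup>+x. ennreal N * (indicator (cball 0 R) x * ennreal (norm (x - y) powr (s - ?d)) * ennreal (?F y)) \<partial>lborel \<partial>lborel)"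
      by (rule lborel_pair.Fubini') (simp add: case_prod_unfold)
    also have "\<dots> = (\<integral>\<^sup>+y. ennreal N * (?W y * ennreal (?F y)) \<partial>lborel)"
      by (intro nn_integral_cong) (simp add: nn_integral_cmult nn_integral_multc)
    also have "\<dots> \<le> (\<integral>\<^sup>+y. ennreal N * (ennreal (K1 / s) * (indicator (cball 0 M) y * ennreal (?F y))) +
        ennreal N * (ennreal (2 powr ?d * V * B * I) * (ennreal (norm y powr (- ?d - ?d)) * indicator {M..} (norm y))) \<partial>lborel)"
    proof (rule nn_integral_mono)
      fix y :: 'a
      show "ennreal N * (?W y * ennreal (?F y)) \<le> ennreal N * (ennreal (K1 / s) * (indicator (cball 0 M) y * ennreal (?F y))) +
        ennreal N * (ennreal (2 powr ?d * V * B * I) * (ennreal (norm y powr (- ?d - ?d)) * indicator {M..} (norm y)))"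
      proof (cases "norm y \<le> M")
        case True
        have "ennreal N * (?W y * ennreal (?F y)) \<le> ennreal N * (ennreal (K1 / s) * ennreal (?F y))"
          using near[OF True] by (intro mult_left_mono mult_right_mono) auto
        thus ?thesis using True by (simp add: add_increasing2)
      next
        case False
        have "ennreal N * (?W y * ennreal (?F y)) \<le> ennreal N * (ennreal (2 powr ?d * V * B * I) * ennreal (norm y powr (- ?d - ?d)))"
          using far[of y] False by (intro mult_left_mono) auto
        thus ?thesis using False by simp
      qed
    qed
    also have "\<dots> = ennreal N * (ennreal (K1 / s) * ?X) +
        ennreal N * (ennreal (2 powr ?d * V * B * I) * (\<integral>\<^sup>+y. ennreal (norm y powr (- ?d - ?d)) * indicator {M..} (norm y) \<partial>(lborel :: 'a measure)))"
      by (subst nn_integral_add) (simp_all add: nn_integral_cmult)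
    also have "\<dots> \<le> ennreal N * (ennreal (K1 / s) * ?X) + ennreal N * (ennreal (2 powr ?d * V * B * I) * ennreal (\<omega> / M))"
      using tail by (intro add_left_mono mult_left_mono) auto
    also have "ennreal N * (ennreal (2 powr ?d * V * B * I) * ennreal (\<omega> / M)) = ennreal (T / M * I)"
      using N B V I \<omega> M by (simp add: ennreal_mult' [symmetric] T_def mult_ac)
    also have "\<dots> \<le> ennreal (I / 2)"
    proof (rule ennreal_leI)
      have "T / M \<le> 1 / 2" using M by (simp add: field_simps)
      thus "T / M * I \<le> I / 2" using mult_right_mono[OF _ I, of "T / M" "1 / 2"] by simp
    qed
    finally have ineq: "ennreal I \<le> ennreal N * (ennreal (K1 / s) * ?X) + ennreal (I / 2)"
      by (simp add: add_left_mono)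
    show ?thesis
    proof (cases "?X = \<infinity>")
      case True
      thus ?thesis using N K1 * by (simp add: ennreal_mult_top)
    next
      case False
      then obtain X where X: "0 \<le> X" "?X = ennreal X" by (cases ?X) auto
      have "ennreal I \<le> ennreal (N * (K1 / s * X) + I / 2)"
        using ineq X N K1 * I by (simp add: ennreal_mult' [symmetric] ennreal_plus [symmetric] del: ennreal_plus)
      hence "I \<le> N * (K1 / s * X) + I / 2" using X N K1 * I by (subst (asm) ennreal_le_iff) auto
      hence "I \<le> 2 * N * K1 / s * X" by simp
      thus ?thesis unfolding X using X N K1 * by (simp add: ennreal_mult' [symmetric] ennreal_leI I_def)
    qed
  qed
  moreover have "0 < 2 * N * K1" using N K1 by simp
  ultimately show ?thesis using M(4) by blast
qed

section \<open>Comparison of fractional gradients of different orders\<close>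

text \<open>
  The factor \<open>a\<close> comes from the pole of \<open>\<Gamma>(a / 2)\<close> at \<open>a = 0\<close>.  The factor \<open>1 / (1 - a)\<close> comes from
  \<open>\<Gamma>((d - a) / 2)\<close>, which for \<open>d = 1\<close> has a pole at \<open>a = 1\<close>.
\<close>
lemma riesz_const_le:
  assumes "1 \<le> d"
  shows "\<exists>\<kappa>>0. \<forall>a. 0 < a \<and> a < 1 \<longrightarrow> riesz_const d a \<le> \<kappa> * a / (1 - a)"
proof -
  define m where "m = (\<lambda>a. Gamma ((real d - a) / 2 + 1) * rGamma (1 + a / 2) / (2 powr a * pi powr (real d / 2)))"
  have d: "1 \<le> real d" using assms by simp
  have "continuous_on {0..1} m"
    unfolding m_def
  proof (intro continuous_intros)
    show "continuous_on {0..1} (\<lambda>a. Gamma ((real d - a) / 2 + 1))"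
    proof (rule continuous_on_compose2[OF continuous_on_Gamma])
      show "{0<..} \<inter> \<int>\<^sub>\<le>\<^sub>0 = ({} :: real set)" by (auto dest!: nonpos_Ints_nonpos)
      have "0 < (real d - a) / 2 + 1" if "a \<le> 1" for a using that d by (simp add: field_simps)
      thus "(\<lambda>a. (real d - a) / 2 + 1) ` {0..1} \<subseteq> {0<..}" by auto
    qed (auto intro!: continuous_intros)
    show "continuous_on {0..1} (\<lambda>a::real. rGamma (1 + a / 2))"
      by (intro continuous_on_compose2[OF continuous_on_rGamma] continuous_intros) auto
  qed auto
  hence "bounded (m ` {0..1})" by (intro compact_imp_bounded compact_continuous_image) auto
  then obtain N where N: "\<forall>y\<in>m ` {0..1}. norm y \<le> N" unfolding bounded_iff by blast
  have "riesz_const d a \<le> max 1 N * a / (1 - a)" if a: "0 < a" "a < 1" for a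
  proof -
    have ad: "a < real d" using a d by linarith
    have "Gamma ((real d - a) / 2 + 1) = (real d - a) / 2 * Gamma ((real d - a) / 2)"
      using ad by (intro Gamma_plus1) (auto dest!: nonpos_Ints_nonpos)
    hence g1: "Gamma ((real d - a) / 2) = 2 / (real d - a) * Gamma ((real d - a) / 2 + 1)" using ad by (simp add: nonzero_eq_divide_eq mult.commute)
    have "Gamma (a / 2 + 1) = a / 2 * Gamma (a / 2)"
      using a by (intro Gamma_plus1) (auto dest!: nonpos_Ints_nonpos)
    hence g2: "Gamma (a / 2) = 2 / a * Gamma (1 + a / 2)" using a by (simp add: add.commute nonzero_eq_divide_eq mult.commute)
    have G: "0 < Gamma (1 + a / 2)" using a by (intro Gamma_real_pos) auto
    have G': "0 < Gamma ((real d - a) / 2 + 1)" using ad by (intro Gamma_real_pos add_pos_pos divide_pos_pos) auto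
    have eq: "riesz_const d a = m a * a / (real d - a)"
    proof -
      have "(2 / u * X) / (c * q * (2 / a * W)) = X * (1 / W) / (c * q) * a / u" if "0 < u" "0 < W" "0 < c" "0 < q" for u X W c q :: real
        using that a by (simp add: field_simps)
      from this[of "real d - a" "Gamma (1 + a / 2)" "2 powr a" "pi powr (real d / 2)" "Gamma ((real d - a) / 2 + 1)"]
      show ?thesis using ad G unfolding riesz_const_altdef[OF a(1) ad] g1 g2 m_def rGamma_inverse_Gamma by (simp add: inverse_eq_divide)
    qed
    have m0: "0 \<le> m a" unfolding m_def using G G' by (simp add: rGamma_inverse_Gamma)
    have "norm (m a) \<le> N" using N a by auto
    hence "m a \<le> max 1 N" by simp
    thus ?thesis unfolding eq using a d m0 by (intro frac_le mult_right_mono) auto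
  qed
  thus ?thesis by (intro exI[of _ "max 1 N"]) auto
qed

lemma powr_add_le:
  fixes a b p :: real
  assumes "0 \<le> a" "0 \<le> b" "0 \<le> p"
  shows "(a + b) powr p \<le> 2 powr p * (a powr p + b powr p)"
proof -
  have "(a + b) powr p \<le> (2 * max a b) powr p" using assms by (intro powr_mono2) auto
  also have "\<dots> = 2 powr p * max a b powr p" using assms by (simp add: powr_mult)
  also have "\<dots> \<le> 2 powr p * (a powr p + b powr p)" by (intro mult_left_mono) (auto simp: max_def)
  finally show ?thesis .
qed

text \<open>
  Near the support, \<open>D\<^sup>t\<phi>\<close> is the convolution of \<open>D\<^sup>s\<phi>\<close> with a Riesz kernel of order \<open>a = s - t\<close>, whose
  mass on bounded sets is at most a constant times \<open>1 / (1 - a) \<le> 1 / t\<close>.  The remaining parts only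
  see \<open>D\<^sup>s\<phi>\<close> or \<open>\<phi>\<close> from afar; there the decay estimate and \<open>\<parallel>\<phi>\<parallel>\<^sub>1 \<le> C / s \<parallel>D\<^sup>s\<phi>\<parallel>\<close> suffice, because the
  factor \<open>a\<close> in the Riesz constant compensates \<open>1 / s\<close>.
\<close>
lemma test_frac_grad_comparison:
  fixes R p :: real
  assumes R: "0 < R" and p: "1 < p"
  shows "\<exists>C>0. \<forall>s t (\<phi> :: 'a::euclidean_space \<Rightarrow> real) Y. 0 < t \<and> t < s \<and> s \<le> 1 \<and> \<phi> \<in> Cc_infinity (ball 0 R) \<and> 0 \<le> Y \<and>
      (\<integral>\<^sup>+x. ennreal (norm (test_frac_grad s \<phi> x) powr p) \<partial>lborel) \<le> ennreal (Y powr p) \<longrightarrow>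
    (\<integral>\<^sup>+x. ennreal (norm (test_frac_grad t \<phi> x) powr p) \<partial>lborel) \<le> ennreal ((C / t * Y) powr p)"
proof -
  let ?d = "real DIM('a)"
  have d1: "1 \<le> ?d" using DIM_positive[where 'a='a] by linarith
  obtain B where B: "0 < B" "\<forall>s R (\<phi> :: 'a \<Rightarrow> real) x. 0 < s \<and> s \<le> 1 \<and> 0 < R \<and> \<phi> \<in> Cc_infinity (ball 0 R) \<and> 2 * R \<le> norm x \<longrightarrow>
      norm (test_frac_grad s \<phi> x) \<le> B * (\<integral>y. \<bar>\<phi> y\<bar> \<partial>lborel) * norm x powr (- ?d - s)"
    using test_frac_grad_decay[where 'a='a] by (elim exE conjE)
  obtain C0 M where C0: "0 < C0" and M: "0 < M" and poincare: "\<forall>s (\<phi> :: 'a \<Rightarrow> real). 0 < s \<and> s \<le> 1 \<and> \<phi> \<in> Cc_infinity (ball 0 R) \<longrightarrow>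
      ennreal (\<integral>y. \<bar>\<phi> y\<bar> \<partial>lborel) \<le> ennreal (C0 / s) * (\<integral>\<^sup>+y. indicator (cball 0 M) y * ennreal (norm (test_frac_grad s \<phi> y)) \<partial>lborel)"
    using poincare_L1[OF R, where 'a='a] by (elim exE conjE)
  obtain \<kappa> where \<kappa>: "0 < \<kappa>" "\<forall>a. 0 < a \<and> a < 1 \<longrightarrow> riesz_const DIM('a) a \<le> \<kappa> * a / (1 - a)"
    using riesz_const_le[of "DIM('a)"] DIM_positive[where 'a='a] by (auto simp: Suc_le_eq)
  define \<omega> where "\<omega> = unit_ball_vol ?d"
  have \<omega>: "0 < \<omega>" by (simp add: \<omega>_def)
  define L where "L = max 1 (2 * R)"
  have L: "1 \<le> L" "2 * R \<le> L" "0 < L" by (auto simp: L_def)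
  define v where "v = \<omega> * M ^ DIM('a)"
  have v: "0 < v" using \<omega> M by (simp add: v_def)
  define vL where "vL = \<omega> * L ^ DIM('a)"
  have vL: "0 < vL" using \<omega> L by (simp add: vL_def)
  define K1 where "K1 = C0 * (v * (1 / v) powr (1 / p))"
  have K1: "0 < K1" using C0 v by (simp add: K1_def)
  define K2 where "K2 = \<kappa> * (?d * \<omega> * (3 * L))"
  have K2: "0 < K2" using \<kappa> d1 \<omega> L by (auto simp: K2_def intro!: mult_pos_pos)
  define K3 where "K3 = \<kappa> * 2 powr ?d * B * K1 * \<omega>"
  have K3: "0 < K3" using \<kappa> B K1 \<omega> by (simp add: K3_def)
  define e where "e = ?d * (p - 1)"
  have e: "0 < e" using p d1 by (simp add: e_def)
  \<comment> \<open>The three terms stem from the near part, the far part on the ball, and the outside of the ball.\<close>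
  define K4 where "K4 = 2 powr p * (K2 powr p + vL * K3 powr p) + (B * K1) powr p * (?d * \<omega> / e)"
  have K4: "0 < K4"
  proof -
    have "0 < 2 powr p * (K2 powr p + vL * K3 powr p)" using K2 K3 vL by (auto intro!: mult_pos_pos add_pos_pos)
    moreover have "0 \<le> (B * K1) powr p * (?d * \<omega> / e)" using \<omega> e by simp
    ultimately show ?thesis unfolding K4_def by linarith
  qed
  have "(\<integral>\<^sup>+x. ennreal (norm (test_frac_grad t \<phi> x) powr p) \<partial>lborel) \<le> ennreal ((K4 powr (1 / p) / t * Y) powr p)"
    if *: "0 < t" "t < s" "s \<le> 1" "\<phi> \<in> Cc_infinity (ball 0 R)" "0 \<le> Y"
      "(\<integral>\<^sup>+x. ennreal (norm (test_frac_grad s \<phi> x) powr p) \<partial>lborel) \<le> ennreal (Y powr p)"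
    for s t Y and \<phi> :: "'a \<Rightarrow> real"
  proof -
    define a where "a = s - t"
    have a: "0 < a" "a < 1" "a < ?d" "a \<le> s" using * d1 unfolding a_def by linarith+
    have s: "0 < s" "s \<le> 1" and t: "0 < t" "t \<le> 1" using * by auto
    let ?F = "\<lambda>y. norm (test_frac_grad s \<phi> y)"
    let ?G = "\<lambda>y. norm (test_frac_grad t \<phi> y)"
    have [measurable]: "test_frac_grad s \<phi> \<in> borel_measurable borel" "test_frac_grad t \<phi> \<in> borel_measurable borel"
      using test_frac_grad_measurable[OF *(4)] s t by auto
    define c where "c = riesz_const DIM('a) a"
    have c0: "0 < c" using a by (auto simp: c_def intro: riesz_const_pos)
    have c_le: "c \<le> \<kappa> * a / t"
    proof -
      have "c \<le> \<kappa> * a / (1 - a)" using \<kappa> a by (auto simp: c_def)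
      also have "\<dots> \<le> \<kappa> * a / t" using \<kappa> a * by (intro divide_left_mono) (auto simp: a_def)
      finally show ?thesis .
    qed
    define I where "I = (\<integral>y. \<bar>\<phi> y\<bar> \<partial>lborel)"
    have I0: "0 \<le> I" unfolding I_def by (intro integral_nonneg_AE) auto
    have I: "I \<le> K1 / s * Y"
    proof -
      have "(\<integral>\<^sup>+y. indicator (cball 0 M) y * ennreal (?F y) \<partial>lborel) \<le> ennreal (v * (Y * (1 / v) powr (1 / p)))"
      proof (rule weighted_jensen_le[OF _ _ p])
        show "(\<integral>\<^sup>+y. indicator (cball (0::'a) M) y \<partial>lborel) \<le> ennreal v"
          using M by (simp add: emeasure_cball_eq v_def \<omega>_def)
        have "v * (Y * (1 / v) powr (1 / p)) powr p = Y powr p"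
          using v p * by (simp add: powr_mult powr_powr)
        moreover have "(\<integral>\<^sup>+y. indicator (cball 0 M) y * ennreal (?F y powr p) \<partial>lborel) \<le> (\<integral>\<^sup>+y. ennreal (?F y powr p) \<partial>lborel)"
          by (intro nn_integral_mono) (auto simp: indicator_def)
        ultimately show "(\<integral>\<^sup>+y. indicator (cball 0 M) y * ennreal (?F y powr p) \<partial>lborel) \<le> ennreal (v * (Y * (1 / v) powr (1 / p)) powr p)"
          using *(6) by (simp only:)
      qed (use v * in auto)
      hence "ennreal I \<le> ennreal (C0 / s) * ennreal (v * (Y * (1 / v) powr (1 / p)))"
        using poincare[rule_format, of s \<phi>] s * unfolding I_def by (meson mult_left_mono order_trans zero_le)
      also have "\<dots> = ennreal (K1 / s * Y)"
        using C0 s v * by (subst ennreal_mult' [symmetric]) (auto simp: K1_def mult_ac)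
      finally show ?thesis using K1 s * by (subst (asm) ennreal_le_iff) auto
    qed
    have I': "I \<le> K1 / t * Y"
    proof -
      have "K1 / s * Y \<le> K1 / t * Y" using K1 * by (intro mult_right_mono divide_left_mono) auto
      thus ?thesis using I by linarith
    qed
    have cI: "c * I \<le> \<kappa> * K1 / t * Y"
    proof -
      have "c * I \<le> (\<kappa> * a / t) * (K1 / s * Y)" using c_le I c0 I0 \<kappa> a t by (intro mult_mono) auto
      also have "\<dots> = (\<kappa> * K1 / t * Y) * (a / s)" by simp
      also have "\<dots> \<le> (\<kappa> * K1 / t * Y) * 1" using a s t K1 \<kappa> * by (intro mult_left_mono) auto
      finally show ?thesis by simp
    qed
    \<comment> \<open>The far part of the convolution is bounded by a constant on the ball of radius \<open>L\<close>.\<close>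
    define far where "far = K3 / t * Y"
    have far0: "0 \<le> far" using K3 * by (simp add: far_def)
    let ?k = "\<lambda>x y. indicator {..3 * L} (norm (x - y)) * ennreal (c * norm (x - y) powr (a - ?d)) :: ennreal"
    have kern: "ennreal (riesz_kernel a z) = ennreal (c * norm z powr (a - ?d))" for z :: 'a
      unfolding riesz_kernel_altdef c_def by simp
    have split: "ennreal (?G x) \<le> (\<integral>\<^sup>+y. ?k x y * ennreal (?F y) \<partial>lborel) + ennreal far" if x: "norm x \<le> L" for x
    proof -
      have farpt: "ennreal (c * norm (x - y) powr (a - ?d)) * ennreal (?F y) \<le>
        ennreal (c * 2 powr ?d * B * I) * (ennreal (norm y powr (- ?d - ?d)) * indicator {2 * L..} (norm y))" if y: "2 * L \<le> norm y" for y
      proof -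
        have y1: "1 \<le> norm y" "0 < norm y" "2 * R \<le> norm y" using y L by linarith+
        have "norm (x - y) powr (a - ?d) \<le> 2 powr ?d * norm y powr (a - ?d)"
          using x y L a by (intro ennreal_norm_powr_far[of x L y]) auto
        hence "c * norm (x - y) powr (a - ?d) * ?F y \<le> c * (2 powr ?d * norm y powr (a - ?d)) * (B * I * norm y powr (- ?d - s))"
          using c0 B(2)[rule_format, of s R \<phi> y] * R y1 s by (intro mult_mono mult_left_mono) (auto simp: I_def)
        also have "\<dots> = c * 2 powr ?d * B * I * (norm y powr (a - ?d) * norm y powr (- ?d - s))" by simp
        also have "norm y powr (a - ?d) * norm y powr (- ?d - s) = norm y powr (a - ?d + (- ?d - s))"
          by (rule powr_add [symmetric])
        also have "c * 2 powr ?d * B * I * norm y powr (a - ?d + (- ?d - s)) \<le> c * 2 powr ?d * B * I * norm y powr (- ?d - ?d)"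
          using c0 B I0 y1 a by (intro mult_left_mono powr_mono) auto
        finally show ?thesis using y c0 B I0 by (simp add: ennreal_mult' [symmetric] ennreal_leI)
      qed
      have "ennreal (?G x) \<le> (\<integral>\<^sup>+y. ennreal (c * norm (x - y) powr (a - ?d)) * ennreal (?F y) \<partial>lborel)"
        using test_frac_grad_le_riesz[OF *(4,1,2,3), of x] unfolding a_def[symmetric] kern .
      also have "\<dots> \<le> (\<integral>\<^sup>+y. ?k x y * ennreal (?F y) +
          ennreal (c * 2 powr ?d * B * I) * (ennreal (norm y powr (- ?d - ?d)) * indicator {2 * L..} (norm y)) \<partial>lborel)"
      proof (rule nn_integral_mono)
        fix y :: 'a
        show "ennreal (c * norm (x - y) powr (a - ?d)) * ennreal (?F y) \<le> ?k x y * ennreal (?F y) +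
          ennreal (c * 2 powr ?d * B * I) * (ennreal (norm y powr (- ?d - ?d)) * indicator {2 * L..} (norm y))"
        proof (cases "norm y \<le> 2 * L")
          case True
          hence "norm (x - y) \<le> 3 * L" using x norm_triangle_ineq4[of x y] by linarith
          thus ?thesis by simp
        next
          case False
          thus ?thesis using farpt[of y] by (simp add: add_increasing)
        qed
      qed
      also have "\<dots> = (\<integral>\<^sup>+y. ?k x y * ennreal (?F y) \<partial>lborel) +
          ennreal (c * 2 powr ?d * B * I) * (\<integral>\<^sup>+y. ennreal (norm y powr (- ?d - ?d)) * indicator {2 * L..} (norm y) \<partial>(lborel :: 'a measure))"
        by (subst nn_integral_add) (simp_all add: nn_integral_cmult)
      also have "(\<integral>\<^sup>+y. ennreal (norm y powr (- ?d - ?d)) * indicator {2 * L..} (norm y) \<partial>(lborel :: 'a measure)) \<le> ennreal \<omega>"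
      proof -
        have "(2 * L) powr (- ?d) \<le> (2 * L) powr 0" using L d1 by (intro powr_mono) auto
        hence "\<omega> * (2 * L) powr (- ?d) \<le> \<omega>" using L \<omega> by (simp add: mult_left_le)
        thus ?thesis using L d1
          by (subst nn_integral_norm_powr_outside_ball) (auto simp: \<omega>_def ennreal_leI)
      qed
      also have "ennreal (c * 2 powr ?d * B * I) * ennreal \<omega> \<le> ennreal far"
      proof -
        have "c * 2 powr ?d * B * I * \<omega> = (c * I) * (2 powr ?d * B * \<omega>)" by simp
        also have "\<dots> \<le> (\<kappa> * K1 / t * Y) * (2 powr ?d * B * \<omega>)" using cI B \<omega> by (intro mult_right_mono) auto
        also have "\<dots> = far" by (simp add: far_def K3_def)
        finally show ?thesis using \<omega> by (subst ennreal_mult'' [symmetric]) (auto intro: ennreal_leI)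
      qed
      finally show ?thesis by (simp add: add_left_mono mult_left_mono)
    qed
    \<comment> \<open>The mass of the truncated kernel: \<open>c / a \<le> \<kappa> / t\<close> cancels the \<open>1 / a\<close> of the radial integral.\<close>
    define A where "A = K2 / t"
    have A: "0 < A" using K2 t by (simp add: A_def)
    have mass: "(\<integral>\<^sup>+z. indicator {..3 * L} (norm z) * ennreal (c * norm z powr (a - ?d)) \<partial>(lborel :: 'a measure)) \<le> ennreal A"
    proof -
      have "(\<integral>\<^sup>+z. indicator {..3 * L} (norm z) * ennreal (c * norm z powr (a - ?d)) \<partial>(lborel :: 'a measure)) =
        (\<integral>\<^sup>+z. ennreal c * (ennreal (norm z powr (a - ?d)) * indicator {..3 * L} (norm z)) \<partial>(lborel :: 'a measure))"
        using c0 by (intro nn_integral_cong) (simp add: ennreal_mult mult_ac)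
      also have "\<dots> = ennreal c * ennreal (?d * \<omega> * (3 * L) powr a / a)"
        unfolding \<omega>_def using a L by (subst nn_integral_cmult, simp, subst nn_integral_norm_powr_ball) auto
      also have "\<dots> = ennreal (c / a * (?d * \<omega> * (3 * L) powr a))"
        using c0 by (subst ennreal_mult' [symmetric]) auto
      also have "\<dots> \<le> ennreal A"
      proof (rule ennreal_leI)
        have 1: "c / a \<le> \<kappa> / t" using c_le a t by (simp add: field_simps)
        have "(3 * L) powr a \<le> (3 * L) powr 1" using L a by (intro powr_mono) auto
        hence 2: "?d * \<omega> * (3 * L) powr a \<le> ?d * \<omega> * (3 * L)" using \<omega> L by (intro mult_left_mono) auto
        have "c / a * (?d * \<omega> * (3 * L) powr a) \<le> \<kappa> / t * (?d * \<omega> * (3 * L))"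
          using 1 2 c0 a \<kappa> t \<omega> by (intro mult_mono) auto
        thus "c / a * (?d * \<omega> * (3 * L) powr a) \<le> A" by (simp add: A_def K2_def)
      qed
      finally show ?thesis .
    qed
    have massx: "(\<integral>\<^sup>+y. ?k x y \<partial>lborel) \<le> ennreal A" for x :: 'a
      using nn_integral_lborel_reflect[of "\<lambda>z. indicator {..3 * L} (norm z) * ennreal (c * norm z powr (a - ?d))" x] mass by simp
    have massy: "(\<integral>\<^sup>+x. ?k x y \<partial>lborel) \<le> ennreal A" for y :: 'a
      using nn_integral_lborel_shift[of "\<lambda>z. indicator {..3 * L} (norm z) * ennreal (c * norm z powr (a - ?d))" y] mass by simp
    have near: "ennreal (?G x powr p) \<le> ennreal (2 powr p) * (ennreal (A powr (p - 1)) * (\<integral>\<^sup>+y. ?k x y * ennreal (?F y powr p) \<partial>lborel) + ennreal (far powr p))"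
      if x: "norm x \<le> L" for x
    proof -
      define n where "n = max 0 (?G x - far)"
      have n0: "0 \<le> n" by (simp add: n_def)
      have "ennreal n \<le> (\<integral>\<^sup>+y. ?k x y * ennreal (?F y) \<partial>lborel)"
      proof (cases "?G x \<le> far")
        case True
        thus ?thesis by (simp add: n_def)
      next
        case False
        hence "ennreal n + ennreal far \<le> (\<integral>\<^sup>+y. ?k x y * ennreal (?F y) \<partial>lborel) + ennreal far"
          using split[OF x] far0 by (simp add: n_def ennreal_plus [symmetric] del: ennreal_plus)
        thus ?thesis by (simp add: ennreal_add_left_cancel_le add.commute[of _ "ennreal far"])
      qed
      hence np: "ennreal (n powr p) \<le> ennreal (A powr (p - 1)) * (\<integral>\<^sup>+y. ?k x y * ennreal (?F y powr p) \<partial>lborel)"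
        using n0 A massx[of x] p by (intro weighted_jensen_powr) auto
      have "?G x powr p \<le> (n + far) powr p" using p by (intro powr_mono2) (auto simp: n_def)
      also have "\<dots> \<le> 2 powr p * (n powr p + far powr p)" using n0 far0 p by (intro powr_add_le) auto
      finally have "ennreal (?G x powr p) \<le> ennreal (2 powr p) * (ennreal (n powr p) + ennreal (far powr p))"
        by (simp add: ennreal_mult' [symmetric] ennreal_plus [symmetric] ennreal_leI del: ennreal_plus)
      also have "\<dots> \<le> ennreal (2 powr p) * (ennreal (A powr (p - 1)) * (\<integral>\<^sup>+y. ?k x y * ennreal (?F y powr p) \<partial>lborel) + ennreal (far powr p))"
        using np by (intro mult_left_mono add_right_mono) auto
      finally show ?thesis .
    qed
    have out: "ennreal (?G x powr p) \<le> ennreal ((B * I) powr p) * (ennreal (norm x powr (- ?d - e)) * indicator {L..} (norm x))" if x: "L \<le> norm x" for x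
    proof -
      have "?G x \<le> B * I * norm x powr (- ?d - t)"
        using B(2)[rule_format, of t R \<phi> x] * R x L t by (auto simp: I_def)
      also have "\<dots> \<le> B * I * norm x powr (- ?d)"
        using B I0 x L t by (intro mult_left_mono powr_mono) auto
      finally have "?G x powr p \<le> (B * I * norm x powr (- ?d)) powr p" using p by (intro powr_mono2) auto
      also have "\<dots> = (B * I) powr p * norm x powr (- ?d - e)"
      proof -
        have "- ?d * p = - ?d - e" by (simp add: e_def algebra_simps)
        hence "(norm x powr (- ?d)) powr p = norm x powr (- ?d - e)" by (simp only: powr_powr)
        thus ?thesis using B I0 by (subst powr_mult) auto
      qed
      finally show ?thesis using x by (simp add: ennreal_mult' [symmetric] ennreal_leI)
    qed
    have "(\<integral>\<^sup>+x. ennreal (?G x powr p) \<partial>lborel) \<le>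
      (\<integral>\<^sup>+x. ennreal (2 powr p) * (ennreal (A powr (p - 1)) * (\<integral>\<^sup>+y. ?k x y * ennreal (?F y powr p) \<partial>lborel) + ennreal (far powr p) * indicator (cball 0 L) x)
        + ennreal ((B * I) powr p) * (ennreal (norm x powr (- ?d - e)) * indicator {L..} (norm x)) \<partial>lborel)"
    proof (rule nn_integral_mono)
      fix x :: 'a
      show "ennreal (?G x powr p) \<le> ennreal (2 powr p) * (ennreal (A powr (p - 1)) * (\<integral>\<^sup>+y. ?k x y * ennreal (?F y powr p) \<partial>lborel) + ennreal (far powr p) * indicator (cball 0 L) x)
        + ennreal ((B * I) powr p) * (ennreal (norm x powr (- ?d - e)) * indicator {L..} (norm x))"
      proof (cases "norm x \<le> L")
        case True
        thus ?thesis using near[OF True] by (simp add: add_increasing2)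
      next
        case False
        thus ?thesis using out[of x] by (simp add: add_increasing)
      qed
    qed
    also have "\<dots> = ennreal (2 powr p) * (ennreal (A powr (p - 1)) * (\<integral>\<^sup>+x. \<integral>\<^sup>+y. ?k x y * ennreal (?F y powr p) \<partial>lborel \<partial>lborel) + ennreal (far powr p) * emeasure lborel (cball (0::'a) L))
        + ennreal ((B * I) powr p) * (\<integral>\<^sup>+x. ennreal (norm x powr (- ?d - e)) * indicator {L..} (norm x) \<partial>(lborel :: 'a measure))"
      by (simp add: nn_integral_add nn_integral_cmult nn_integral_cmult_indicator)
    also have "\<dots> \<le> ennreal (2 powr p) * (ennreal (A powr (p - 1)) * (ennreal A * ennreal (Y powr p)) + ennreal (far powr p) * ennreal vL)
        + ennreal ((B * I) powr p) * ennreal (?d * \<omega> / e)"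
    proof (intro add_mono mult_left_mono)
      have "(\<integral>\<^sup>+x. \<integral>\<^sup>+y. ?k x y * ennreal (?F y powr p) \<partial>lborel \<partial>lborel) = (\<integral>\<^sup>+y. \<integral>\<^sup>+x. ?k x y * ennreal (?F y powr p) \<partial>lborel \<partial>lborel)"
        by (rule lborel_pair.Fubini') (simp add: case_prod_unfold)
      also have "\<dots> = (\<integral>\<^sup>+y. (\<integral>\<^sup>+x. ?k x y \<partial>lborel) * ennreal (?F y powr p) \<partial>lborel)"
        by (intro nn_integral_cong nn_integral_multc) simp
      also have "\<dots> \<le> (\<integral>\<^sup>+y. ennreal A * ennreal (?F y powr p) \<partial>lborel)"
        by (intro nn_integral_mono mult_right_mono massy) simp
      also have "\<dots> \<le> ennreal A * ennreal (Y powr p)" using *(6) by (simp add: nn_integral_cmult mult_left_mono)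
      finally show "(\<integral>\<^sup>+x. \<integral>\<^sup>+y. ?k x y * ennreal (?F y powr p) \<partial>lborel \<partial>lborel) \<le> ennreal A * ennreal (Y powr p)" .
      show "emeasure lborel (cball (0::'a) L) \<le> ennreal vL" using L by (simp add: emeasure_cball_eq vL_def \<omega>_def)
      have "L powr (- e) \<le> L powr 0" using L e by (intro powr_mono) auto
      hence "?d * \<omega> * L powr (- e) / e \<le> ?d * \<omega> / e"
        using L \<omega> e by (intro divide_right_mono) (auto simp: mult_left_le)
      thus "(\<integral>\<^sup>+x. ennreal (norm x powr (- ?d - e)) * indicator {L..} (norm x) \<partial>(lborel :: 'a measure)) \<le> ennreal (?d * \<omega> / e)"
        using L e by (subst nn_integral_norm_powr_outside_ball) (auto simp: \<omega>_def ennreal_leI)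
    qed auto
    also have "\<dots> = ennreal (2 powr p * (A powr (p - 1) * (A * Y powr p) + far powr p * vL) + (B * I) powr p * (?d * \<omega> / e))"
      using A vL \<omega> e by (simp add: ennreal_mult' [symmetric] ennreal_plus [symmetric] del: ennreal_plus)
    also have "\<dots> \<le> ennreal ((K4 powr (1 / p) / t * Y) powr p)"
    proof (rule ennreal_leI)
      define u where "u = (Y / t) powr p"
      have 1: "A powr (p - 1) * (A * Y powr p) = K2 powr p * u"
      proof -
        have "A powr (p - 1) * (A * Y powr p) = A powr p * Y powr p" using A by (simp add: powr_diff)
        also have "\<dots> = (K2 * (Y / t)) powr p" using A * by (simp add: A_def powr_mult[symmetric])
        also have "\<dots> = K2 powr p * u"
          unfolding u_def by (rule powr_mult)
        finally show ?thesis .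
      qed
      have "far = K3 * (Y / t)" by (simp add: far_def)
      hence 2: "far powr p = K3 powr p * u" by (simp only: u_def powr_mult)
      have "B * I \<le> (B * K1) * (Y / t)" using mult_left_mono[OF I', of B] B(1) by (simp add: mult.assoc)
      hence "(B * I) powr p \<le> ((B * K1) * (Y / t)) powr p" using B I0 p by (intro powr_mono2) auto
      also have "\<dots> = (B * K1) powr p * u" unfolding u_def by (rule powr_mult)
      finally have 3: "(B * I) powr p * (?d * \<omega> / e) \<le> (B * K1) powr p * u * (?d * \<omega> / e)"
        using \<omega> e by (intro mult_right_mono) auto
      have "(K4 powr (1 / p) / t * Y) powr p = (K4 powr (1 / p) * (Y / t)) powr p" by simp
      also have "\<dots> = K4 * u" using K4 p t * by (subst powr_mult) (auto simp: powr_powr u_def)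
      also have "\<dots> = 2 powr p * (K2 powr p * u + K3 powr p * u * vL) + (B * K1) powr p * u * (?d * \<omega> / e)"
        unfolding K4_def by (simp add: distrib_left distrib_right mult_ac)
      finally show "2 powr p * (A powr (p - 1) * (A * Y powr p) + far powr p * vL) + (B * I) powr p * (?d * \<omega> / e) \<le> (K4 powr (1 / p) / t * Y) powr p"
        using 3 unfolding 1 2 by linarith
    qed
    finally show ?thesis .
  qed
  moreover have "0 < K4 powr (1 / p)" using K4 by simp
  ultimately show ?thesis by blast
qed

section \<open>Smooth functions with compact support\<close>

lemma Ck_Suc_imp_Ck: "Ck (Suc k) f \<Longrightarrow> Ck k f"
proof (induction k arbitrary: f)
  case 0
  thus ?case by (auto intro!: continuous_at_imp_continuous_on differentiable_imp_continuous_within)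
next
  case (Suc k)
  have "Ck (Suc k) (\<lambda>x. frechet_derivative f (at x) i)" if "i \<in> Basis" for i
    using Suc.prems that by simp
  hence "Ck k (\<lambda>x. frechet_derivative f (at x) i)" if "i \<in> Basis" for i
    using Suc.IH that by blast
  moreover have "\<forall>x. f differentiable (at x)" using Suc.prems by simp
  ultimately show ?case by simp
qed

lemma Ck_add:
  assumes "Ck k f" "Ck k g"
  shows "Ck k (\<lambda>x. f x + g x)"
  using Ck_diff[OF assms(1) Ck_bounded_linear[OF bounded_linear_minus[OF bounded_linear_ident] assms(2)]] by simp

lemma Ck_SucI:
  assumes d: "\<And>x. (f has_derivative f' x) (at x)" and "\<And>i. i \<in> Basis \<Longrightarrow> Ck k (\<lambda>x. f' x i)"
  shows "Ck (Suc k) f"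
proof -
  have "frechet_derivative f (at x) = f' x" for x
    using frechet_derivative_at[OF d[of x]] by simp
  moreover have "f differentiable (at x)" for x using d[of x] unfolding differentiable_def by blast
  ultimately show ?thesis using assms(2) by simp
qed

lemma Ck_const: "Ck k (\<lambda>x. c)"
proof (induction k arbitrary: c)
  case (Suc k)
  show ?case by (rule Ck_SucI[where f'="\<lambda>_ _. 0"]) (auto intro: Suc)
qed simp

lemma Ck_mult:
  fixes f g :: "'a::euclidean_space \<Rightarrow> real"
  assumes "Ck k f" "Ck k g"
  shows "Ck k (\<lambda>x. f x * g x)"
  using assms
proof (induction k arbitrary: f g)
  case 0
  thus ?case by (auto intro: continuous_intros)
next
  case (Suc k)
  show ?case
  proof (rule Ck_SucI)
    show "((\<lambda>x. f x * g x) has_derivative (\<lambda>h. f x * frechet_derivative g (at x) h + frechet_derivative f (at x) h * g x)) (at x)" for x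
      using Suc.prems by (intro has_derivative_mult) (auto simp: frechet_derivative_works)
    show "Ck k (\<lambda>x. f x * frechet_derivative g (at x) i + frechet_derivative f (at x) i * g x)" if "i \<in> Basis" for i
      using Suc.prems that Ck_Suc_imp_Ck[OF Suc.prems(1)] Ck_Suc_imp_Ck[OF Suc.prems(2)]
      by (intro Ck_add Suc.IH) simp_all
  qed
qed

lemma Ck_prod:
  fixes f :: "'i \<Rightarrow> 'a::euclidean_space \<Rightarrow> real"
  assumes "finite S" "\<And>i. i \<in> S \<Longrightarrow> Ck k (f i)"
  shows "Ck k (\<lambda>x. \<Prod>i\<in>S. f i x)"
  using assms by (induction S rule: finite_induct) (auto intro: Ck_const Ck_mult)

text \<open>
  With \<open>p = 1\<close> this is the function \<open>exp (- 1 / t)\<close>, continued by \<open>0\<close>, that is flat at the origin.  The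
  polynomial factor makes the family closed under differentiation.
\<close>
definition flat :: "real poly \<Rightarrow> real \<Rightarrow> real" where
  "flat p t = (if 0 < t then poly p (1 / t) * exp (- (1 / t)) else 0)"

lemma poly_times_exp_minus_tendsto_0:
  fixes p :: "real poly"
  shows "((\<lambda>u. poly p u * exp (- u)) \<longlongrightarrow> 0) at_top"
proof -
  have "((\<lambda>u. \<Sum>i\<le>degree p. coeff p i * (u ^ i / exp u)) \<longlongrightarrow> (\<Sum>i\<le>degree p. coeff p i * 0)) at_top"
    by (intro tendsto_sum tendsto_mult tendsto_const tendsto_power_div_exp_0)
  moreover have "(\<Sum>i\<le>degree p. coeff p i * (u ^ i / exp u)) = poly p u * exp (- u)" for u
    by (simp add: poly_altdef sum_distrib_right exp_minus divide_inverse mult.assoc)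
  ultimately show ?thesis by simp
qed

lemma flat_has_derivative:
  "(flat p has_real_derivative flat ([:0, 0, 1:] * (p - pderiv p)) t) (at t)"
proof (cases "t = 0")
  case True
  have r: "((\<lambda>h. flat p h / h) \<longlongrightarrow> 0) (at_right 0)"
  proof -
    have "((\<lambda>h. poly ([:0, 1:] * p) (inverse h) * exp (- inverse h)) \<longlongrightarrow> 0) (at_right (0::real))"
      by (rule filterlim_compose[OF poly_times_exp_minus_tendsto_0 filterlim_inverse_at_top_right])
    moreover have "\<forall>\<^sub>F h in at_right 0. poly ([:0, 1:] * p) (inverse h) * exp (- inverse h) = flat p h / h"
      by (auto simp: eventually_at_filter flat_def divide_inverse mult_ac)
    ultimately show ?thesis by (rule Lim_transform_eventually)
  qed
  have l: "((\<lambda>h. flat p h / h) \<longlongrightarrow> 0) (at_left 0)"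
    by (rule tendsto_eventually) (auto simp: eventually_at_filter flat_def)
  have "((\<lambda>h. flat p h / h) \<longlongrightarrow> 0) (at 0)"
    using l r by (simp add: filterlim_split_at)
  thus ?thesis using True by (simp add: DERIV_def flat_def)
next
  case False
  show ?thesis
  proof (cases "0 < t")
    case True
    have d: "((\<lambda>t. 1 / t) has_real_derivative - (1 / t * (1 / t))) (at t)"
      using DERIV_inverse[of t] True by (simp add: inverse_eq_divide power2_eq_square)
    have "((\<lambda>t. poly p (1 / t) * exp (- (1 / t))) has_real_derivative
      (poly (pderiv p) (1 / t) * - (1 / t * (1 / t))) * exp (- (1 / t)) + (exp (- (1 / t)) * (- (- (1 / t * (1 / t))))) * poly p (1 / t)) (at t)"
      by (rule DERIV_mult[OF DERIV_chain2[OF poly_DERIV d] DERIV_chain2[OF DERIV_exp DERIV_minus[OF d]]])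
    moreover have "(poly (pderiv p) u * - (u * u)) * e + (e * (- (- (u * u)))) * poly p u = poly ([:0, 0, 1:] * (p - pderiv p)) u * e" for u e
      by (simp add: algebra_simps)
    ultimately have dd: "((\<lambda>t. poly p (1 / t) * exp (- (1 / t))) has_real_derivative flat ([:0, 0, 1:] * (p - pderiv p)) t) (at t)"
      using True by (simp only: flat_def if_True)
    have ev: "\<forall>\<^sub>F x in nhds t. poly p (1 / x) * exp (- (1 / x)) = flat p x"
      using eventually_nhds_in_open[of "{0<..}" t] True by (auto simp: flat_def elim!: eventually_mono)
    show ?thesis by (rule iffD1[OF DERIV_cong_ev[OF refl ev refl] dd])
  next
    case f: False
    have dd: "((\<lambda>t. 0) has_real_derivative flat ([:0, 0, 1:] * (p - pderiv p)) t) (at t)"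
      using f by (simp add: flat_def)
    have ev: "\<forall>\<^sub>F x in nhds t. 0 = flat p x"
      using eventually_nhds_in_open[of "{..<0}" t] f False by (auto simp: flat_def elim!: eventually_mono)
    show ?thesis by (rule iffD1[OF DERIV_cong_ev[OF refl ev refl] dd])
  qed
qed

lemma Ck_flat_affine:
  fixes i :: "'a::euclidean_space"
  shows "Ck k (\<lambda>x::'a. flat p (c * (x \<bullet> i) + e))"
proof (induction k arbitrary: p)
  case 0
  have "continuous_on UNIV (flat p)"
    using flat_has_derivative by (intro continuous_at_imp_continuous_on ballI DERIV_isCont) blast
  thus ?case by (auto intro!: continuous_on_compose2[of UNIV "flat p"] continuous_intros)
next
  case (Suc k)
  let ?q = "[:0, 0, 1:] * (p - pderiv p)"
  show ?case
  proof (rule Ck_SucI)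
    show "((\<lambda>x. flat p (c * (x \<bullet> i) + e)) has_derivative (\<lambda>h. (c * (h \<bullet> i)) * flat ?q (c * (x \<bullet> i) + e))) (at x)" for x
    proof -
      have "((\<lambda>x. c * (x \<bullet> i) + e) has_derivative (\<lambda>h. c * (h \<bullet> i))) (at x)"
        by (auto intro!: derivative_eq_intros)
      moreover have "(flat p has_derivative (\<lambda>h. h * flat ?q (c * (x \<bullet> i) + e))) (at (c * (x \<bullet> i) + e))"
      proof -
        have "(\<lambda>h. h * z) = (*) z" for z :: real by (simp add: fun_eq_iff mult.commute)
        thus ?thesis using flat_has_derivative[of p] by (simp only: has_field_derivative_def)
      qed
      ultimately show ?thesis by (rule has_derivative_compose)
    qed
    show "Ck k (\<lambda>x. (c * (j \<bullet> i)) * flat ?q (c * (x \<bullet> i) + e))" for j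
      by (intro Ck_bounded_linear[OF bounded_linear_mult_right] Suc)
  qed
qed

text \<open>
  As \<open>n\<close> grows this tends to the indicator of the box, since \<open>exp (- 1 / (n t))\<close> tends to \<open>1\<close> for every
  \<open>t > 0\<close>.
\<close>
definition bump :: "nat \<Rightarrow> 'a::euclidean_space \<Rightarrow> 'a \<Rightarrow> 'a \<Rightarrow> real" where
  "bump n a b x = (\<Prod>i\<in>Basis. flat 1 (real n * (x \<bullet> i) + - real n * (a \<bullet> i)) * flat 1 (- real n * (x \<bullet> i) + real n * (b \<bullet> i)))"

lemma flat_1_bounds: "0 \<le> flat 1 t" "flat 1 t \<le> 1"
  by (auto simp: flat_def)

lemma Ck_bump: "Ck k (bump n a b)"
  unfolding bump_def[abs_def] by (intro Ck_prod Ck_mult Ck_flat_affine finite_Basis)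

lemma bump_bounds: "0 \<le> bump n a b x" "bump n a b x \<le> 1"
  using flat_1_bounds by (auto simp: bump_def intro!: prod_nonneg prod_le_1 mult_nonneg_nonneg mult_le_one)

lemma bump_outside:
  assumes "x \<notin> box a b"
  shows "bump n a b x = 0"
proof -
  obtain i where i: "i \<in> Basis" "x \<bullet> i \<le> a \<bullet> i \<or> b \<bullet> i \<le> x \<bullet> i"
    using assms by (auto simp: mem_box not_less)
  have "flat 1 (real n * (x \<bullet> i) + - real n * (a \<bullet> i)) * flat 1 (- real n * (x \<bullet> i) + real n * (b \<bullet> i)) = 0"
    using i(2)
  proof
    assume "x \<bullet> i \<le> a \<bullet> i"
    hence "real n * (x \<bullet> i) \<le> real n * (a \<bullet> i)" by (intro mult_left_mono) auto
    thus ?thesis by (simp add: flat_def)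
  next
    assume "b \<bullet> i \<le> x \<bullet> i"
    hence "real n * (b \<bullet> i) \<le> real n * (x \<bullet> i)" by (intro mult_left_mono) auto
    thus ?thesis by (simp add: flat_def)
  qed
  thus ?thesis unfolding bump_def using i(1) by (intro prod_zero) auto
qed

lemma flat_1_scaled_tendsto:
  assumes "0 < c"
  shows "(\<lambda>n. flat 1 (real n * c)) \<longlonglongrightarrow> 1"
proof -
  have "(\<lambda>n. exp (- (1 / c * (1 / real n)))) \<longlonglongrightarrow> exp (- (1 / c * 0))"
    by (intro tendsto_intros lim_1_over_n)
  moreover have "\<forall>\<^sub>F n in sequentially. exp (- (1 / c * (1 / real n))) = flat 1 (real n * c)"
    using eventually_gt_at_top[of 0] by eventually_elim (use assms in \<open>simp add: flat_def mult.commute\<close>)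
  ultimately show ?thesis using Lim_transform_eventually by fastforce
qed

lemma bump_tendsto: "(\<lambda>n. bump n a b x) \<longlonglongrightarrow> indicator (box a b) x"
proof (cases "x \<in> box a b")
  case True
  have "(\<lambda>n. bump n a b x) \<longlonglongrightarrow> (\<Prod>i\<in>(Basis :: 'a set). 1 * 1)"
    unfolding bump_def
  proof (intro tendsto_prod tendsto_mult)
    fix i :: 'a assume i: "i \<in> Basis"
    have "(\<lambda>n. flat 1 (real n * (x \<bullet> i - a \<bullet> i))) \<longlonglongrightarrow> 1" "(\<lambda>n. flat 1 (real n * (b \<bullet> i - x \<bullet> i))) \<longlonglongrightarrow> 1"
      using True i by (auto intro!: flat_1_scaled_tendsto simp: mem_box)
    thus "(\<lambda>n. flat 1 (real n * (x \<bullet> i) + - real n * (a \<bullet> i))) \<longlonglongrightarrow> 1"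
      "(\<lambda>n. flat 1 (- real n * (x \<bullet> i) + real n * (b \<bullet> i))) \<longlonglongrightarrow> 1"
      by (simp_all add: right_diff_distrib add.commute)
  qed
  thus ?thesis using True by simp
qed (simp add: bump_outside)

lemma bump_Cc_infinity:
  "(\<lambda>x. bump n a b x *\<^sub>R (j::'a::euclidean_space)) \<in> Cc_infinity UNIV"
proof -
  have "closure {x. bump n a b x *\<^sub>R j \<noteq> 0} \<subseteq> cbox a b"
  proof (rule closure_minimal)
    have "bump n a b x = 0" if "x \<notin> cbox a b" for x
      using that box_subset_cbox[of a b] by (intro bump_outside) blast
    thus "{x. bump n a b x *\<^sub>R j \<noteq> 0} \<subseteq> cbox a b" by auto
  qed (rule closed_cbox)
  hence "compact (closure {x. bump n a b x *\<^sub>R j \<noteq> 0})"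
    using compact_Int_closed[OF compact_cbox[of a b] closed_closure[of "{x. bump n a b x *\<^sub>R j \<noteq> 0}"]]
    by (simp add: Int_absorb1)
  moreover have "Ck k (\<lambda>x. bump n a b x *\<^sub>R j)" for k
    by (intro Ck_bounded_linear[OF bounded_linear_scaleR_left] Ck_bump)
  ultimately show ?thesis by (simp add: Cc_infinity_def)
qed

section \<open>Uniqueness of weak fractional gradients\<close>

lemma L1_loc_measurable:
  assumes "G \<in> L1_loc"
  shows "G \<in> borel_measurable lebesgue"
proof (rule borel_measurable_LIMSEQ_metric)
  show "(\<lambda>i. indicat_real (cball 0 (real i)) x *\<^sub>R G x) \<longlonglongrightarrow> G x" for x
  proof (rule tendsto_eventually)
    obtain n :: nat where "norm x \<le> real n" using real_arch_simple by blast
    thus "\<forall>\<^sub>F i in sequentially. indicat_real (cball 0 (real i)) x *\<^sub>R G x = G x"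
      by (intro eventually_sequentiallyI[of n]) (auto simp: indicator_def)
  qed
  show "(\<lambda>x. indicat_real (cball 0 (real i)) x *\<^sub>R G x) \<in> borel_measurable lebesgue" for i
  proof -
    have "set_integrable lebesgue (cball 0 (real i)) G" using assms by (simp add: L1_loc_def)
    thus ?thesis unfolding set_integrable_def by (rule borel_measurable_integrable)
  qed
qed

text \<open>
  The positive and the negative part of \<open>g\<close> are densities of two measures that agree on boxes, hence
  everywhere.
\<close>
lemma AE_0_if_integral_box_0:
  fixes g :: "'a::euclidean_space \<Rightarrow> real"
  assumes loc: "\<And>a b. set_integrable lebesgue (cbox a b) g"
    and meas: "g \<in> borel_measurable lebesgue"
    and zero: "\<And>a b. (\<integral>x. indicator (box a b) x * g x \<partial>lebesgue) = 0"
  shows "AE x in lebesgue. g x = 0"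
proof -
  obtain g' where [measurable]: "g' \<in> borel_measurable lborel" and g': "AE x in lborel. g x = g' x"
    using completion_ex_borel_measurable_real[OF meas] by metis
  have g'': "AE x in lebesgue. g x = g' x" using g' by (rule AE_completion)
  have loc': "integrable lborel (\<lambda>x. indicator (cbox a b) x * g' x)" for a b
  proof -
    have "integrable lebesgue (\<lambda>x. indicator (cbox a b) x * g x)"
      using loc[of a b] by (simp add: set_integrable_def)
    hence "integrable lebesgue (\<lambda>x. indicator (cbox a b) x * g' x)"
      by (rule integrable_cong_AE_imp) (use g'' in \<open>auto intro!: measurable_completion borel_measurable_times borel_measurable_indicator\<close>)
    thus ?thesis by (subst (asm) integrable_completion) (auto intro!: borel_measurable_times borel_measurable_indicator)
  qed
  have zero': "(\<integral>x. indicator (box a b) x * g' x \<partial>lborel) = 0" for a b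
  proof -
    have m: "(\<lambda>x. indicator (box a b) x * g' x) \<in> borel_measurable lborel"
      by (intro borel_measurable_times borel_measurable_indicator) auto
    have "(\<integral>x. indicator (box a b) x * g' x \<partial>lborel) = (\<integral>x. indicator (box a b) x * g' x \<partial>lebesgue)"
      by (rule integral_completion[OF m, symmetric])
    also have "\<dots> = (\<integral>x. indicator (box a b) x * g x \<partial>lebesgue)"
      using g'' by (intro integral_cong_AE) (auto intro!: measurable_completion[OF m] borel_measurable_times borel_measurable_indicator meas)
    finally show ?thesis using zero by simp
  qed
  have boxint: "integrable lborel (\<lambda>x. indicator (box a b) x * g' x)" for a b
  proof (rule Bochner_Integration.integrable_bound[OF loc'[of a b]])
    show "(\<lambda>x. indicator (box a b) x * g' x) \<in> borel_measurable lborel"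
      by (intro borel_measurable_times borel_measurable_indicator) auto
    show "AE x in lborel. norm (indicator (box a b) x * g' x) \<le> norm (indicator (cbox a b) x * g' x)"
      using box_subset_cbox[of a b] by (intro AE_I2) (auto simp: indicator_def)
  qed
  define Mp where "Mp = density lborel (\<lambda>x. ennreal (g' x))"
  define Mn where "Mn = density lborel (\<lambda>x. ennreal (- g' x))"
  have em: "emeasure Mp (box a b) = (\<integral>\<^sup>+x. ennreal (indicator (box a b) x * g' x) \<partial>lborel)"
    "emeasure Mn (box a b) = (\<integral>\<^sup>+x. ennreal (- (indicator (box a b) x * g' x)) \<partial>lborel)" for a b
    unfolding Mp_def Mn_def by (auto simp: emeasure_density indicator_def intro!: nn_integral_cong)
  have fin: "emeasure Mp (box a b) \<noteq> \<infinity>" "emeasure Mn (box a b) \<noteq> \<infinity>" for a b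
    using boxint[of a b] unfolding em by (auto simp: real_integrable_def)
  have eq: "emeasure Mp (box a b) = emeasure Mn (box a b)" for a b
  proof -
    have "enn2real (emeasure Mp (box a b)) = enn2real (emeasure Mn (box a b))"
      using zero'[of a b] real_lebesgue_integral_def[OF boxint[of a b]] unfolding em by simp
    thus ?thesis using fin[of a b] by (metis ennreal_enn2real_if infinity_ennreal_def)
  qed
  have "Mp = Mn"
  proof (rule measure_eqI_generator_eq)
    let ?E = "range (\<lambda>(a, b). box a b::'a set)"
    show "Int_stable ?E" by (auto simp: Int_stable_def box_Int_box)
    show "?E \<subseteq> Pow UNIV" "sets Mp = sigma_sets UNIV ?E" "sets Mn = sigma_sets UNIV ?E"
      by (simp_all add: Mp_def Mn_def borel_eq_box)
    let ?A = "\<lambda>n::nat. box (- (real n *\<^sub>R One)) (real n *\<^sub>R One) :: 'a set"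
    show "range ?A \<subseteq> ?E" "(\<Union>i. ?A i) = UNIV"
      unfolding UN_box_eq_UNIV by auto
    show "emeasure Mp (?A i) \<noteq> \<infinity>" for i using fin by blast
    show "X \<in> ?E \<Longrightarrow> emeasure Mp X = emeasure Mn X" for X using eq by auto
  qed
  hence "AE x in lborel. ennreal (g' x) = ennreal (- g' x)"
    unfolding Mp_def Mn_def by (intro sigma_finite_measure.density_unique[OF sigma_finite_lborel]) auto
  hence "AE x in lborel. g' x = 0"
  proof eventually_elim
    case (elim x)
    thus ?case by (cases "g' x" "0::real" rule: linorder_cases) (auto simp: ennreal_neg ennreal_eq_0_iff)
  qed
  hence "AE x in lebesgue. g' x = 0" by (rule AE_completion)
  thus ?thesis using g'' by eventually_elim simp
qed

text \<open>
  Testing with bump functions and passing to the limit, the integral of every component over every box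
  is zero.
\<close>
lemma fundamental_lemma:
  fixes G :: "'a::euclidean_space \<Rightarrow> 'a"
  assumes G: "G \<in> L1_loc" and zero: "\<And>\<Phi>. \<Phi> \<in> Cc_infinity UNIV \<Longrightarrow> (\<integral>x. G x \<bullet> \<Phi> x \<partial>lebesgue) = 0"
  shows "AE x in lebesgue. G x = 0"
proof -
  note [measurable] = L1_loc_measurable[OF G]
  have comp: "AE x in lebesgue. G x \<bullet> j = 0" if "j \<in> Basis" for j
  proof (rule AE_0_if_integral_box_0)
    have int: "integrable lebesgue (\<lambda>x. indicat_real (cbox a b) x *\<^sub>R G x)" for a b
      using G by (auto simp: L1_loc_def set_integrable_def)
    have int': "integrable lebesgue (\<lambda>x. indicat_real (cbox a b) x * (G x \<bullet> j))" for a b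
      using integrable_inner_left[OF int[of a b], of j] by simp
    thus "set_integrable lebesgue (cbox a b) (\<lambda>x. G x \<bullet> j)" for a b
      by (simp add: set_integrable_def)
    show m: "(\<lambda>x. G x \<bullet> j) \<in> borel_measurable lebesgue" by measurable
    fix a b :: 'a
    have bm: "bump n a b \<in> borel_measurable lebesgue" for n
      using Ck_imp_continuous[OF Ck_bump[of 0 n a b]] by (intro measurable_completion) (simp add: borel_measurable_continuous_onI)
    have "(\<lambda>n. \<integral>x. bump n a b x * (G x \<bullet> j) \<partial>lebesgue) \<longlonglongrightarrow> (\<integral>x. indicator (box a b) x * (G x \<bullet> j) \<partial>lebesgue)"
    proof (rule integral_dominated_convergence)
      show "integrable lebesgue (\<lambda>x. norm (indicat_real (cbox a b) x * (G x \<bullet> j)))" using int' by (rule integrable_norm)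
      show "AE x in lebesgue. (\<lambda>n. bump n a b x * (G x \<bullet> j)) \<longlonglongrightarrow> indicator (box a b) x * (G x \<bullet> j)"
        by (intro AE_I2 tendsto_mult bump_tendsto tendsto_const)
      show "AE x in lebesgue. norm (bump n a b x * (G x \<bullet> j)) \<le> norm (indicat_real (cbox a b) x * (G x \<bullet> j))" for n
      proof (rule AE_I2)
        fix x
        show "norm (bump n a b x * (G x \<bullet> j)) \<le> norm (indicat_real (cbox a b) x * (G x \<bullet> j))"
        proof (cases "x \<in> box a b")
          case True
          hence "x \<in> cbox a b" using box_subset_cbox by blast
          thus ?thesis using bump_bounds[of n a b x] by (simp add: abs_mult mult_left_le_one_le)
        qed (simp add: bump_outside)
      qed
      show "(\<lambda>x. indicator (box a b) x * (G x \<bullet> j)) \<in> borel_measurable lebesgue"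
        by (intro borel_measurable_times borel_measurable_indicator m) auto
      show "(\<lambda>x. bump n a b x * (G x \<bullet> j)) \<in> borel_measurable lebesgue" for n
        by (intro borel_measurable_times m bm)
    qed
    moreover have "(\<integral>x. bump n a b x * (G x \<bullet> j) \<partial>lebesgue) = 0" for n
      using zero[OF bump_Cc_infinity[of n a b j]] by simp
    ultimately show "(\<integral>x. indicator (box a b) x * (G x \<bullet> j) \<partial>lebesgue) = 0"
      using LIMSEQ_unique[OF _ tendsto_const] by simp
  qed
  have "AE x in lebesgue. \<forall>j\<in>Basis. G x \<bullet> j = 0"
    using comp by (subst AE_ball_countable) (auto intro: countable_finite)
  thus ?thesis by eventually_elim (auto intro: euclidean_eqI)
qed

section \<open>Lebesgue spaces\<close>

text \<open>
  The \<open>p\<close>-th power of the norm, as an extended real number that may be infinite.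
\<close>
definition Lp_mass :: "real \<Rightarrow> ('a::euclidean_space \<Rightarrow> 'b::euclidean_space) \<Rightarrow> ennreal" where
  "Lp_mass p f = (\<integral>\<^sup>+x. ennreal (norm (f x) powr p) \<partial>lebesgue)"

lemma Lp_mass_lborel: "Lp_mass p f = (\<integral>\<^sup>+x. ennreal (norm (f x) powr p) \<partial>lborel)"
  unfolding Lp_mass_def by (rule nn_integral_completion)

lemma Lp_iff_mass:
  "f \<in> Lp p \<longleftrightarrow> f \<in> borel_measurable lebesgue \<and> Lp_mass p f < \<infinity>"
proof -
  have "integrable lebesgue (\<lambda>x. norm (f x) powr p) \<longleftrightarrow> Lp_mass p f < \<infinity>" if "f \<in> borel_measurable lebesgue"
    using that by (subst integrable_iff_bounded) (auto simp: Lp_mass_def)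
  thus ?thesis by (auto simp: Lp_def)
qed

lemma Lp_norm_powr:
  assumes "f \<in> Lp p" "0 < p"
  shows "ennreal (Lp_norm p f powr p) = Lp_mass p f"
proof -
  have i: "integrable lebesgue (\<lambda>x. norm (f x) powr p)" using assms by (simp add: Lp_def)
  have "0 \<le> (LINT x|lebesgue. norm (f x) powr p)" by (intro integral_nonneg_AE) auto
  hence "Lp_norm p f powr p = (LINT x|lebesgue. norm (f x) powr p)"
    using assms(2) by (simp add: Lp_norm_def powr_powr)
  thus ?thesis unfolding Lp_mass_def using i by (subst nn_integral_eq_integral) auto
qed

lemma Lp_norm_nonneg: "0 \<le> Lp_norm p f"
  by (simp add: Lp_norm_def)

lemma Lp_mass_cong_AE: "AE x in lebesgue. f x = g x \<Longrightarrow> Lp_mass p f = Lp_mass p g"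
  unfolding Lp_mass_def by (intro nn_integral_cong_AE) auto

lemma Lp_norm_le_iff_mass:
  assumes "f \<in> Lp p" "0 < p" "0 \<le> Y"
  shows "Lp_norm p f \<le> Y \<longleftrightarrow> Lp_mass p f \<le> ennreal (Y powr p)"
proof -
  have "Lp_norm p f \<le> Y \<longleftrightarrow> Lp_norm p f powr p \<le> Y powr p"
    using assms Lp_norm_nonneg[of p f] powr_mono2[of p "Lp_norm p f" Y] powr_less_mono2[of p Y "Lp_norm p f"]
    by (auto simp: not_le[symmetric])
  thus ?thesis unfolding Lp_norm_powr[OF assms(1,2), symmetric] by simp
qed

lemma Lp_mass_diff_le:
  assumes [measurable]: "f \<in> borel_measurable lebesgue" "g \<in> borel_measurable lebesgue" and p: "0 \<le> p"
  shows "Lp_mass p (\<lambda>x. f x - g x) \<le> ennreal (2 powr p) * (Lp_mass p f + Lp_mass p g)"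
proof -
  have "Lp_mass p (\<lambda>x. f x - g x) \<le> (\<integral>\<^sup>+x. ennreal (2 powr p) * (ennreal (norm (f x) powr p) + ennreal (norm (g x) powr p)) \<partial>lebesgue)"
    unfolding Lp_mass_def
  proof (rule nn_integral_mono)
    fix x
    have "norm (f x - g x) powr p \<le> (norm (f x) + norm (g x)) powr p"
      using p norm_triangle_ineq4 by (intro powr_mono2) auto
    also have "\<dots> \<le> 2 powr p * (norm (f x) powr p + norm (g x) powr p)" using p by (intro powr_add_le) auto
    finally show "ennreal (norm (f x - g x) powr p) \<le> ennreal (2 powr p) * (ennreal (norm (f x) powr p) + ennreal (norm (g x) powr p))"
      by (simp add: ennreal_mult' [symmetric] ennreal_plus [symmetric] ennreal_leI del: ennreal_plus)
  qed
  also have "\<dots> = ennreal (2 powr p) * (Lp_mass p f + Lp_mass p g)"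
    unfolding Lp_mass_def by (simp add: nn_integral_cmult nn_integral_add)
  finally show ?thesis .
qed

lemma Lp_diff:
  assumes "f \<in> Lp p" "g \<in> Lp p" "0 \<le> p"
  shows "(\<lambda>x. f x - g x) \<in> Lp p"
proof -
  have "Lp_mass p (\<lambda>x. f x - g x) \<le> ennreal (2 powr p) * (Lp_mass p f + Lp_mass p g)"
    using assms by (intro Lp_mass_diff_le) (auto simp: Lp_iff_mass)
  also have "\<dots> < \<infinity>" using assms by (auto simp: Lp_iff_mass ennreal_mult_less_top)
  finally show ?thesis using assms by (auto simp: Lp_iff_mass)
qed

lemma Lp_mass_triangle:
  assumes "f \<in> borel_measurable lebesgue" "g \<in> borel_measurable lebesgue" "0 \<le> p"
  shows "Lp_mass p f \<le> ennreal (2 powr p) * (Lp_mass p (\<lambda>x. f x - g x) + Lp_mass p g)"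
proof -
  have "Lp_mass p (\<lambda>x. (f x - g x) - (- g x)) \<le> ennreal (2 powr p) * (Lp_mass p (\<lambda>x. f x - g x) + Lp_mass p (\<lambda>x. - g x))"
    using assms by (intro Lp_mass_diff_le) auto
  thus ?thesis by (simp add: Lp_mass_def)
qed

lemma Lp_subset_L1_loc:
  assumes "f \<in> Lp p" "1 < p"
  shows "f \<in> L1_loc"
  unfolding L1_loc_def mem_Collect_eq set_integrable_def
proof (intro allI impI)
  fix K :: "'a set" assume K: "compact K"
  have f: "f \<in> borel_measurable lebesgue" "integrable lebesgue (\<lambda>x. norm (f x) powr p)"
    using assms by (auto simp: Lp_def)
  have Km: "K \<in> sets lebesgue" "emeasure lebesgue K < \<infinity>"
    using K compact_imp_closed[OF K] emeasure_lborel_cbox_finite emeasure_compact_finite[OF K] by (auto simp: borel_closed)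
  show "integrable lebesgue (\<lambda>x. indicat_real K x *\<^sub>R f x)"
  proof (rule Bochner_Integration.integrable_bound)
    show "integrable lebesgue (\<lambda>x. indicat_real K x + norm (f x) powr p)"
      using f Km by (intro Bochner_Integration.integrable_add integrable_real_indicator) auto
    show "(\<lambda>x. indicat_real K x *\<^sub>R f x) \<in> borel_measurable lebesgue"
      using f Km by (intro borel_measurable_scaleR borel_measurable_indicator) auto
    show "AE x in lebesgue. norm (indicat_real K x *\<^sub>R f x) \<le> norm (indicat_real K x + norm (f x) powr p)"
    proof (rule AE_I2)
      fix x
      have "norm (f x) \<le> 1 + norm (f x) powr p"
      proof (cases "norm (f x) \<le> 1")
        case False
        hence "norm (f x) powr 1 \<le> norm (f x) powr p" using assms by (intro powr_mono) auto
        thus ?thesis using False by simp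
      qed (simp add: add_increasing2)
      thus "norm (indicat_real K x *\<^sub>R f x) \<le> norm (indicat_real K x + norm (f x) powr p)"
        by (auto simp: indicator_def)
    qed
  qed
qed

text \<open>The pairing of \<open>L\<^sup>p\<close> and \<open>L\<^sup>q\<close>, with a free scaling parameter \<open>l\<close> instead of Hoelder's inequality.\<close>
lemma pairing_le:
  fixes w :: "'a::euclidean_space \<Rightarrow> 'b::euclidean_space" and V :: "'a \<Rightarrow> 'c::euclidean_space"
  assumes [measurable]: "w \<in> borel_measurable lebesgue" "V \<in> borel_measurable lebesgue"
    and pq: "1 < p" "1 < q" "1 / p + 1 / q = 1" and l: "0 < l"
  shows "(\<integral>\<^sup>+x. ennreal (norm (w x) * norm (V x)) \<partial>lebesgue) \<le>
    ennreal (l powr (- p)) * Lp_mass p w + ennreal (l powr q) * Lp_mass q V"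
proof -
  have "(\<integral>\<^sup>+x. ennreal (norm (w x) * norm (V x)) \<partial>lebesgue) \<le>
    (\<integral>\<^sup>+x. ennreal (l powr (- p)) * ennreal (norm (w x) powr p) + ennreal (l powr q) * ennreal (norm (V x) powr q) \<partial>lebesgue)"
  proof (rule nn_integral_mono)
    fix x
    have "norm (w x) * norm (V x) = (norm (w x) / l) * (l * norm (V x))" using l by simp
    also have "\<dots> \<le> (norm (w x) / l) powr p / p + (l * norm (V x)) powr q / q"
      using pq l by (intro Youngs_inequality) auto
    also have "\<dots> \<le> (norm (w x) / l) powr p + (l * norm (V x)) powr q"
    proof (rule add_mono)
      show "(norm (w x) / l) powr p / p \<le> (norm (w x) / l) powr p"
        using pq mult_left_mono[of 1 p "(norm (w x) / l) powr p"] by (simp add: divide_le_eq)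
      show "(l * norm (V x)) powr q / q \<le> (l * norm (V x)) powr q"
        using pq mult_left_mono[of 1 q "(l * norm (V x)) powr q"] by (simp add: divide_le_eq)
    qed
    also have "\<dots> = l powr (- p) * norm (w x) powr p + l powr q * norm (V x) powr q"
      using l by (simp add: powr_divide powr_mult powr_minus_divide)
    finally show "ennreal (norm (w x) * norm (V x)) \<le> ennreal (l powr (- p)) * ennreal (norm (w x) powr p) + ennreal (l powr q) * ennreal (norm (V x) powr q)"
      by (simp add: ennreal_mult' [symmetric] ennreal_plus [symmetric] ennreal_leI del: ennreal_plus)
  qed
  also have "\<dots> = ennreal (l powr (- p)) * Lp_mass p w + ennreal (l powr q) * Lp_mass q V"
    unfolding Lp_mass_def by (simp add: nn_integral_cmult nn_integral_add)
  finally show ?thesis .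
qed

lemma pairing_integrable:
  fixes w :: "'a::euclidean_space \<Rightarrow> 'b::euclidean_space" and V :: "'a \<Rightarrow> 'b"
  assumes w: "w \<in> Lp p" and V: "V \<in> Lp q" and pq: "1 < p" "1 < q" "1 / p + 1 / q = 1"
  shows "integrable lebesgue (\<lambda>x. w x \<bullet> V x)"
proof (rule integrableI_bounded)
  have m: "w \<in> borel_measurable lebesgue" "V \<in> borel_measurable lebesgue" using w V by (auto simp: Lp_iff_mass)
  thus "(\<lambda>x. w x \<bullet> V x) \<in> borel_measurable lebesgue" by (rule borel_measurable_inner)
  have "(\<integral>\<^sup>+x. ennreal (norm (w x \<bullet> V x)) \<partial>lebesgue) \<le> (\<integral>\<^sup>+x. ennreal (norm (w x) * norm (V x)) \<partial>lebesgue)"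
    by (intro nn_integral_mono ennreal_leI) (simp add: Cauchy_Schwarz_ineq2)
  also have "\<dots> \<le> ennreal (1 powr (- p)) * Lp_mass p w + ennreal (1 powr q) * Lp_mass q V"
    by (intro pairing_le m pq) simp
  also have "\<dots> < \<infinity>" using w V by (simp add: Lp_iff_mass)
  finally show "(\<integral>\<^sup>+x. ennreal (norm (w x \<bullet> V x)) \<partial>lebesgue) < \<infinity>" .
qed

lemma pairing_tendsto:
  fixes w :: "nat \<Rightarrow> 'a::euclidean_space \<Rightarrow> 'b::euclidean_space" and V :: "'a \<Rightarrow> 'b"
  assumes w: "\<And>n. w n \<in> Lp p" and w0: "w0 \<in> Lp p" and V: "V \<in> Lp q"
    and pq: "1 < p" "1 < q" "1 / p + 1 / q = 1"
    and le: "\<And>n. Lp_mass p (\<lambda>x. w0 x - w n x) \<le> ennreal (\<delta> n)" and \<delta>: "\<delta> \<longlonglongrightarrow> 0"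
  shows "(\<lambda>n. \<integral>x. w n x \<bullet> V x \<partial>lebesgue) \<longlonglongrightarrow> (\<integral>x. w0 x \<bullet> V x \<partial>lebesgue)"
proof (rule LIMSEQ_I)
  fix e :: real assume e: "0 < e"
  obtain v where v: "0 \<le> v" "Lp_mass q V = ennreal v"
    using V by (cases "Lp_mass q V") (auto simp: Lp_iff_mass)
  \<comment> \<open>This scale makes the contribution of \<open>V\<close> at most \<open>e / 2\<close>; the other one then vanishes in the limit.\<close>
  define l where "l = (e / (2 * (v + 1))) powr (1 / q)"
  have l: "0 < l" using e v by (simp add: l_def)
  have lv: "l powr q * v \<le> e / 2"
  proof -
    have "l powr q * v = e / (2 * (v + 1)) * v" using e v pq by (simp add: l_def powr_powr)
    also have "\<dots> \<le> e / 2" using e v by (simp add: field_simps)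
    finally show ?thesis .
  qed
  have "(\<lambda>n. l powr (- p) * \<bar>\<delta> n\<bar>) \<longlonglongrightarrow> l powr (- p) * \<bar>0\<bar>" using \<delta> by (intro tendsto_intros)
  hence "\<forall>\<^sub>F n in sequentially. l powr (- p) * \<bar>\<delta> n\<bar> < e / 2" using e by (intro order_tendstoD(2)) auto
  then obtain N where N: "\<And>n. N \<le> n \<Longrightarrow> l powr (- p) * \<bar>\<delta> n\<bar> < e / 2" by (auto simp: eventually_sequentially)
  show "\<exists>no. \<forall>n\<ge>no. norm ((\<integral>x. w n x \<bullet> V x \<partial>lebesgue) - (\<integral>x. w0 x \<bullet> V x \<partial>lebesgue)) < e"
  proof (intro exI[of _ N] allI impI)
    fix n assume n: "N \<le> n"
    have d: "(\<lambda>x. w0 x - w n x) \<in> Lp p" using w0 w pq by (intro Lp_diff) auto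
    have i: "integrable lebesgue (\<lambda>x. w n x \<bullet> V x)" "integrable lebesgue (\<lambda>x. w0 x \<bullet> V x)" "integrable lebesgue (\<lambda>x. (w0 x - w n x) \<bullet> V x)"
      by (intro pairing_integrable[OF _ V pq] w w0 d)+
    have "ennreal (norm (\<integral>x. (w0 x - w n x) \<bullet> V x \<partial>lebesgue)) \<le> (\<integral>\<^sup>+x. ennreal (norm ((w0 x - w n x) \<bullet> V x)) \<partial>lebesgue)"
      by (rule integral_norm_bound_ennreal[OF i(3)])
    also have "\<dots> \<le> (\<integral>\<^sup>+x. ennreal (norm (w0 x - w n x) * norm (V x)) \<partial>lebesgue)"
      by (intro nn_integral_mono ennreal_leI) (simp add: Cauchy_Schwarz_ineq2)
    also have "\<dots> \<le> ennreal (l powr (- p)) * Lp_mass p (\<lambda>x. w0 x - w n x) + ennreal (l powr q) * Lp_mass q V"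
      using d V by (intro pairing_le pq l) (auto simp: Lp_iff_mass)
    also have "\<dots> \<le> ennreal (l powr (- p)) * ennreal \<bar>\<delta> n\<bar> + ennreal (l powr q) * ennreal v"
      using le[of n] v by (intro add_mono mult_left_mono) (auto intro: order_trans ennreal_leI)
    also have "\<dots> = ennreal (l powr (- p) * \<bar>\<delta> n\<bar> + l powr q * v)"
      using v by (simp add: ennreal_mult' [symmetric] ennreal_plus [symmetric] del: ennreal_plus)
    finally have "norm (\<integral>x. (w0 x - w n x) \<bullet> V x \<partial>lebesgue) \<le> l powr (- p) * \<bar>\<delta> n\<bar> + l powr q * v"
      using v by (subst (asm) ennreal_le_iff) auto
    also have "\<dots> < e" using N[OF n] lv by linarith
    finally have "norm (\<integral>x. (w0 x - w n x) \<bullet> V x \<partial>lebesgue) < e" .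
    moreover have "(\<integral>x. (w0 x - w n x) \<bullet> V x \<partial>lebesgue) = (\<integral>x. w0 x \<bullet> V x \<partial>lebesgue) - (\<integral>x. w n x \<bullet> V x \<partial>lebesgue)"
      using i by (simp add: inner_diff_left)
    ultimately show "norm ((\<integral>x. w n x \<bullet> V x \<partial>lebesgue) - (\<integral>x. w0 x \<bullet> V x \<partial>lebesgue)) < e"
      by (simp add: abs_minus_commute)
  qed
qed

text \<open>
  Completeness of \<open>L\<^sup>p\<close> along fast sequences: \<open>\<Sum>\<^sub>n 2\<^bsup>n p\<^esup> |f\<^sub>n\<^sub>+\<^sub>1 - f\<^sub>n|\<^sup>p\<close> is integrable, hence finite almost
  everywhere, and there the increments are at most a constant times \<open>2\<^bsup>-n\<^esup>\<close>.
\<close>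
lemma Lp_fast_Cauchy_limit:
  fixes f :: "nat \<Rightarrow> 'a::euclidean_space \<Rightarrow> 'b::euclidean_space"
  assumes f [measurable]: "\<And>n. f n \<in> borel_measurable lborel" and p: "0 < p" and c: "0 \<le> c"
    and cauchy: "\<And>n m. n \<le> m \<Longrightarrow> Lp_mass p (\<lambda>x. f m x - f n x) \<le> ennreal (c * (4 powr (- real n)) powr p)"
  obtains H where "H \<in> borel_measurable lborel" "\<And>n. Lp_mass p (\<lambda>x. H x - f n x) \<le> ennreal (c * (4 powr (- real n)) powr p)"
proof -
  define H where "H = (\<lambda>x. lim (\<lambda>n. f n x))"
  have [measurable]: "H \<in> borel_measurable lborel" unfolding H_def by (rule borel_measurable_lim_metric) (rule f)
  let ?t = "\<lambda>n x. ennreal ((2 powr real n) powr p) * ennreal (norm (f (Suc n) x - f n x) powr p)"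
  have r: "(2 powr real n) powr p * (4 powr (- real n)) powr p = (2 powr (- p)) ^ n" for n
  proof -
    have "(2 powr real n) powr p * (4 powr (- real n)) powr p = (2 powr real n * 4 powr (- real n)) powr p"
      by (simp add: powr_mult)
    also have "2 powr real n * 4 powr (- real n) = (2::real) powr (- real n)"
    proof -
      have "(4::real) powr (- real n) = (2 powr 2) powr (- real n)" by simp
      also have "\<dots> = 2 powr (2 * - real n)" by (rule powr_powr)
      finally show ?thesis by (simp add: powr_add[symmetric])
    qed
    also have "(2 powr (- real n)) powr p = (2::real) powr (- p * real n)" by (simp add: powr_powr mult.commute)
    also have "\<dots> = (2 powr (- p)) powr real n" by (rule powr_powr [symmetric])
    also have "\<dots> = (2 powr (- p)) ^ n" by (rule powr_realpow) simp
    finally show ?thesis .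
  qed
  have "(\<integral>\<^sup>+x. (\<Sum>n. ?t n x) \<partial>lborel) = (\<Sum>n. \<integral>\<^sup>+x. ?t n x \<partial>lborel)"
    by (rule nn_integral_suminf) measurable
  also have "\<dots> \<le> (\<Sum>n. ennreal (c * (2 powr (- p)) ^ n))"
  proof (rule suminf_le)
    fix n
    have "(\<integral>\<^sup>+x. ?t n x \<partial>lborel) = ennreal ((2 powr real n) powr p) * Lp_mass p (\<lambda>x. f (Suc n) x - f n x)"
      unfolding Lp_mass_lborel by (rule nn_integral_cmult) measurable
    also have "\<dots> \<le> ennreal ((2 powr real n) powr p) * ennreal (c * (4 powr (- real n)) powr p)"
      by (intro mult_left_mono cauchy) auto
    also have "\<dots> = ennreal (c * ((2 powr real n) powr p * (4 powr (- real n)) powr p))"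
      by (subst ennreal_mult' [symmetric]) (auto simp: mult_ac)
    finally show "(\<integral>\<^sup>+x. ?t n x \<partial>lborel) \<le> ennreal (c * (2 powr (- p)) ^ n)" unfolding r .
  qed auto
  also have "\<dots> < \<infinity>"
  proof -
    have "(2::real) powr (- p) < 2 powr 0" using p by (intro powr_less_mono) auto
    hence "summable (\<lambda>n. c * ((2::real) powr (- p)) ^ n)" by (intro summable_mult summable_geometric) auto
    thus ?thesis using c by (subst suminf_ennreal_eq[OF _ summable_sums]) auto
  qed
  finally have "AE x in lborel. (\<Sum>n. ?t n x) \<noteq> \<infinity>"
    by (intro nn_integral_PInf_AE) auto
  hence conv: "AE x in lborel. (\<lambda>n. f n x) \<longlonglongrightarrow> H x"
  proof eventually_elim
    fix x assume fin: "(\<Sum>n. ?t n x) \<noteq> \<infinity>"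
    then obtain b where b: "0 \<le> b" "(\<Sum>n. ?t n x) = ennreal b" by (cases "\<Sum>n. ?t n x") auto
    have "norm (f (Suc n) x - f n x) \<le> b powr (1 / p) * (1 / 2) ^ n" for n
    proof -
      have "?t n x \<le> (\<Sum>n. ?t n x)" using sum_le_suminf[of "\<lambda>n. ?t n x" "{n}"] by simp
      hence "((2 powr real n) powr p) * norm (f (Suc n) x - f n x) powr p \<le> b"
        unfolding b using b(1) by (subst (asm) ennreal_mult' [symmetric]) (auto simp: ennreal_le_iff)
      hence "(2 powr real n * norm (f (Suc n) x - f n x)) powr p \<le> b" by (simp add: powr_mult)
      hence "((2 powr real n * norm (f (Suc n) x - f n x)) powr p) powr (1 / p) \<le> b powr (1 / p)"
        using p by (intro powr_mono2) auto
      hence "2 powr real n * norm (f (Suc n) x - f n x) \<le> b powr (1 / p)"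
        using p by (simp add: powr_powr)
      thus ?thesis by (simp add: powr_realpow field_simps)
    qed
    hence "summable (\<lambda>n. f (Suc n) x - f n x)"
      by (intro summable_comparison_test'[OF summable_mult[OF summable_geometric]]) auto
    hence "convergent (\<lambda>n. (\<Sum>i<n. f (Suc i) x - f i x) + f 0 x)"
      by (intro convergent_add convergent_const) (simp add: summable_iff_convergent)
    moreover have "(\<Sum>i<n. f (Suc i) x - f i x) + f 0 x = f n x" for n
      using sum_lessThan_telescope[of "\<lambda>n. f n x" n] by simp
    ultimately have "convergent (\<lambda>n. f n x)" by simp
    thus "(\<lambda>n. f n x) \<longlonglongrightarrow> H x" by (simp add: H_def convergent_LIMSEQ_iff)
  qed
  have "Lp_mass p (\<lambda>x. H x - f n x) \<le> ennreal (c * (4 powr (- real n)) powr p)" for n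
  proof -
    have "Lp_mass p (\<lambda>x. H x - f n x) = (\<integral>\<^sup>+x. liminf (\<lambda>m. ennreal (norm (f m x - f n x) powr p)) \<partial>lborel)"
      unfolding Lp_mass_lborel
      using conv
    proof (intro nn_integral_cong_AE, eventually_elim)
      fix x assume "(\<lambda>n. f n x) \<longlonglongrightarrow> H x"
      hence "(\<lambda>m. ennreal (norm (f m x - f n x) powr p)) \<longlonglongrightarrow> ennreal (norm (H x - f n x) powr p)"
        using p by (intro tendsto_ennrealI tendsto_powr2 tendsto_intros) auto
      thus "ennreal (norm (H x - f n x) powr p) = liminf (\<lambda>m. ennreal (norm (f m x - f n x) powr p))"
        by (rule lim_imp_Liminf[OF trivial_limit_sequentially, symmetric])
    qed
    also have "\<dots> \<le> liminf (\<lambda>m. \<integral>\<^sup>+x. ennreal (norm (f m x - f n x) powr p) \<partial>lborel)"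
      by (rule nn_integral_liminf) measurable
    also have "\<dots> \<le> ennreal (c * (4 powr (- real n)) powr p)"
    proof -
      have "liminf (\<lambda>m. \<integral>\<^sup>+x. ennreal (norm (f m x - f n x) powr p) \<partial>lborel) \<le> liminf (\<lambda>m. ennreal (c * (4 powr (- real n)) powr p))"
        using cauchy[of n] unfolding Lp_mass_lborel
        by (intro Liminf_mono eventually_sequentiallyI[of n]) auto
      thus ?thesis by (simp add: Liminf_const)
    qed
    finally show ?thesis .
  qed
  thus ?thesis using that[of H] by simp
qed

section \<open>Weak fractional gradients of functions in Lebesgue spaces\<close>

lemma Cc_infinity_C0_ball:
  assumes "\<Phi> \<in> Cc_infinity \<Omega>"
  obtains R where "C0_ball R \<Phi>"
proof -
  have "bounded (closure {x. \<Phi> x \<noteq> 0})" using assms by (simp add: Cc_infinity_def compact_imp_bounded)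
  then obtain R where R: "0 < R" "closure {x. \<Phi> x \<noteq> 0} \<subseteq> ball 0 R" using bounded_subset_ballD by blast
  have "\<Phi> x = 0" if "R \<le> norm x" for x
  proof (rule ccontr)
    assume "\<Phi> x \<noteq> 0"
    hence "x \<in> ball 0 R" using R(2) closure_subset[of "{x. \<Phi> x \<noteq> 0}"] by blast
    thus False using that by simp
  qed
  moreover have "continuous_on UNIV \<Phi>" using assms Ck_imp_continuous[of 0 \<Phi>] by (simp only: Cc_infinity_def mem_Collect_eq)
  ultimately show ?thesis using that[of R] by (simp add: C0_ball_def)
qed

lemma C0_ball_Lp:
  fixes f :: "'a::euclidean_space \<Rightarrow> 'b::euclidean_space"
  assumes f: "C0_ball R f" and p: "0 < p"
  shows "f \<in> Lp p"
proof -
  obtain B where B: "0 \<le> B" "\<And>x. norm (f x) \<le> B" using C0_ball_bounded[OF f] by metis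
  have "Lp_mass p f \<le> (\<integral>\<^sup>+x. ennreal (B powr p) * indicator (cball (0::'a) R) x \<partial>lborel)"
    unfolding Lp_mass_lborel
  proof (rule nn_integral_mono)
    fix x
    show "ennreal (norm (f x) powr p) \<le> ennreal (B powr p) * indicator (cball 0 R) x"
    proof (cases "norm x \<le> R")
      case True
      thus ?thesis using B(2)[of x] p by (auto intro!: ennreal_leI powr_mono2)
    next
      case False
      thus ?thesis using f by (simp add: C0_ball_def)
    qed
  qed
  also have "\<dots> < \<infinity>" by (rule nn_integral_cball_finite)
  finally show ?thesis
    using C0_ball_measurable[OF f] by (auto simp: Lp_iff_mass intro: measurable_completion)
qed

lemma Cc_infinity_Lp:
  assumes "\<Phi> \<in> Cc_infinity \<Omega>" "0 < p"
  shows "\<Phi> \<in> Lp p"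
  using Cc_infinity_C0_ball[OF assms(1)] C0_ball_Lp assms(2) by metis

lemma test_frac_grad_Lp:
  assumes "\<phi> \<in> Cc_infinity \<Omega>" "0 < s" "s \<le> 1" "1 < p"
  shows "test_frac_grad s \<phi> \<in> Lp p"
  using test_frac_grad_nn_integral_powr[OF assms] test_frac_grad_measurable[OF assms(1-3)]
  by (auto simp: Lp_iff_mass Lp_mass_lborel intro!: measurable_completion)

lemma Lp_add:
  assumes "f \<in> Lp p" "g \<in> Lp p" "0 \<le> p"
  shows "(\<lambda>x. f x + g x) \<in> Lp p"
proof -
  have "(\<lambda>x. - g x) \<in> Lp p" using assms(2) by (auto simp: Lp_def)
  from Lp_diff[OF assms(1) this assms(3)] show ?thesis by simp
qed

lemma Lp_sum:
  assumes "finite S" "\<And>i. i \<in> S \<Longrightarrow> f i \<in> Lp p" "0 < p"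
  shows "(\<lambda>x. \<Sum>i\<in>S. f i x) \<in> Lp p"
  using assms(1,2)
proof (induction S rule: finite_induct)
  case empty
  thus ?case using assms(3) by (simp add: Lp_def)
next
  case (insert i S)
  thus ?case using assms(3) by (simp add: Lp_add)
qed

lemma Lp_inner_Basis:
  assumes "f \<in> Lp p" "j \<in> Basis" "0 < p"
  shows "(\<lambda>x. f x \<bullet> j) \<in> Lp p"
proof -
  have "Lp_mass p (\<lambda>x. f x \<bullet> j) \<le> Lp_mass p f"
    unfolding Lp_mass_def using assms
    by (intro nn_integral_mono ennreal_leI powr_mono2) (auto simp: Basis_le_norm)
  thus ?thesis using assms by (auto simp: Lp_iff_mass intro: le_less_trans)
qed

lemma test_frac_div_Lp:
  fixes \<Phi> :: "'a::euclidean_space \<Rightarrow> 'a"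
  assumes "\<Phi> \<in> Cc_infinity UNIV" "0 < s" "s \<le> 1" "1 < p"
  shows "test_frac_div s \<Phi> \<in> Lp p"
  unfolding test_frac_div_def[abs_def] using assms
  by (intro Lp_sum Lp_inner_Basis test_frac_grad_Lp[OF Cc_infinity_inner]) auto

lemma conjugate_exponent:
  assumes "1 < (p::real)"
  obtains q where "1 < q" "1 / p + 1 / q = 1"
proof -
  have "1 < p / (p - 1)" "1 / p + 1 / (p / (p - 1)) = 1"
    using assms by (simp_all add: less_divide_eq diff_divide_distrib)
  thus ?thesis using that by blast
qed

lemma L1_loc_pairing_integrable:
  assumes G: "G \<in> L1_loc" and \<Phi>: "\<Phi> \<in> Cc_infinity UNIV"
  shows "integrable lebesgue (\<lambda>x. G x \<bullet> \<Phi> x)"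
proof -
  obtain R where cs: "C0_ball R \<Phi>" using Cc_infinity_C0_ball[OF \<Phi>] by metis
  obtain B where B: "0 \<le> B" "\<And>x. norm (\<Phi> x) \<le> B" using C0_ball_bounded[OF cs] by metis
  have m: "\<Phi> \<in> borel_measurable lebesgue" "G \<in> borel_measurable lebesgue"
    using C0_ball_measurable[OF cs] L1_loc_measurable[OF G] by (auto intro: measurable_completion)
  have "set_integrable lebesgue (cball 0 R) G" using G by (simp add: L1_loc_def)
  hence "integrable lebesgue (\<lambda>x. B *\<^sub>R (indicat_real (cball 0 R) x *\<^sub>R G x))"
    unfolding set_integrable_def by (rule integrable_scaleR_right)
  thus ?thesis
  proof (rule Bochner_Integration.integrable_bound)
    show "(\<lambda>x. G x \<bullet> \<Phi> x) \<in> borel_measurable lebesgue" using m by (intro borel_measurable_inner)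
    show "AE x in lebesgue. norm (G x \<bullet> \<Phi> x) \<le> norm (B *\<^sub>R (indicat_real (cball 0 R) x *\<^sub>R G x))"
    proof (rule AE_I2)
      fix x
      show "norm (G x \<bullet> \<Phi> x) \<le> norm (B *\<^sub>R (indicat_real (cball 0 R) x *\<^sub>R G x))"
      proof (cases "norm x \<le> R")
        case True
        have "norm (G x \<bullet> \<Phi> x) \<le> norm (G x) * norm (\<Phi> x)" unfolding real_norm_def by (rule Cauchy_Schwarz_ineq2)
        also have "\<dots> \<le> norm (G x) * B" using B by (intro mult_left_mono) auto
        finally show ?thesis using True B by (simp add: mult.commute)
      next
        case False
        thus ?thesis using cs by (simp add: C0_ball_def)
      qed
    qed
  qed
qed

lemma test_has_weak_frac_grad:
  fixes \<phi> :: "'a::euclidean_space \<Rightarrow> real"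
  assumes \<phi>: "\<phi> \<in> Cc_infinity \<Omega>" and s: "0 < s" "s \<le> 1"
  shows "has_weak_frac_grad s \<phi> (test_frac_grad s \<phi>)"
  unfolding has_weak_frac_grad_def
proof (intro conjI ballI)
  show "test_frac_grad s \<phi> \<in> L1_loc"
    using test_frac_grad_Lp[OF \<phi> s, of 2] by (rule Lp_subset_L1_loc) auto
  fix \<Phi> :: "'a \<Rightarrow> 'a" assume \<Phi>: "\<Phi> \<in> Cc_infinity UNIV"
  have \<phi>': "\<phi> \<in> Cc_infinity UNIV" using Cc_infinity_mono[OF \<phi>] by simp
  have \<Phi>j: "(\<lambda>y. \<Phi> y \<bullet> j) \<in> Cc_infinity UNIV" for j by (rule Cc_infinity_inner[OF \<Phi>])
  have m: "\<phi> \<in> borel_measurable lborel" "(\<lambda>y. \<Phi> y \<bullet> j) \<in> borel_measurable lborel" for j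
    using Cc_infinity_integrable[OF \<phi>'] Cc_infinity_integrable[OF \<Phi>j] by blast+
  have mF: "test_frac_grad s \<phi> \<in> borel_measurable lborel" "test_frac_grad s (\<lambda>y. \<Phi> y \<bullet> j) \<in> borel_measurable lborel" for j
    using test_frac_grad_measurable[OF \<phi> s] test_frac_grad_measurable[OF \<Phi>j s] by auto
  have mprod: "(\<lambda>x. (test_frac_grad s \<phi> x \<bullet> j) * (\<Phi> x \<bullet> j)) \<in> borel_measurable lborel" for j
    by (rule borel_measurable_times[OF borel_measurable_inner[OF mF(1) borel_measurable_const] m(2)])
  have mprod': "(\<lambda>x. \<phi> x * (test_frac_grad s (\<lambda>y. \<Phi> y \<bullet> j) x \<bullet> j)) \<in> borel_measurable lborel" for j
    by (rule borel_measurable_times[OF m(1) borel_measurable_inner[OF mF(2) borel_measurable_const]])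
  have int1: "integrable lebesgue (\<lambda>x. \<phi> x * (test_frac_grad s (\<lambda>y. \<Phi> y \<bullet> j) x \<bullet> j))" if "j \<in> Basis" for j
    using pairing_integrable[OF Cc_infinity_Lp[OF \<phi>, of 2] Lp_inner_Basis[OF test_frac_grad_Lp[OF \<Phi>j s, of 2] that]] by simp
  have int2: "integrable lebesgue (\<lambda>x. (test_frac_grad s \<phi> x \<bullet> j) * (\<Phi> x \<bullet> j))" if "j \<in> Basis" for j
    using pairing_integrable[OF Lp_inner_Basis[OF test_frac_grad_Lp[OF \<phi> s, of 2] that] Cc_infinity_Lp[OF \<Phi>j, of 2]] by simp
  have "(LINT x|lebesgue. \<phi> x * test_frac_div s \<Phi> x) = (\<Sum>j\<in>Basis. LINT x|lebesgue. \<phi> x * (test_frac_grad s (\<lambda>y. \<Phi> y \<bullet> j) x \<bullet> j))"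
    unfolding test_frac_div_def sum_distrib_left by (rule Bochner_Integration.integral_sum[OF int1])
  also have "\<dots> = (\<Sum>j\<in>Basis. - (LINT x|lebesgue. (test_frac_grad s \<phi> x \<bullet> j) * (\<Phi> x \<bullet> j)))"
  proof (rule sum.cong[OF refl])
    fix j :: 'a assume j: "j \<in> Basis"
    have "(LINT x|lebesgue. \<phi> x * (test_frac_grad s (\<lambda>y. \<Phi> y \<bullet> j) x \<bullet> j)) = (LINT x|lborel. \<phi> x * (test_frac_grad s (\<lambda>y. \<Phi> y \<bullet> j) x \<bullet> j))"
      by (rule integral_completion[OF mprod'])
    also have "\<dots> = - (LINT x|lborel. (test_frac_grad s \<phi> x \<bullet> j) * (\<Phi> x \<bullet> j))"
      by (rule frac_grad_integration_by_parts[OF \<phi>' \<Phi>j s j])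
    also have "(LINT x|lborel. (test_frac_grad s \<phi> x \<bullet> j) * (\<Phi> x \<bullet> j)) = (LINT x|lebesgue. (test_frac_grad s \<phi> x \<bullet> j) * (\<Phi> x \<bullet> j))"
      by (rule integral_completion[OF mprod, symmetric])
    finally show "(LINT x|lebesgue. \<phi> x * (test_frac_grad s (\<lambda>y. \<Phi> y \<bullet> j) x \<bullet> j)) = - (LINT x|lebesgue. (test_frac_grad s \<phi> x \<bullet> j) * (\<Phi> x \<bullet> j))" .
  qed
  also have "\<dots> = - (LINT x|lebesgue. (\<Sum>j\<in>Basis. (test_frac_grad s \<phi> x \<bullet> j) * (\<Phi> x \<bullet> j)))"
    by (subst Bochner_Integration.integral_sum[OF int2]) (auto simp: sum_negf)
  also have "\<dots> = - (LINT x|lebesgue. test_frac_grad s \<phi> x \<bullet> \<Phi> x)"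
    by (rule arg_cong[where f=uminus], rule Bochner_Integration.integral_cong[OF refl], rule euclidean_inner[symmetric])
  finally show "(LINT x|lebesgue. \<phi> x * test_frac_div s \<Phi> x) = - (LINT x|lebesgue. test_frac_grad s \<phi> x \<bullet> \<Phi> x)" .
qed

lemma L1_loc_diff:
  assumes "F \<in> L1_loc" "G \<in> L1_loc"
  shows "(\<lambda>x. F x - G x) \<in> L1_loc"
  using assms by (auto simp: L1_loc_def intro!: set_integral_diff)

lemma has_weak_frac_grad_diff:
  assumes u: "u \<in> Lp p" "has_weak_frac_grad s u G" and w: "w \<in> Lp p" "has_weak_frac_grad s w F"
    and s: "0 < s" "s \<le> 1" and p: "1 < p"
  shows "has_weak_frac_grad s (\<lambda>x. u x - w x) (\<lambda>x. G x - F x)"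
  unfolding has_weak_frac_grad_def
proof (intro conjI ballI)
  have loc: "G \<in> L1_loc" "F \<in> L1_loc" using u w by (auto simp: has_weak_frac_grad_def)
  show "(\<lambda>x. G x - F x) \<in> L1_loc" by (rule L1_loc_diff[OF loc])
  fix \<Phi> :: "'a \<Rightarrow> 'a" assume \<Phi>: "\<Phi> \<in> Cc_infinity UNIV"
  obtain q where q: "1 < q" "1 / p + 1 / q = 1" using conjugate_exponent[OF p] by metis
  have V: "test_frac_div s \<Phi> \<in> Lp q" by (rule test_frac_div_Lp[OF \<Phi> s q(1)])
  have i: "integrable lebesgue (\<lambda>x. u x * test_frac_div s \<Phi> x)" "integrable lebesgue (\<lambda>x. w x * test_frac_div s \<Phi> x)"
    using pairing_integrable[OF u(1) V p q] pairing_integrable[OF w(1) V p q] by simp_all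
  note j = L1_loc_pairing_integrable[OF loc(1) \<Phi>] L1_loc_pairing_integrable[OF loc(2) \<Phi>]
  have e: "(LINT x|lebesgue. u x * test_frac_div s \<Phi> x) = - (LINT x|lebesgue. G x \<bullet> \<Phi> x)"
    "(LINT x|lebesgue. w x * test_frac_div s \<Phi> x) = - (LINT x|lebesgue. F x \<bullet> \<Phi> x)"
    using u(2) w(2) \<Phi> by (auto simp: has_weak_frac_grad_def)
  show "(LINT x|lebesgue. (u x - w x) * test_frac_div s \<Phi> x) = - (LINT x|lebesgue. (G x - F x) \<bullet> \<Phi> x)"
    using i j e by (simp add: left_diff_distrib inner_diff_left)
qed

lemma has_weak_frac_grad_unique:
  assumes "has_weak_frac_grad s u G" "has_weak_frac_grad s u F"
  shows "AE x in lebesgue. F x = G x"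
proof -
  have loc: "G \<in> L1_loc" "F \<in> L1_loc" using assms by (auto simp: has_weak_frac_grad_def)
  have "AE x in lebesgue. F x - G x = 0"
  proof (rule fundamental_lemma[OF L1_loc_diff[OF loc(2,1)]])
    fix \<Phi> :: "'a \<Rightarrow> 'a" assume \<Phi>: "\<Phi> \<in> Cc_infinity UNIV"
    note j = L1_loc_pairing_integrable[OF loc(1) \<Phi>] L1_loc_pairing_integrable[OF loc(2) \<Phi>]
    have "- (LINT x|lebesgue. G x \<bullet> \<Phi> x) = - (LINT x|lebesgue. F x \<bullet> \<Phi> x)"
      using assms \<Phi> unfolding has_weak_frac_grad_def by metis
    thus "(LINT x|lebesgue. (F x - G x) \<bullet> \<Phi> x) = 0" using j by (simp add: inner_diff_left)
  qed
  thus ?thesis by eventually_elim simp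
qed

lemma frac_grad_works:
  assumes "has_weak_frac_grad s u G"
  shows "has_weak_frac_grad s u (frac_grad s u)" "AE x in lebesgue. frac_grad s u x = G x"
proof -
  show "has_weak_frac_grad s u (frac_grad s u)" unfolding frac_grad_def by (rule someI[of "has_weak_frac_grad s u", OF assms])
  thus "AE x in lebesgue. frac_grad s u x = G x" by (rule has_weak_frac_grad_unique[OF assms])
qed

lemma frac_grad_mass:
  assumes "has_weak_frac_grad s u G"
  shows "Lp_mass p (frac_grad s u) = Lp_mass p G"
  by (rule Lp_mass_cong_AE[OF frac_grad_works(2)[OF assms]])

lemma frac_grad_Lp:
  assumes "has_weak_frac_grad s u G" "Lp_mass p G < \<infinity>"
  shows "frac_grad s u \<in> Lp p"
  using frac_grad_works(1)[OF assms(1)] assms(2) frac_grad_mass[OF assms(1)]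
  by (auto simp: Lp_iff_mass has_weak_frac_grad_def intro: L1_loc_measurable)

section \<open>Passing to the closure\<close>

text \<open>
  The representative chosen in \<open>frac_grad\<close> agrees with \<open>G\<close> almost everywhere, so smallness of the norm
  can be expressed through \<open>G\<close>.
\<close>
lemma Lam_norm_mass:
  assumes "w \<in> Lp p" "has_weak_frac_grad s w G" "Lp_mass p G < \<infinity>" and p: "1 < p" and e: "0 < e"
  shows "Lam_norm s p w < e \<Longrightarrow> Lp_mass p w \<le> ennreal (e powr p)"
    and "Lam_norm s p w < e \<Longrightarrow> Lp_mass p G \<le> ennreal (e powr p)"
    and "0 \<le> \<eta> \<Longrightarrow> 2 * \<eta> < e powr p \<Longrightarrow> Lp_mass p w \<le> ennreal \<eta> \<Longrightarrow> Lp_mass p G \<le> ennreal \<eta> \<Longrightarrow> Lam_norm s p w < e"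
proof -
  define a where "a = Lp_norm p w powr p"
  define b where "b = Lp_norm p (frac_grad s w) powr p"
  have ab: "0 \<le> a" "0 \<le> b" by (simp_all add: a_def b_def)
  have mass: "Lp_mass p w = ennreal a" "Lp_mass p G = ennreal b"
    using Lp_norm_powr[OF assms(1)] Lp_norm_powr[OF frac_grad_Lp[OF assms(2,3)]] frac_grad_mass[OF assms(2), of p] p
    by (simp_all add: a_def b_def)
  have eq: "Lam_norm s p w < e \<longleftrightarrow> a + b < e powr p"
  proof -
    have L: "Lam_norm s p w = (a + b) powr (1 / p)" by (simp add: Lam_norm_def a_def b_def)
    have "((a + b) powr (1 / p)) powr p = a + b" using ab p by (simp add: powr_powr)
    moreover have "(e powr p) powr (1 / p) = e" using e p by (simp add: powr_powr)
    ultimately show ?thesis unfolding L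
      using powr_less_mono2[of p "(a + b) powr (1 / p)" e] powr_less_mono2[of "1 / p" "a + b" "e powr p"] ab p e by auto
  qed
  show "Lam_norm s p w < e \<Longrightarrow> Lp_mass p w \<le> ennreal (e powr p)" "Lam_norm s p w < e \<Longrightarrow> Lp_mass p G \<le> ennreal (e powr p)"
    unfolding eq mass using ab by (auto intro!: ennreal_leI)
  show "0 \<le> \<eta> \<Longrightarrow> 2 * \<eta> < e powr p \<Longrightarrow> Lp_mass p w \<le> ennreal \<eta> \<Longrightarrow> Lp_mass p G \<le> ennreal \<eta> \<Longrightarrow> Lam_norm s p w < e"
    unfolding eq mass by simp
qed

text \<open>
  Let \<open>\<phi>\<^sub>n\<close> be test functions that approximate \<open>u\<close> in the norm of order \<open>s\<close>.  By the comparison, applied to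
  \<open>\<phi>\<^sub>m - \<phi>\<^sub>n\<close>, the gradients \<open>D\<^sup>t\<phi>\<^sub>n\<close> form a fast Cauchy sequence.  Their limit \<open>H\<close> is a weak gradient of \<open>u\<close>,
  because both sides of the defining relation pass to the limit.  The factor \<open>4\<close> is the price of
  using \<open>|a + b|\<^sup>p \<le> 2\<^sup>p (|a|\<^sup>p + |b|\<^sup>p)\<close> twice.
\<close>
lemma Lam0_transfer:
  fixes \<Omega> :: "'a::euclidean_space set"
  assumes \<Omega>: "\<Omega> \<subseteq> ball 0 R" and p: "1 < p" and st: "0 < t" "t < s" "s \<le> 1" and C: "0 < C"
    and comparison: "\<And>(\<phi> :: 'a \<Rightarrow> real) Y. \<phi> \<in> Cc_infinity (ball 0 R) \<Longrightarrow> 0 \<le> Y \<Longrightarrow>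
      Lp_mass p (test_frac_grad s \<phi>) \<le> ennreal (Y powr p) \<Longrightarrow> Lp_mass p (test_frac_grad t \<phi>) \<le> ennreal ((C * Y) powr p)"
    and u: "u \<in> Lam0 s p \<Omega>"
  shows "u \<in> Lam0 t p \<Omega>" and "Lp_norm p (frac_grad t u) \<le> 4 * C * Lp_norm p (frac_grad s u)"
proof -
  have s: "0 < s" "s \<le> 1" and t: "0 < t" "t \<le> 1" using st by auto
  have p0: "0 < p" "0 \<le> p" using p by auto
  define G where "G = frac_grad s u"
  have uLp: "u \<in> Lp p" and GLp: "G \<in> Lp p" using u by (auto simp: Lam0_def Lam_def G_def)
  have weakG: "has_weak_frac_grad s u G"
    using u frac_grad_works(1) unfolding G_def Lam0_def Lam_def by blast
  define \<epsilon> where "\<epsilon> = (\<lambda>n::nat. (4::real) powr (- real n))"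
  have \<epsilon>: "0 < \<epsilon> n" for n by (simp add: \<epsilon>_def)
  have "\<forall>n. \<exists>\<phi>\<in>Cc_infinity \<Omega>. Lam_norm s p (\<lambda>x. u x - \<phi> x) < \<epsilon> n"
    using u \<epsilon> by (auto simp: Lam0_def)
  then obtain \<phi> where \<phi>: "\<And>n. \<phi> n \<in> Cc_infinity \<Omega>" and close: "\<And>n. Lam_norm s p (\<lambda>x. u x - \<phi> n x) < \<epsilon> n"
    by metis
  have \<phi>R: "\<phi> n \<in> Cc_infinity (ball 0 R)" for n by (rule Cc_infinity_mono[OF \<phi> \<Omega>])
  have \<phi>Lp: "\<phi> n \<in> Lp p" for n by (rule Cc_infinity_Lp[OF \<phi> p0(1)])
  define F where "F = (\<lambda>n. test_frac_grad s (\<phi> n))"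
  define D where "D = (\<lambda>n. test_frac_grad t (\<phi> n))"
  have FLp: "F n \<in> Lp p" and DLp: "D n \<in> Lp p" for n
    unfolding F_def D_def using test_frac_grad_Lp[OF \<phi> _ _ p] s t by auto
  have weakF: "has_weak_frac_grad s (\<phi> n) (F n)" and weakD: "has_weak_frac_grad t (\<phi> n) (D n)" for n
    unfolding F_def D_def using test_has_weak_frac_grad[OF \<phi>] s t by auto
  have meas: "u \<in> borel_measurable lebesgue" "G \<in> borel_measurable lebesgue" "F n \<in> borel_measurable lebesgue" "D n \<in> borel_measurable lebesgue" for n
    using uLp GLp FLp DLp by (auto simp: Lp_iff_mass)
  have weak_diff: "has_weak_frac_grad s (\<lambda>x. u x - \<phi> n x) (\<lambda>x. G x - F n x)" for n
    by (rule has_weak_frac_grad_diff[OF uLp weakG \<phi>Lp weakF s p])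
  have GF: "Lp_mass p (\<lambda>x. G x - F n x) < \<infinity>" for n using Lp_diff[OF GLp FLp p0(2)] by (simp add: Lp_iff_mass)
  have mass_u: "Lp_mass p (\<lambda>x. u x - \<phi> n x) \<le> ennreal (\<epsilon> n powr p)" for n
    by (rule Lam_norm_mass(1)[OF Lp_diff[OF uLp \<phi>Lp p0(2)] weak_diff GF p \<epsilon> close])
  have mass_G: "Lp_mass p (\<lambda>x. G x - F n x) \<le> ennreal (\<epsilon> n powr p)" for n
    by (rule Lam_norm_mass(2)[OF Lp_diff[OF uLp \<phi>Lp p0(2)] weak_diff GF p \<epsilon> close])
  define c where "c = C powr p * (2 powr p * 2)"
  have c: "0 \<le> c" by (simp add: c_def)
  have "Lp_mass p (\<lambda>x. D m x - D n x) \<le> ennreal (c * (4 powr (- real n)) powr p)" if nm: "n \<le> m" for n m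
  proof -
    define Y where "Y = (2 powr p * 2) powr (1 / p) * \<epsilon> n"
    have Y: "0 \<le> Y" using \<epsilon>[of n] by (simp add: Y_def)
    have Yp: "Y powr p = 2 powr p * 2 * \<epsilon> n powr p"
      using \<epsilon>[of n] p by (simp add: Y_def powr_mult powr_powr)
    have \<psi>: "(\<lambda>x. \<phi> m x - \<phi> n x) \<in> Cc_infinity (ball 0 R)" by (rule Cc_infinity_diff[OF \<phi>R \<phi>R])
    have "Lp_mass p (test_frac_grad s (\<lambda>x. \<phi> m x - \<phi> n x)) = Lp_mass p (\<lambda>x. (G x - F n x) - (G x - F m x))"
      by (simp add: Lp_mass_def F_def test_frac_grad_diff[OF \<phi> \<phi> s])
    also have "\<dots> \<le> ennreal (2 powr p) * (Lp_mass p (\<lambda>x. G x - F n x) + Lp_mass p (\<lambda>x. G x - F m x))"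
      using meas p by (intro Lp_mass_diff_le) auto
    also have "\<dots> \<le> ennreal (2 powr p) * (ennreal (\<epsilon> n powr p) + ennreal (\<epsilon> n powr p))"
    proof (intro mult_left_mono add_mono mass_G)
      have "\<epsilon> m \<le> \<epsilon> n" unfolding \<epsilon>_def using nm by (intro powr_mono) auto
      hence "\<epsilon> m powr p \<le> \<epsilon> n powr p" using \<epsilon>[of m] p by (intro powr_mono2) auto
      thus "Lp_mass p (\<lambda>x. G x - F m x) \<le> ennreal (\<epsilon> n powr p)" using mass_G[of m] by (meson ennreal_leI order_trans)
    qed auto
    also have "\<dots> = ennreal (Y powr p)"
      unfolding Yp by (simp add: ennreal_mult' [symmetric] ennreal_plus [symmetric] del: ennreal_plus)
    finally have "Lp_mass p (test_frac_grad t (\<lambda>x. \<phi> m x - \<phi> n x)) \<le> ennreal ((C * Y) powr p)"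
      by (rule comparison[OF \<psi> Y])
    also have "(C * Y) powr p = c * (4 powr (- real n)) powr p"
      using C Y by (simp add: powr_mult Yp c_def \<epsilon>_def)
    finally show ?thesis by (simp add: Lp_mass_def D_def test_frac_grad_diff[OF \<phi> \<phi> t])
  qed
  moreover have "D n \<in> borel_measurable lborel" for n
    unfolding D_def using test_frac_grad_measurable[OF \<phi> t] by simp
  ultimately obtain H where "H \<in> borel_measurable lborel" and mass_H: "\<And>n. Lp_mass p (\<lambda>x. H x - D n x) \<le> ennreal (c * \<epsilon> n powr p)"
    using Lp_fast_Cauchy_limit[of D p c] p0 c unfolding \<epsilon>_def by metis
  hence Hm: "H \<in> borel_measurable lebesgue" by (intro measurable_completion)
  have \<epsilon>0: "(\<lambda>n. \<epsilon> n powr p) \<longlonglongrightarrow> 0"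
  proof -
    have "(\<lambda>n. ((1::real) / 4) ^ n) \<longlonglongrightarrow> 0" by (intro LIMSEQ_realpow_zero) auto
    moreover have "(1 / 4) ^ n = \<epsilon> n" for n
      by (simp add: \<epsilon>_def powr_minus powr_realpow power_one_over inverse_eq_divide)
    ultimately have "\<epsilon> \<longlonglongrightarrow> 0" by simp
    hence "(\<lambda>n. \<epsilon> n powr p) \<longlonglongrightarrow> 0 powr p"
      using p \<epsilon> by (intro tendsto_powr2 tendsto_const) (auto intro: less_imp_le always_eventually)
    thus ?thesis by simp
  qed
  have H_le: "Lp_mass p H \<le> ennreal (2 powr p) * (ennreal (c * \<epsilon> n powr p) + Lp_mass p (D n))" for n
  proof -
    have "Lp_mass p H \<le> ennreal (2 powr p) * (Lp_mass p (\<lambda>x. H x - D n x) + Lp_mass p (D n))"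
      by (rule Lp_mass_triangle[OF Hm meas(4) p0(2)])
    also have "\<dots> \<le> ennreal (2 powr p) * (ennreal (c * \<epsilon> n powr p) + Lp_mass p (D n))"
      by (intro mult_left_mono add_right_mono mass_H) auto
    finally show ?thesis .
  qed
  have HLp: "H \<in> Lp p"
  proof -
    have "Lp_mass p (D 0) < \<infinity>" using DLp[of 0] by (simp add: Lp_iff_mass)
    hence "ennreal (2 powr p) * (ennreal (c * \<epsilon> 0 powr p) + Lp_mass p (D 0)) < \<infinity>" by (auto simp: ennreal_mult_less_top)
    thus ?thesis using H_le[of 0] Hm by (auto simp: Lp_iff_mass intro: le_less_trans)
  qed
  have weakH: "has_weak_frac_grad t u H"
    unfolding has_weak_frac_grad_def
  proof (intro conjI ballI)
    show "H \<in> L1_loc" by (rule Lp_subset_L1_loc[OF HLp p])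
    fix \<Phi> :: "'a \<Rightarrow> 'a" assume \<Phi>: "\<Phi> \<in> Cc_infinity UNIV"
    obtain q where q: "1 < q" "1 / p + 1 / q = 1" using conjugate_exponent[OF p] by metis
    have c\<epsilon>: "(\<lambda>n. c * \<epsilon> n powr p) \<longlonglongrightarrow> 0" using tendsto_mult[OF tendsto_const[of c] \<epsilon>0] by simp
    have "(\<lambda>n. LINT x|lebesgue. \<phi> n x \<bullet> test_frac_div t \<Phi> x) \<longlonglongrightarrow> (LINT x|lebesgue. u x \<bullet> test_frac_div t \<Phi> x)"
      by (rule pairing_tendsto[OF \<phi>Lp uLp test_frac_div_Lp[OF \<Phi> t q(1)] p q mass_u \<epsilon>0])
    moreover have "(LINT x|lebesgue. \<phi> n x \<bullet> test_frac_div t \<Phi> x) = - (LINT x|lebesgue. D n x \<bullet> \<Phi> x)" for n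
      using weakD[of n] \<Phi> by (simp add: has_weak_frac_grad_def)
    moreover have "(\<lambda>n. - (LINT x|lebesgue. D n x \<bullet> \<Phi> x)) \<longlonglongrightarrow> - (LINT x|lebesgue. H x \<bullet> \<Phi> x)"
      using q by (intro tendsto_minus pairing_tendsto[OF DLp HLp Cc_infinity_Lp[OF \<Phi>] p q mass_H c\<epsilon>]) auto
    ultimately have "(LINT x|lebesgue. u x \<bullet> test_frac_div t \<Phi> x) = - (LINT x|lebesgue. H x \<bullet> \<Phi> x)"
      by (simp only:) (rule LIMSEQ_unique)
    thus "(LINT x|lebesgue. u x * test_frac_div t \<Phi> x) = - (LINT x|lebesgue. H x \<bullet> \<Phi> x)" by simp
  qed
  have Hfin: "Lp_mass p H < \<infinity>" using HLp by (simp add: Lp_iff_mass)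
  have Ht: "frac_grad t u \<in> Lp p" by (rule frac_grad_Lp[OF weakH Hfin])
  show "u \<in> Lam0 t p \<Omega>"
    unfolding Lam0_def Lam_def mem_Collect_eq
  proof (intro conjI allI impI)
    show "\<exists>G. has_weak_frac_grad t u G" using weakH by blast
    fix e :: real assume e: "0 < e"
    have lim: "(\<lambda>n. 2 * ((1 + c) * \<epsilon> n powr p)) \<longlonglongrightarrow> 2 * ((1 + c) * 0)" using \<epsilon>0 by (intro tendsto_intros)
    have "\<forall>\<^sub>F n in sequentially. 2 * ((1 + c) * \<epsilon> n powr p) < e powr p" using e by (intro order_tendstoD(2)[OF lim]) simp
    then obtain n where n: "2 * ((1 + c) * \<epsilon> n powr p) < e powr p" by (auto simp: eventually_sequentially)
    have le: "\<epsilon> n powr p \<le> (1 + c) * \<epsilon> n powr p" "c * \<epsilon> n powr p \<le> (1 + c) * \<epsilon> n powr p"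
      using c by (simp_all add: distrib_right)
    have "Lam_norm t p (\<lambda>x. u x - \<phi> n x) < e"
    proof (rule Lam_norm_mass(3)[OF Lp_diff[OF uLp \<phi>Lp p0(2)] has_weak_frac_grad_diff[OF uLp weakH \<phi>Lp weakD t p] _ p e _ n])
      show "Lp_mass p (\<lambda>x. H x - D n x) < \<infinity>" using Lp_diff[OF HLp DLp p0(2)] by (simp add: Lp_iff_mass)
      show "Lp_mass p (\<lambda>x. u x - \<phi> n x) \<le> ennreal ((1 + c) * \<epsilon> n powr p)"
        by (rule order_trans[OF mass_u ennreal_leI[OF le(1)]])
      show "Lp_mass p (\<lambda>x. H x - D n x) \<le> ennreal ((1 + c) * \<epsilon> n powr p)"
        by (rule order_trans[OF mass_H ennreal_leI[OF le(2)]])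
    qed (use c in simp)
    thus "\<exists>\<phi>\<in>Cc_infinity \<Omega>. Lam_norm t p (\<lambda>x. u x - \<phi> x) < e" using \<phi> by blast
  qed (fact uLp Ht)+
  define g where "g = Lp_norm p G"
  have g: "0 \<le> g" by (simp add: g_def Lp_norm_nonneg)
  have mg: "Lp_mass p G = ennreal (g powr p)" unfolding g_def by (rule Lp_norm_powr[OF GLp p0(1), symmetric])
  define h where "h = Lp_norm p H"
  have mh: "Lp_mass p H = ennreal (h powr p)" unfolding h_def by (rule Lp_norm_powr[OF HLp p0(1), symmetric])
  have bound: "h powr p \<le> 2 powr p * (c * \<epsilon> n powr p + C powr p * (2 powr p * (\<epsilon> n powr p + g powr p)))" for n
  proof -
    define Y where "Y = (2 powr p * (\<epsilon> n powr p + g powr p)) powr (1 / p)"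
    have Yp: "Y powr p = 2 powr p * (\<epsilon> n powr p + g powr p)" using p by (simp add: Y_def powr_powr)
    have "Lp_mass p (F n) \<le> ennreal (2 powr p) * (Lp_mass p (\<lambda>x. F n x - G x) + Lp_mass p G)"
      by (rule Lp_mass_triangle[OF meas(3,2) p0(2)])
    also have "Lp_mass p (\<lambda>x. F n x - G x) = Lp_mass p (\<lambda>x. G x - F n x)" by (simp add: Lp_mass_def norm_minus_commute)
    also have "ennreal (2 powr p) * (Lp_mass p (\<lambda>x. G x - F n x) + Lp_mass p G) \<le> ennreal (2 powr p) * (ennreal (\<epsilon> n powr p) + ennreal (g powr p))"
      unfolding mg by (intro mult_left_mono add_right_mono mass_G) auto
    also have "\<dots> = ennreal (Y powr p)"
      unfolding Yp by (simp add: ennreal_mult' [symmetric] ennreal_plus [symmetric] del: ennreal_plus)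
    finally have "Lp_mass p (D n) \<le> ennreal ((C * Y) powr p)"
      unfolding F_def D_def by (intro comparison[OF \<phi>R]) (auto simp: Y_def)
    also have "(C * Y) powr p = C powr p * (2 powr p * (\<epsilon> n powr p + g powr p))" unfolding Yp[symmetric] by (rule powr_mult)
    finally have "Lp_mass p H \<le> ennreal (2 powr p) * (ennreal (c * \<epsilon> n powr p) + ennreal (C powr p * (2 powr p * (\<epsilon> n powr p + g powr p))))"
      by (intro order_trans[OF H_le[of n]] mult_left_mono add_left_mono) auto
    also have "\<dots> = ennreal (2 powr p * (c * \<epsilon> n powr p + C powr p * (2 powr p * (\<epsilon> n powr p + g powr p))))"
      using c by (simp add: ennreal_mult' [symmetric] ennreal_plus [symmetric] del: ennreal_plus)
    finally show ?thesis unfolding mh using c by (subst (asm) ennreal_le_iff) auto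
  qed
  have "(\<lambda>n. 2 powr p * (c * \<epsilon> n powr p + C powr p * (2 powr p * (\<epsilon> n powr p + g powr p)))) \<longlonglongrightarrow>
      2 powr p * (c * 0 + C powr p * (2 powr p * (0 + g powr p)))"
    by (intro tendsto_mult tendsto_add tendsto_const \<epsilon>0)
  hence "h powr p \<le> 2 powr p * (c * 0 + C powr p * (2 powr p * (0 + g powr p)))"
    by (rule LIMSEQ_le_const) (use bound in blast)
  also have "\<dots> = (4 * C * g) powr p"
  proof -
    have "4 * C * g = 2 * (C * (2 * g))" by simp
    hence "(4 * C * g) powr p = (2 * (C * (2 * g))) powr p" by (simp only:)
    also have "\<dots> = 2 powr p * (C powr p * (2 powr p * g powr p))" by (simp only: powr_mult)
    finally show ?thesis by simp
  qed
  finally have "Lp_mass p (frac_grad t u) \<le> ennreal ((4 * C * g) powr p)"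
    unfolding frac_grad_mass[OF weakH] mh by (rule ennreal_leI)
  thus "Lp_norm p (frac_grad t u) \<le> 4 * C * Lp_norm p (frac_grad s u)"
    using Lp_norm_le_iff_mass[OF Ht p0(1)] C g unfolding g_def G_def by simp
qed

theorem corollary2p2:
  fixes \<Omega> :: "'a::euclidean_space set" and p :: real
  assumes "open \<Omega>" and "bounded \<Omega>" and "1 < p"
  shows "\<exists>C>0. \<forall>s t. 0 < t \<and> t < s \<and> s \<le> 1 \<longrightarrow>
           Lam0 s p \<Omega> \<subseteq> Lam0 t p \<Omega> \<and>
           (\<forall>u\<in>Lam0 s p \<Omega>.
              Lp_norm p (frac_grad t u) \<le> C / t powr (1 + 1 / p) * Lp_norm p (frac_grad s u))"
proof -
  obtain R where R: "0 < R" "\<Omega> \<subseteq> ball 0 R" using bounded_subset_ballD[OF assms(2), of 0] by blast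
  obtain C where C: "0 < C" and comparison: "\<forall>s t (\<phi> :: 'a \<Rightarrow> real) Y. 0 < t \<and> t < s \<and> s \<le> 1 \<and> \<phi> \<in> Cc_infinity (ball 0 R) \<and> 0 \<le> Y \<and>
      (\<integral>\<^sup>+x. ennreal (norm (test_frac_grad s \<phi> x) powr p) \<partial>lborel) \<le> ennreal (Y powr p) \<longrightarrow>
    (\<integral>\<^sup>+x. ennreal (norm (test_frac_grad t \<phi> x) powr p) \<partial>lborel) \<le> ennreal ((C / t * Y) powr p)"
    using test_frac_grad_comparison[OF R(1) assms(3), where 'a='a] by (elim exE conjE)
  have "Lam0 s p \<Omega> \<subseteq> Lam0 t p \<Omega> \<and> (\<forall>u\<in>Lam0 s p \<Omega>.
      Lp_norm p (frac_grad t u) \<le> 4 * C / t powr (1 + 1 / p) * Lp_norm p (frac_grad s u))"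
    if st: "0 < t" "t < s" "s \<le> 1" for s t
  proof (intro conjI subsetI ballI)
    fix u assume u: "u \<in> Lam0 s p \<Omega>"
    have C': "0 < C / t" using C st by simp
    have cmp: "Lp_mass p (test_frac_grad t \<phi>) \<le> ennreal ((C / t * Y) powr p)"
      if "\<phi> \<in> Cc_infinity (ball 0 R)" "0 \<le> Y" "Lp_mass p (test_frac_grad s \<phi>) \<le> ennreal (Y powr p)" for \<phi> :: "'a \<Rightarrow> real" and Y
      using comparison st that unfolding Lp_mass_lborel by blast
    note tr = Lam0_transfer[OF R(2) assms(3) st C' cmp u]
    show "u \<in> Lam0 t p \<Omega>" by (rule tr(1))
    \<comment> \<open>Since \<open>t < 1\<close>, the factor \<open>1 / t\<close> is the smaller one.\<close>
    have "t powr (1 + 1 / p) \<le> t powr 1" using st assms(3) by (intro powr_mono') auto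
    hence "4 * (C / t) \<le> 4 * C / t powr (1 + 1 / p)" using st C by (simp add: frac_le)
    hence "4 * (C / t) * Lp_norm p (frac_grad s u) \<le> 4 * C / t powr (1 + 1 / p) * Lp_norm p (frac_grad s u)"
      by (intro mult_right_mono Lp_norm_nonneg)
    with tr(2) show "Lp_norm p (frac_grad t u) \<le> 4 * C / t powr (1 + 1 / p) * Lp_norm p (frac_grad s u)" by linarith
  qed
  moreover have "0 < 4 * C" using C by simp
  ultimately show ?thesis by blast
qed

end
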